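(* Let $m\ge 0$ and let $V=(V_{ij})_{i,j=1}^2$ be a $2\times2$ matrix-valued function on $\mathbb{R}$ (not assumed Hermitian) with $V_{ij}\in L^1(\mathbb{R})$ for $i,j=1,2$ such that $$\|V\|_1:=\int_{\mathbb{R}}\|V(x)\|\,dx<1 .$$ Let $H$ be the Dirac operator with potential $V$ (the closed extension of $H_0+V$ described in the context). Set $$x_0:=\sqrt{\frac{\|V\|_1^4-2\|V\|_1^2+2}{4(1-\|V\|_1^2)}+\frac12},\qquad r_0:=\sqrt{\frac{\|V\|_1^4-2\|V\|_1^2+2}{4(1-\|V\|_1^2)}-\frac12}.$$ Then the disks $K_{mr_0}(mx_0)$ and $K_{mr_0}(-mx_0)$ are disjoint and $$\sigma_{\rm d}(H)\subset K_{mr_0}(mx_0)\cup K_{mr_0}(-mx_0).$$ In particular, if $m=0$ (massless Dirac operator), then the spectrum of $H$ is $\mathbb{R}$.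
   Context: Units are chosen so that $\hbar=c=1$. The Hilbert space is $\mathcal{H}=L^2(\mathbb{R})\otimes\mathbb{C}^2=L^2(\mathbb{R};\mathbb{C}^2)$. The free Dirac operator is the selfadjoint operator $H_0=-i\frac{d}{dx}\sigma_1+m\sigma_3$ with domain $H^1(\mathbb{R};\mathbb{C}^2)$, where $\sigma_1=\begin{pmatrix}0&1\\1&0\end{pmatrix}$, $\sigma_3=\begin{pmatrix}1&0\\0&-1\end{pmatrix}$; $\sigma(H_0)=(-\infty,-m]\cup[m,\infty)$ and $R_0(z)=(H_0-z)^{-1}$. $\|V(x)\|$ is the operator norm of the matrix $V(x)$ on $\mathbb{C}^2$ with Euclidean norm; $V$ is identified with the closed maximal multiplication operator in $\mathcal{H}$. Definition of $H$: let $V=U|V|$ be the polar decomposition and $A:=|V|^{1/2}$, $B:=U|V|^{1/2}$, so $V=BA$. For $z\in\rho(H_0)$, $AR_0(z)$ is bounded and $R_0(z)B$, $AR_0(z)B$ have bounded closures; put $Q(z):=\overline{AR_0(z)B}$. Then $H$ is the closed densely defined extension of $H_0+V$ with $\rho(H)\cap\rho(H_0)=\{z\in\rho(H_0): -1\in\rho(Q(z))\}\neq\emptyset$ and, for $z$ in this set, $(H-z)^{-1}=R_0(z)-\overline{R_0(z)B}\,(I+Q(z))^{-1}AR_0(z)$. If $V$ is bounded, $H=H_0+V$ on the domain of $H_0$. $K_r(z_0)$ is the closed disk in $\mathbb{C}$ with centre $z_0$ and radius $r>0$; by convention $K_r(z_0)=\emptyset$ if $r=0$. For a closed operator $T$,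 $\sigma_{\rm d}(T)$ is the set of isolated eigenvalues of $T$ of finite multiplicity. *)

theory Defs
  imports "HOL-Analysis.Analysis"
begin

section \<open>Complex normed spaces\<close>

class complex_normed_vector = real_normed_vector +
  fixes scaleC :: "complex \<Rightarrow> 'a \<Rightarrow> 'a"  (infixr "*\<^sub>C" 75)
  assumes scaleC_add_right: "a *\<^sub>C (x + y) = a *\<^sub>C x + a *\<^sub>C y"
    and scaleC_add_left: "(a + b) *\<^sub>C x = a *\<^sub>C x + b *\<^sub>C x"
    and scaleC_scaleC: "a *\<^sub>C b *\<^sub>C x = (a * b) *\<^sub>C x"
    and scaleC_of_real: "complex_of_real r *\<^sub>C x = r *\<^sub>R x"
    and norm_scaleC: "norm (a *\<^sub>C x) = cmod a * norm x"

global_interpretation complex_vector: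
  vector_space "scaleC :: complex \<Rightarrow> 'a \<Rightarrow> 'a::complex_normed_vector"
proof
  show "1 *\<^sub>C x = x" for x :: 'a
    using scaleC_of_real[of 1 x] by simp
qed (simp_all add: scaleC_add_right scaleC_add_left scaleC_scaleC)

definition bounded_clinear :: "('a::complex_normed_vector \<Rightarrow> 'a) \<Rightarrow> bool" where
  "bounded_clinear F \<longleftrightarrow> bounded_linear F \<and> (\<forall>c x. F (c *\<^sub>C x) = c *\<^sub>C F x)"


section \<open>Unbounded operators\<close>

text \<open>An operator is identified with its graph, a set of pairs (argument, value).  Then the
  inverse is the converse relation, extension is inclusion, an operator is closed iff the set is
  closed in the product topology, and the closure of an operator is the closure of the set.\<close>

type_synonym 'a op = "('a \<times> 'a) set"

definition linear_op :: "'a::complex_normed_vector op \<Rightarrow> bool" where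
  "linear_op T \<longleftrightarrow> single_valued T \<and> (0, 0) \<in> T \<and>
     (\<forall>f g f' g'. (f, g) \<in> T \<and> (f', g') \<in> T \<longrightarrow> (f + f', g + g') \<in> T) \<and>
     (\<forall>c f g. (f, g) \<in> T \<longrightarrow> (c *\<^sub>C f, c *\<^sub>C g) \<in> T)"

definition op_of :: "('a \<Rightarrow> 'a) \<Rightarrow> 'a op" where
  "op_of F = {(f, F f) | f. True}"

definition op_add :: "'a::ab_group_add op \<Rightarrow> 'a op \<Rightarrow> 'a op" where
  "op_add S T = {(f, g + h) | f g h. (f, g) \<in> S \<and> (f, h) \<in> T}"

definition op_diff :: "'a::ab_group_add op \<Rightarrow> 'a op \<Rightarrow> 'a op" where
  "op_diff S T = {(f, g - h) | f g h. (f, g) \<in> S \<and> (f, h) \<in> T}"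

text \<open>Relational composition \<open>O\<close> is diagrammatic; \<open>S \<cdot>\<^sub>o T\<close> is the operator product
  \<open>f \<mapsto> S (T f)\<close> with domain \<open>{f \<in> D(T). T f \<in> D(S)}\<close>.\<close>

abbreviation op_comp :: "'a op \<Rightarrow> 'a op \<Rightarrow> 'a op"  (infixr "\<cdot>\<^sub>o" 75) where
  "S \<cdot>\<^sub>o T \<equiv> T O S"

definition op_shift :: "'a::complex_normed_vector op \<Rightarrow> complex \<Rightarrow> 'a op" where
  "op_shift T z = {(f, g - z *\<^sub>C f) | f g. (f, g) \<in> T}"

text \<open>\<open>resolvent T z\<close> is \<open>(T - z)\<^sup>-\<^sup>1\<close>; it is a bounded operator defined on the whole space
  precisely for \<open>z\<close> in the resolvent set.\<close>

definition resolvent :: "'a::complex_normed_vector op \<Rightarrow> complex \<Rightarrow> 'a op" where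
  "resolvent T z = converse (op_shift T z)"

definition resolvent_set :: "'a::complex_normed_vector op \<Rightarrow> complex set" where
  "resolvent_set T = {z. \<exists>R. bounded_clinear R \<and> resolvent T z = op_of R}"

definition spectrum :: "'a::complex_normed_vector op \<Rightarrow> complex set" where
  "spectrum T = - resolvent_set T"

definition eigenspace :: "'a::complex_normed_vector op \<Rightarrow> complex \<Rightarrow> 'a set" where
  "eigenspace T z = {f. (f, z *\<^sub>C f) \<in> T}"

text \<open>Multiplicity is the geometric one.  This is the weakest reading of finite multiplicity:
  eigenvalues of finite algebraic multiplicity are included.\<close>

definition discrete_spectrum :: "'a::complex_normed_vector op \<Rightarrow> complex set" where
  "discrete_spectrum T = {z. z isolated_in spectrum T \<and>
     (\<exists>f \<in> eigenspace T z. f \<noteq> 0) \<and>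
     (\<exists>E. finite E \<and> eigenspace T z \<subseteq> complex_vector.span E)}"


section \<open>The Hilbert space of square integrable spinors\<close>

definition square_integrable :: "(real \<Rightarrow> complex^2) \<Rightarrow> bool" where
  "square_integrable f \<longleftrightarrow>
     f \<in> borel_measurable lborel \<and> integrable lborel (\<lambda>x. (norm (f x))\<^sup>2)"

lemma square_integrable_0: "square_integrable (\<lambda>x. 0)"
  by (simp add: square_integrable_def)

lemma square_integrable_add:
  assumes "square_integrable f" "square_integrable g"
  shows "square_integrable (\<lambda>x. f x + g x)"
proof -
  have m [measurable]: "f \<in> borel_measurable lborel" "g \<in> borel_measurable lborel"
    using assms by (simp_all add: square_integrable_def)
  have "integrable lborel (\<lambda>x. 2 * (norm (f x))\<^sup>2 + 2 * (norm (g x))\<^sup>2)"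
    using assms by (simp add: square_integrable_def)
  moreover have "(norm (a + b))\<^sup>2 \<le> 2 * (norm a)\<^sup>2 + 2 * (norm b)\<^sup>2" for a b :: "complex^2"
  proof -
    have "(norm (a + b))\<^sup>2 \<le> (norm a + norm b)\<^sup>2"
      by (simp add: norm_triangle_ineq power_mono)
    also have "\<dots> \<le> 2 * (norm a)\<^sup>2 + 2 * (norm b)\<^sup>2"
      using sum_squares_bound[of "norm a" "norm b"] by (simp add: power2_sum)
    finally show ?thesis .
  qed
  ultimately have "integrable lborel (\<lambda>x. (norm (f x + g x))\<^sup>2)"
    by (elim Bochner_Integration.integrable_bound) (use m in \<open>auto intro!: AE_I2\<close>)
  then show ?thesis
    by (simp add: square_integrable_def)
qed

lemma norm_vector_scalar_mult: "norm (c *s v) = cmod c * norm v" for v :: "complex^'n"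
  by (simp add: norm_vec_def norm_mult L2_set_right_distrib)

lemma borel_measurable_vector_scalar_mult:
  fixes f :: "'a \<Rightarrow> complex^2"
  assumes "f \<in> borel_measurable M"
  shows "(\<lambda>x. c *s f x) \<in> borel_measurable M"
proof -
  have "linear (\<lambda>v. c *s v :: complex^2)"
    by (rule linearI) (auto simp: vec_eq_iff algebra_simps)
  then have "(\<lambda>v. c *s v :: complex^2) \<in> borel_measurable borel"
    by (intro borel_measurable_continuous_onI linear_continuous_on linear_conv_bounded_linear[THEN iffD1])
  from measurable_compose[OF assms this] show ?thesis .
qed

lemma square_integrable_scale:
  assumes "square_integrable f"
  shows "square_integrable (\<lambda>x. c *s f x)"
  using assms
  by (simp add: square_integrable_def borel_measurable_vector_scalar_mult
      norm_vector_scalar_mult power_mult_distrib)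

lemma scaleR_eq_vector_scalar_mult: "r *\<^sub>R v = complex_of_real r *s v" for v :: "complex^'n"
  by (simp add: vec_eq_iff complex_eq_iff)

lemma square_integrable_scaleR:
  assumes "square_integrable f"
  shows "square_integrable (\<lambda>x. r *\<^sub>R f x)"
  unfolding scaleR_eq_vector_scalar_mult by (rule square_integrable_scale[OF assms])

lemma square_integrable_minus:
  assumes "square_integrable f"
  shows "square_integrable (\<lambda>x. - f x)"
  using square_integrable_scaleR[OF assms, of "-1"] by simp

lemma square_integrable_diff:
  assumes "square_integrable f" "square_integrable g"
  shows "square_integrable (\<lambda>x. f x - g x)"
  using square_integrable_add[OF assms(1) square_integrable_minus[OF assms(2)]] by simp

lemma integrable_inner_square_integrable:
  assumes "square_integrable f" "square_integrable g"
  shows "integrable lborel (\<lambda>x. inner (f x) (g x))"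
proof -
  have m [measurable]: "f \<in> borel_measurable lborel" "g \<in> borel_measurable lborel"
    using assms by (simp_all add: square_integrable_def)
  have "integrable lborel (\<lambda>x. (norm (f x))\<^sup>2 + (norm (g x))\<^sup>2)"
    using assms by (simp add: square_integrable_def)
  moreover have "\<bar>inner a b\<bar> \<le> (norm a)\<^sup>2 + (norm b)\<^sup>2" for a b :: "complex^2"
  proof -
    have "\<bar>inner a b\<bar> \<le> norm a * norm b"
      by (rule Cauchy_Schwarz_ineq2)
    also have "\<dots> \<le> (norm a)\<^sup>2 + (norm b)\<^sup>2"
      using sum_squares_bound[of "norm a" "norm b"] mult_nonneg_nonneg[of "norm a" "norm b"]
      by (simp del: mult_nonneg_nonneg)
    finally show ?thesis .
  qed
  ultimately show ?thesis
    by (elim Bochner_Integration.integrable_bound) (use m in \<open>auto intro!: AE_I2\<close>)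
qed

definition l2_eq :: "(real \<Rightarrow> complex^2) \<Rightarrow> (real \<Rightarrow> complex^2) \<Rightarrow> bool" where
  "l2_eq f g \<longleftrightarrow> square_integrable f \<and> square_integrable g \<and> (AE x in lborel. f x = g x)"

quotient_type spinor = "real \<Rightarrow> complex^2" / partial: l2_eq
proof (rule part_equivpI)
  show "\<exists>x. l2_eq x x"
    by (rule exI[of _ "\<lambda>x. 0"]) (simp add: l2_eq_def square_integrable_0)
  show "symp l2_eq"
    by (auto intro!: sympI simp: l2_eq_def)
  show "transp l2_eq"
    by (auto intro!: transpI simp: l2_eq_def)
qed

instantiation spinor :: real_inner
begin

lift_definition zero_spinor :: spinor is "\<lambda>x. 0"
  by (simp add: l2_eq_def square_integrable_0)

lift_definition plus_spinor :: "spinor \<Rightarrow> spinor \<Rightarrow> spinor" is "\<lambda>f g x. f x + g x"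
  by (auto simp: l2_eq_def square_integrable_add)

lift_definition minus_spinor :: "spinor \<Rightarrow> spinor \<Rightarrow> spinor" is "\<lambda>f g x. f x - g x"
  by (auto simp: l2_eq_def square_integrable_diff)

lift_definition uminus_spinor :: "spinor \<Rightarrow> spinor" is "\<lambda>f x. - f x"
  by (auto simp: l2_eq_def square_integrable_minus)

lift_definition scaleR_spinor :: "real \<Rightarrow> spinor \<Rightarrow> spinor" is "\<lambda>r f x. r *\<^sub>R f x"
  by (auto simp: l2_eq_def square_integrable_scaleR)

text \<open>The inner product of \<open>complex^2\<close> in the library, hence also the one below, is the real
  part of the Hermitian inner product; it induces the same norm.\<close>

lift_definition inner_spinor :: "spinor \<Rightarrow> spinor \<Rightarrow> real"
  is "\<lambda>f g. LINT x|lborel. inner (f x) (g x)"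
  by (rule integral_cong_AE)
     (auto simp: l2_eq_def square_integrable_def intro!: borel_measurable_inner)

definition norm_spinor :: "spinor \<Rightarrow> real" where
  "norm_spinor f = sqrt (inner f f)"

definition sgn_spinor :: "spinor \<Rightarrow> spinor" where
  "sgn_spinor f = scaleR (inverse (norm f)) f"

definition dist_spinor :: "spinor \<Rightarrow> spinor \<Rightarrow> real" where
  "dist_spinor f g = norm (f - g)"

definition uniformity_spinor :: "(spinor \<times> spinor) filter" where
  "uniformity_spinor = (INF e\<in>{0<..}. principal {(f, g). dist f g < e})"

definition open_spinor :: "spinor set \<Rightarrow> bool" where
  "open_spinor U \<longleftrightarrow> (\<forall>f\<in>U. eventually (\<lambda>(f', g). f' = f \<longrightarrow> g \<in> U) uniformity)"

instance
proof
  fix f g h :: spinor and r s :: real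
  show "f + g + h = f + (g + h)" "f + g = g + f" "0 + f = f" "- f + f = 0" "f - g = f + - g"
    by (transfer, auto simp: l2_eq_def square_integrable_0 add.assoc add.commute
          intro: square_integrable_add square_integrable_diff square_integrable_minus)+
  show "r *\<^sub>R (f + g) = r *\<^sub>R f + r *\<^sub>R g" "(r + s) *\<^sub>R f = r *\<^sub>R f + s *\<^sub>R f"
    "r *\<^sub>R s *\<^sub>R f = (r * s) *\<^sub>R f" "1 *\<^sub>R f = f"
    by (transfer, auto simp: l2_eq_def algebra_simps
          intro: square_integrable_add square_integrable_scaleR)+
  show "inner f g = inner g f"
    by transfer (simp add: inner_commute)
  show "inner (f + g) h = inner f h + inner g h"
    by transfer (auto simp: inner_add_left l2_eq_def integrable_inner_square_integrable)
  show "inner (r *\<^sub>R f) g = r * inner f g"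
    by transfer simp
  show "0 \<le> inner f f"
    by transfer simp
  show "(inner f f = 0) = (f = 0)"
  proof transfer
    fix f assume f: "l2_eq f f"
    have "((LINT x|lborel. inner (f x) (f x)) = 0) = (AE x in lborel. inner (f x) (f x) = 0)"
      using f by (intro integral_nonneg_eq_0_iff_AE)
        (auto simp: l2_eq_def integrable_inner_square_integrable)
    then show "((LINT x|lborel. inner (f x) (f x)) = 0) = l2_eq f (\<lambda>x. 0)"
      using f by (simp add: l2_eq_def square_integrable_0)
  qed
qed (simp_all add: norm_spinor_def sgn_spinor_def dist_spinor_def uniformity_spinor_def
       open_spinor_def)

end

instantiation spinor :: complex_normed_vector
begin

lift_definition scaleC_spinor :: "complex \<Rightarrow> spinor \<Rightarrow> spinor" is "\<lambda>c f x. c *s f x"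
  by (auto simp: l2_eq_def square_integrable_scale)

lemma norm_scaleC_spinor: "norm (c *\<^sub>C f) = cmod c * norm f" for f :: spinor
proof -
  have "inner (c *\<^sub>C f) (c *\<^sub>C f) = (cmod c)\<^sup>2 * inner f f"
    by transfer (simp add: dot_square_norm norm_vector_scalar_mult power_mult_distrib)
  then show ?thesis
    by (simp add: norm_spinor_def real_sqrt_mult)
qed

instance
proof
  fix f g :: spinor and a b :: complex and r :: real
  show "a *\<^sub>C (f + g) = a *\<^sub>C f + a *\<^sub>C g" "(a + b) *\<^sub>C f = a *\<^sub>C f + b *\<^sub>C f"
    "a *\<^sub>C b *\<^sub>C f = (a * b) *\<^sub>C f" "complex_of_real r *\<^sub>C f = r *\<^sub>R f"
    by (transfer, auto simp: l2_eq_def vec_eq_iff algebra_simps scaleR_eq_vector_scalar_mult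
          intro: square_integrable_add square_integrable_scale)+
qed (rule norm_scaleC_spinor)

end

text \<open>For \<open>square_integrable f\<close>, \<open>abs_spinor f\<close> is the class of \<open>f\<close> modulo null sets.\<close>


section \<open>The Dirac operator\<close>

definition sigma1 :: "complex^2^2" where
  "sigma1 = vector [vector [0, 1], vector [1, 0]]"

definition sigma3 :: "complex^2^2" where
  "sigma3 = vector [vector [1, 0], vector [0, -1]]"

text \<open>\<open>f\<close> is absolutely continuous with (almost everywhere defined) derivative \<open>f'\<close>; for locally
  integrable \<open>f'\<close> this is the statement that \<open>f\<close> is the continuous representative of a function
  with weak derivative \<open>f'\<close>.\<close>

definition ac_with_derivative :: "(real \<Rightarrow> complex^2) \<Rightarrow> (real \<Rightarrow> complex^2) \<Rightarrow> bool" where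
  "ac_with_derivative f f' \<longleftrightarrow> (\<forall>a b. a \<le> b \<longrightarrow>
     set_integrable lborel {a..b} f' \<and> f b - f a = (LINT x:{a..b}|lborel. f' x))"

text \<open>The domain is \<open>H\<^sup>1\<close>: the classes of absolutely continuous functions in \<open>L\<^sup>2\<close> with
  derivative in \<open>L\<^sup>2\<close>.\<close>

definition free_dirac :: "real \<Rightarrow> spinor op" where
  "free_dirac m = {(abs_spinor f,
      abs_spinor (\<lambda>x. (- \<i>) *s (sigma1 *v f' x) + complex_of_real m *s (sigma3 *v f x))) | f f'.
     square_integrable f \<and> square_integrable f' \<and> ac_with_derivative f f'}"

definition mult_op :: "(real \<Rightarrow> complex^2^2) \<Rightarrow> spinor op" where
  "mult_op W = {(abs_spinor f, abs_spinor g) | f g.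
     square_integrable f \<and> square_integrable g \<and> (AE x in lborel. g x = W x *v f x)}"

definition mat_adjoint :: "complex^'n^'n \<Rightarrow> complex^'n^'n" where
  "mat_adjoint M = (\<chi> i j. cnj (M $ j $ i))"

text \<open>For Hermitian \<open>M\<close> the form is real, so the real inner product suffices.\<close>

definition mat_psd :: "complex^'n^'n \<Rightarrow> bool" where
  "mat_psd M \<longleftrightarrow> mat_adjoint M = M \<and> (\<forall>v. 0 \<le> inner v (M *v v))"

definition mat_sqrt :: "complex^'n^'n \<Rightarrow> complex^'n^'n" where
  "mat_sqrt M = (THE P. mat_psd P \<and> P ** P = M)"

definition mat_abs :: "complex^'n^'n \<Rightarrow> complex^'n^'n" where
  "mat_abs M = mat_sqrt (mat_adjoint M ** M)"

text \<open>The partial isometry in the polar decomposition.\<close>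

definition mat_phase :: "complex^'n^'n \<Rightarrow> complex^'n^'n" where
  "mat_phase M = (THE U. M = U ** mat_abs M \<and> U ** mat_adjoint U ** U = U \<and>
     (\<forall>v. U *v v = 0 \<longleftrightarrow> M *v v = 0))"

definition op_A :: "(real \<Rightarrow> complex^2^2) \<Rightarrow> spinor op" where
  "op_A V = mult_op (\<lambda>x. mat_sqrt (mat_abs (V x)))"

definition op_B :: "(real \<Rightarrow> complex^2^2) \<Rightarrow> spinor op" where
  "op_B V = mult_op (\<lambda>x. mat_phase (V x) ** mat_sqrt (mat_abs (V x)))"

definition op_Q :: "real \<Rightarrow> (real \<Rightarrow> complex^2^2) \<Rightarrow> complex \<Rightarrow> spinor op" where
  "op_Q m V z = closure (op_A V \<cdot>\<^sub>o resolvent (free_dirac m) z \<cdot>\<^sub>o op_B V)"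

text \<open>\<open>resolvent (op_Q m V z) (-1)\<close> is \<open>(I + Q(z))\<^sup>-\<^sup>1\<close>.  At most one \<open>H\<close> satisfies the predicate: an
  operator is determined by its resolvent at a single point, and the set of points where the
  resolvent is prescribed is nonempty.\<close>

definition is_dirac_operator :: "real \<Rightarrow> (real \<Rightarrow> complex^2^2) \<Rightarrow> spinor op \<Rightarrow> bool" where
  "is_dirac_operator m V H \<longleftrightarrow>
     linear_op H \<and> closed H \<and> closure (Domain H) = UNIV \<and>
     op_add (free_dirac m) (mult_op V) \<subseteq> H \<and>
     resolvent_set H \<inter> resolvent_set (free_dirac m) =
       {z \<in> resolvent_set (free_dirac m). - 1 \<in> resolvent_set (op_Q m V z)} \<and>
     resolvent_set H \<inter> resolvent_set (free_dirac m) \<noteq> {} \<and>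
     (\<forall>z \<in> resolvent_set H \<inter> resolvent_set (free_dirac m).
        resolvent H z = op_diff (resolvent (free_dirac m) z)
          (closure (resolvent (free_dirac m) z \<cdot>\<^sub>o op_B V) \<cdot>\<^sub>o
           resolvent (op_Q m V z) (- 1) \<cdot>\<^sub>o op_A V \<cdot>\<^sub>o resolvent (free_dirac m) z))"

text \<open>\<open>onorm\<close> is taken with respect to the Euclidean norm of \<open>complex^2\<close>.\<close>

definition potential_norm :: "(real \<Rightarrow> complex^2^2) \<Rightarrow> real" where
  "potential_norm V = (LINT x|lborel. onorm (\<lambda>v. V x *v v))"

text \<open>By convention the disk of radius 0 is empty, not a point.\<close>

definition closed_disk :: "real \<Rightarrow> complex \<Rightarrow> complex set" where
  "closed_disk r z\<^sub>0 = (if r = 0 then {} else cball z\<^sub>0 r)"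

end

theory Submission
  imports Defs
begin

text \<open>The free resolvent has the kernel
  \<open>\<i>/2 ((\<zeta>, s), (s, 1/\<zeta>)) e\<^bsup>\<i>k|x - y|\<^esup>\<close> with \<open>k\<^sup>2 = z\<^sup>2 - m\<^sup>2\<close>, \<open>Im k > 0\<close>, \<open>\<zeta> = (z + m)/k\<close> and
  \<open>s = sgn (x - y)\<close>. This matrix has rank one and norm at most \<open>(|\<zeta>| + 1/|\<zeta>|)/2\<close>, so by Cauchy-Schwarz
  the Birman-Schwinger operator satisfies \<open>\<parallel>Q(z)\<parallel> \<le> \<parallel>V\<parallel>\<^sub>1 (|\<zeta>| + 1/|\<zeta>|)/2\<close>. The bound is less than 1
  precisely outside the two disks, and there a Neumann series puts \<open>z\<close> into the resolvent set of \<open>H\<close>.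
  Real \<open>z\<close> with \<open>|z| \<ge> m\<close> outside the disks are not isolated: all such points lie in the
  spectrum of \<open>H\<close>, by a Weyl sequence of wave packets that escape to infinity.\<close>

section \<open>Square integrable spinors\<close>

text \<open>Two obstacles shape the proof. First, V is only integrable, so a wave packet g need not
  lie in the domain of V and H cannot simply be applied to it. The Weyl argument is therefore run on
  resolvents: at z = l + ie, just off the axis, the formula for (H - z)^{-1} is available, and its
  correction term is small on (H_0 - z) g because it starts with A g, which tends to 0 as the packet
  moves away. This needs the estimate of Q(z) for all small e > 0, hence a point l with a
  neighbourhood outside the closed disks. Second, there are inverses, closures and products of
  unbounded operators that are not known in advance to be single-valued, and |V|^{1/2} and U are
  given by definite descriptions. The former are treated as linear relations, for which a norm bound
  yields single-valuedness. For the latter, closed formulas in the matrix entries serve to prove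
  existence and uniqueness and also make measurability evident.\<close>

lemma l2_eq_refl: "square_integrable f \<Longrightarrow> l2_eq f f"
  by (simp add: l2_eq_def)

lemma spinor_cases:
  obtains f where "square_integrable f" "F = abs_spinor f"
  by (induction F rule: spinor.abs_induct) (auto simp: l2_eq_def)

lemma abs_spinor_eq_iff:
  assumes "square_integrable f" "square_integrable g"
  shows "abs_spinor f = abs_spinor g \<longleftrightarrow> (AE x in lborel. f x = g x)"
  using Quotient3_rel[OF Quotient3_spinor, of f g] assms by (auto simp: l2_eq_def)

lemma abs_spinor_add:
  "square_integrable f \<Longrightarrow> square_integrable g \<Longrightarrow>
    abs_spinor f + abs_spinor g = abs_spinor (\<lambda>x. f x + g x)"
  by (simp add: plus_spinor.abs_eq l2_eq_refl)

lemma abs_spinor_diff: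
  "square_integrable f \<Longrightarrow> square_integrable g \<Longrightarrow>
    abs_spinor f - abs_spinor g = abs_spinor (\<lambda>x. f x - g x)"
  by (simp add: minus_spinor.abs_eq l2_eq_refl)

lemma abs_spinor_scaleC:
  "square_integrable f \<Longrightarrow> c *\<^sub>C abs_spinor f = abs_spinor (\<lambda>x. c *s f x)"
  by (simp add: scaleC_spinor.abs_eq l2_eq_refl)

lemma norm_abs_spinor_power2:
  assumes "square_integrable f"
  shows "(norm (abs_spinor f))\<^sup>2 = (LINT x|lborel. (norm (f x))\<^sup>2)"
proof -
  have "(norm (abs_spinor f))\<^sup>2 = inner (abs_spinor f) (abs_spinor f)"
    by (rule power2_norm_eq_inner)
  also have "\<dots> = (LINT x|lborel. inner (f x) (f x))"
    using assms by (intro inner_spinor.abs_eq l2_eq_refl)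
  finally show ?thesis
    by (simp add: dot_square_norm)
qed

text \<open>Norm estimates are passed through \<open>nn_integral\<close>, where Tonelli and
  Cauchy-Schwarz hold without integrability side conditions.\<close>

lemma norm_abs_spinor_le:
  assumes "square_integrable f" and "0 \<le> c" and "(\<integral>\<^sup>+x. ennreal ((norm (f x))\<^sup>2) \<partial>lborel) \<le> ennreal (c\<^sup>2)"
  shows "norm (abs_spinor f) \<le> c"
proof -
  have "ennreal ((norm (abs_spinor f))\<^sup>2) = (\<integral>\<^sup>+x. ennreal ((norm (f x))\<^sup>2) \<partial>lborel)"
    unfolding norm_abs_spinor_power2[OF assms(1)]
    using assms(1) by (subst nn_integral_eq_integral) (auto simp: square_integrable_def)
  with assms(3) have "(norm (abs_spinor f))\<^sup>2 \<le> c\<^sup>2"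
    by (metis ennreal_le_iff zero_le_power2)
  with assms(2) show ?thesis
    by (rule power2_le_imp_le[rotated])
qed

lemma square_integrableI:
  assumes "f \<in> borel_measurable lborel" "(\<integral>\<^sup>+x. ennreal ((norm (f x))\<^sup>2) \<partial>lborel) < \<infinity>"
  shows "square_integrable f"
  using assms by (auto simp: square_integrable_def intro!: integrableI_bounded)

lemma square_integrable_nn_integral:
  assumes "square_integrable f"
  shows "(\<integral>\<^sup>+x. ennreal ((norm (f x))\<^sup>2) \<partial>lborel) = ennreal ((norm (abs_spinor f))\<^sup>2)"
  unfolding norm_abs_spinor_power2[OF assms]
  using assms by (subst nn_integral_eq_integral) (auto simp: square_integrable_def)

text \<open>The weights \<open>4\<^sup>n\<close> in \<open>S\<close> make a single integrable function dominate all tails: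
  \<open>|g - f\<^sub>n|\<^sup>2 \<le> 4 * 4\<^sup>-\<^sup>n * S\<close>.\<close>

lemma rapidly_Cauchy_abs_spinor_converges:
  fixes f :: "nat \<Rightarrow> real \<Rightarrow> complex^2"
  assumes f: "\<And>n. square_integrable (f n)"
    and le: "\<And>n. norm (abs_spinor (f (Suc n)) - abs_spinor (f n)) \<le> (1/4) ^ n"
  shows "\<exists>g. square_integrable g \<and> (\<lambda>n. abs_spinor (f n)) \<longlonglongrightarrow> abs_spinor g"
proof -
  have meas [measurable]: "f n \<in> borel_measurable borel" for n
    using f by (simp add: square_integrable_def)
  have "((2::real) ^ k)\<^sup>2 = (2 * 2) ^ k" "((1/2::real) ^ k)\<^sup>2 = (1/2 * (1/2)) ^ k" for k
    by (simp_all only: power_mult_distrib power2_eq_square)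
  then have four: "((2::real) ^ k)\<^sup>2 = 4 ^ k" "((1/2::real) ^ k)\<^sup>2 = (1/4) ^ k" for k
    by simp_all
  have le_suminf: "h k \<le> suminf h" for h :: "nat \<Rightarrow> ennreal" and k
    using sum_le_suminf[of h "{k}"] by simp
  define d where "d n x = norm (f (Suc n) x - f n x)" for n x
  have [measurable]: "d n \<in> borel_measurable borel" for n
    unfolding d_def by measurable
  define S where "S x = (\<Sum>n. ennreal (4 ^ n * (d n x)\<^sup>2))" for x
  have [measurable]: "S \<in> borel_measurable borel"
    unfolding S_def by measurable
  have "(\<integral>\<^sup>+x. S x \<partial>lborel) = (\<Sum>n. \<integral>\<^sup>+x. ennreal (4 ^ n * (d n x)\<^sup>2) \<partial>lborel)"
    unfolding S_def by (subst nn_integral_suminf) auto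
  also have "\<dots> \<le> (\<Sum>n. ennreal ((1/4) ^ n))"
  proof (intro suminf_le summableI)
    fix n
    have "(\<integral>\<^sup>+x. ennreal (4 ^ n * (d n x)\<^sup>2) \<partial>lborel) = 4 ^ n * (\<integral>\<^sup>+x. ennreal ((norm (f (Suc n) x - f n x))\<^sup>2) \<partial>lborel)"
      unfolding d_def by (subst nn_integral_cmult[symmetric]) (auto simp: ennreal_mult ennreal_power ennreal_numeral[symmetric] simp del: ennreal_numeral)
    also have "\<dots> = 4 ^ n * ennreal ((norm (abs_spinor (f (Suc n)) - abs_spinor (f n)))\<^sup>2)"
      by (subst square_integrable_nn_integral) (auto intro: square_integrable_diff f simp: abs_spinor_diff f)
    also have "\<dots> \<le> 4 ^ n * ennreal (((1/4) ^ n)\<^sup>2)"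
      by (intro mult_left_mono ennreal_leI power_mono le) auto
    also have "\<dots> = ennreal (4 ^ n * ((1/4) ^ n)\<^sup>2)"
      by (simp add: ennreal_mult ennreal_power ennreal_numeral[symmetric] del: ennreal_numeral)
    also have "4 ^ n * ((1/4) ^ n)\<^sup>2 = (4 * (1/4 * (1/4)) :: real) ^ n"
      by (simp only: power_mult_distrib power2_eq_square)
    also have "(4 * (1/4 * (1/4)) :: real) = 1/4"
      by simp
    finally show "(\<integral>\<^sup>+x. ennreal (4 ^ n * (d n x)\<^sup>2) \<partial>lborel) \<le> ennreal ((1/4) ^ n)" .
  qed
  also have "\<dots> = ennreal (\<Sum>n. (1/4) ^ n)"
    by (intro suminf_ennreal_eq summable_sums summable_geometric) auto
  finally have S: "(\<integral>\<^sup>+x. S x \<partial>lborel) < \<infinity>"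
    using ennreal_less_top by (simp add: le_less_trans)
  then have AE: "AE x in lborel. S x \<noteq> \<infinity>"
    by (intro nn_integral_noteq_infinite) auto
  \<comment> \<open>Where \<open>S x\<close> is finite, \<open>f n x\<close> converges; elsewhere,
    on a null set, the default 0 does not affect the class of \<open>g\<close>.\<close>
  define g where "g x = (if S x = \<infinity> then 0 else lim (\<lambda>n. f n x))" for x
  have [measurable]: "g \<in> borel_measurable borel"
    unfolding g_def by measurable
  have key: "(norm (g x - f n x))\<^sup>2 \<le> 4 * (1/4) ^ n * enn2real (S x)" if "S x \<noteq> \<infinity>" for n x
  proof -
    define s where "s = sqrt (enn2real (S x))"
    have s: "0 \<le> s" "s\<^sup>2 = enn2real (S x)"
      by (auto simp: s_def)
    have Ss: "S x = ennreal (s\<^sup>2)"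
      using that s by (simp add: ennreal_enn2real_if)
    have dle: "d k x \<le> s * (1/2) ^ k" for k
    proof -
      have "ennreal (4 ^ k * (d k x)\<^sup>2) \<le> S x"
        unfolding S_def by (rule le_suminf)
      then have "4 ^ k * (d k x)\<^sup>2 \<le> s\<^sup>2"
        unfolding Ss by (metis ennreal_le_iff zero_le_power2)
      then have "(2 ^ k * d k x)\<^sup>2 \<le> s\<^sup>2"
        by (simp add: power_mult_distrib four)
      then have "2 ^ k * d k x \<le> s"
        using s(1) by (rule power2_le_imp_le)
      then show ?thesis
        by (simp add: field_simps power_divide)
    qed
    have sm: "summable (\<lambda>k. s * (1/2::real) ^ k)"
      by (intro summable_mult summable_geometric) auto
    have sd: "summable (\<lambda>k. norm (f (Suc k) x - f k x))"
      by (rule summable_comparison_test'[OF sm]) (use dle in \<open>auto simp: d_def\<close>)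
    then have "summable (\<lambda>k. f (Suc k) x - f k x)"
      by (rule summable_norm_cancel)
    then have "convergent (\<lambda>n. \<Sum>k<n. f (Suc k) x - f k x)"
      by (simp add: summable_iff_convergent)
    then have "convergent (\<lambda>n. f n x - f 0 x)"
      using sum_lessThan_telescope[of "\<lambda>n. f n x"] by simp
    then obtain L where "(\<lambda>n. f n x - f 0 x) \<longlonglongrightarrow> L"
      by (auto simp: convergent_def)
    from tendsto_add[OF this tendsto_const[of "f 0 x"]]
    have "convergent (\<lambda>n. f n x)"
      by (auto simp: convergent_def)
    then have lim: "(\<lambda>n. f n x) \<longlonglongrightarrow> g x"
      using that by (simp add: g_def convergent_LIMSEQ_iff)
    have "norm (f (n + j) x - f n x) \<le> 2 * (1/2) ^ n * s" for j
    proof -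
      have "norm (f (n + j) x - f n x) \<le> (\<Sum>k<j. d (n + k) x)"
      proof (induction j)
        case (Suc j)
        have "norm (f (n + Suc j) x - f n x) \<le> norm (f (n + j) x - f n x) + d (n + j) x"
          using norm_triangle_ineq[of "f (n + j) x - f n x" "f (Suc (n + j)) x - f (n + j) x"] by (simp add: d_def)
        with Suc show ?case by simp
      qed simp
      also have "\<dots> \<le> (\<Sum>k<j. s * (1/2) ^ n * (1/2) ^ k)"
        by (intro sum_mono order.trans[OF dle]) (simp add: power_add)
      also have "\<dots> = s * (1/2) ^ n * (\<Sum>k<j. (1/2) ^ k)"
        by (simp add: sum_distrib_left)
      also have "\<dots> \<le> s * (1/2) ^ n * 2"
        using s(1) by (intro mult_left_mono) (simp_all add: geometric_sum)
      finally show ?thesis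
        using s(1) by (simp add: mult_ac)
    qed
    moreover have "(\<lambda>j. norm (f (n + j) x - f n x)) \<longlonglongrightarrow> norm (g x - f n x)"
      using LIMSEQ_ignore_initial_segment[OF lim, of n] by (intro tendsto_intros) (simp add: add.commute)
    ultimately have "norm (g x - f n x) \<le> 2 * (1/2) ^ n * s"
      by (meson LIMSEQ_le_const2)
    then have "(norm (g x - f n x))\<^sup>2 \<le> (2 * (1/2) ^ n * s)\<^sup>2"
      by (intro power_mono) auto
    also have "\<dots> = 4 * (1/4) ^ n * s\<^sup>2"
      by (simp add: power_mult_distrib four del: power_divide)
    finally show ?thesis by (simp add: s(2))
  qed
  define I where "I = enn2real (\<integral>\<^sup>+x. S x \<partial>lborel)"
  have I: "(\<integral>\<^sup>+x. S x \<partial>lborel) = ennreal I" "I \<ge> 0"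
    using S by (auto simp: I_def ennreal_enn2real_if)
  have int: "(\<integral>\<^sup>+x. ennreal ((norm (g x - f n x))\<^sup>2) \<partial>lborel) \<le> ennreal (4 * (1/4) ^ n * I)" for n
  proof -
    have "(\<integral>\<^sup>+x. ennreal ((norm (g x - f n x))\<^sup>2) \<partial>lborel) \<le> (\<integral>\<^sup>+x. ennreal (4 * (1/4) ^ n) * S x \<partial>lborel)"
    proof (intro nn_integral_mono_AE, use AE in eventually_elim)
      case (elim x)
      have "ennreal ((norm (g x - f n x))\<^sup>2) \<le> ennreal (4 * (1/4) ^ n * enn2real (S x))"
        by (intro ennreal_leI key) (use elim in auto)
      then show ?case
        using elim by (simp add: ennreal_mult ennreal_enn2real_if)
    qed
    also have "\<dots> = ennreal (4 * (1/4) ^ n * I)"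
      by (subst nn_integral_cmult) (auto simp: I ennreal_mult)
    finally show ?thesis .
  qed
  have gf: "square_integrable (\<lambda>x. g x - f n x)" for n
    by (rule square_integrableI) (use int[of n] in \<open>auto simp: le_less_trans\<close>)
  from square_integrable_add[OF gf[of 0] f[of 0]] have g: "square_integrable g" by simp
  have "norm (abs_spinor (f n) - abs_spinor g) \<le> (1/2) ^ n * (2 * sqrt I)" for n
  proof -
    have "norm (abs_spinor (\<lambda>x. g x - f n x)) \<le> (1/2) ^ n * (2 * sqrt I)"
      using int[of n] I(2) by (intro norm_abs_spinor_le gf)
        (auto simp: power_mult_distrib four mult_ac simp del: power_divide)
    then show ?thesis
      by (subst norm_minus_commute) (simp add: abs_spinor_diff g f)
  qed
  moreover have "(\<lambda>n. (1/2) ^ n * (2 * sqrt I)) \<longlonglongrightarrow> 0"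
    by (intro tendsto_mult_left_zero LIMSEQ_power_zero) auto
  ultimately have "(\<lambda>n. abs_spinor (f n) - abs_spinor g) \<longlonglongrightarrow> 0"
    by (intro Lim_null_comparison[of "\<lambda>n. abs_spinor (f n) - abs_spinor g"]) (auto intro!: always_eventually)
  with g show ?thesis
    using LIM_zero_iff by blast
qed

text \<open>Completeness is what lets a bounded densely defined operator be closed to a total one
  and the equation (I + Q) f = h be solved. A Cauchy sequence has a subsequence with steps at most
  4^-k, to which the preceding lemma applies.\<close>

instance spinor :: complete_space
proof
  fix X :: "nat \<Rightarrow> spinor"
  assume C: "Cauchy X"
  have "\<exists>N. \<forall>m\<ge>N. \<forall>n\<ge>N. norm (X m - X n) < (1/4) ^ k" for k
    using CauchyD[OF C, of "(1/4) ^ k"] by auto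
  then obtain N where N: "\<And>k m n. m \<ge> N k \<Longrightarrow> n \<ge> N k \<Longrightarrow> norm (X m - X n) < (1/4) ^ k"
    by metis
  \<comment> \<open>The partial sums dominate each \<open>N k\<close>, and the summand
    \<open>k\<close> makes \<open>r\<close> strictly increasing.\<close>
  define r where "r k = k + (\<Sum>i\<le>k. N i)" for k
  have r: "N k \<le> r k" "r k < r (Suc k)" for k
    using member_le_sum[of k "{..k}" N] by (auto simp: r_def)
  then have "strict_mono r"
    by (simp add: strict_mono_Suc_iff)
  have "\<exists>f. square_integrable f \<and> X (r k) = abs_spinor f" for k
    by (metis spinor_cases)
  then obtain f where f: "\<And>k. square_integrable (f k)" "\<And>k. X (r k) = abs_spinor (f k)"
    by metis
  have "norm (abs_spinor (f (Suc n)) - abs_spinor (f n)) \<le> (1/4) ^ n" for n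
    unfolding f(2)[symmetric] using N[of n "r (Suc n)" "r n"] r[of n] by (simp add: less_imp_le)
  from rapidly_Cauchy_abs_spinor_converges[OF f(1) this]
  obtain g where "(\<lambda>k. X (r k)) \<longlonglongrightarrow> abs_spinor g"
    by (auto simp: f(2))
  with C \<open>strict_mono r\<close> have "X \<longlonglongrightarrow> abs_spinor g"
    by (intro Cauchy_converges_subseq[of X r]) (auto simp: o_def)
  then show "convergent X"
    by (auto simp: convergent_def)
qed

section \<open>Linear relations\<close>

text \<open>\<open>linear_op\<close> without single-valuedness: this class is stable under converse
  and closure, and a norm bound restores single-valuedness where it is wanted.\<close>

definition linear_rel :: "'a::complex_normed_vector op \<Rightarrow> bool" where
  "linear_rel T \<longleftrightarrow> (0, 0) \<in> T \<and>
     (\<forall>f g f' g'. (f, g) \<in> T \<and> (f', g') \<in> T \<longrightarrow> (f + f', g + g') \<in> T) \<and>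
     (\<forall>c f g. (f, g) \<in> T \<longrightarrow> (c *\<^sub>C f, c *\<^sub>C g) \<in> T)"

definition bounded_rel :: "real \<Rightarrow> 'a::real_normed_vector op \<Rightarrow> bool" where
  "bounded_rel C T \<longleftrightarrow> (\<forall>(f, g) \<in> T. norm g \<le> C * norm f)"

lemma bounded_relD: "bounded_rel C T \<Longrightarrow> (f, g) \<in> T \<Longrightarrow> norm g \<le> C * norm f"
  by (auto simp: bounded_rel_def)

lemma linear_rel_add: "linear_rel T \<Longrightarrow> (f, g) \<in> T \<Longrightarrow> (f', g') \<in> T \<Longrightarrow> (f + f', g + g') \<in> T"
  and linear_rel_scale: "linear_rel T \<Longrightarrow> (f, g) \<in> T \<Longrightarrow> (c *\<^sub>C f, c *\<^sub>C g) \<in> T"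
  and linear_rel_zero: "linear_rel T \<Longrightarrow> (0, 0) \<in> T"
  by (auto simp: linear_rel_def)

lemma scaleC_minus_one: "(- 1) *\<^sub>C f = - f" for f :: "'a::complex_normed_vector"
  using scaleC_of_real[of "-1" f] by simp

lemma linear_rel_diff:
  assumes "linear_rel T" "(f, g) \<in> T" "(f', g') \<in> T"
  shows "(f - f', g - g') \<in> T"
  using linear_rel_add[OF assms(1,2) linear_rel_scale[OF assms(1,3), of "-1"]]
  by (simp add: scaleC_minus_one)

lemma linear_rel_converse: "linear_rel T \<Longrightarrow> linear_rel (converse T)"
  by (auto simp: linear_rel_def)

lemma linear_rel_comp: "linear_rel S \<Longrightarrow> linear_rel T \<Longrightarrow> linear_rel (S \<cdot>\<^sub>o T)"
  unfolding linear_rel_def by (fast intro: relcompI elim: relcompE)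

lemma mem_op_shift_iff: "(f, g) \<in> op_shift T z \<longleftrightarrow> (f, g + z *\<^sub>C f) \<in> T"
  by (force simp: op_shift_def)

lemma mem_resolvent_iff: "(f, g) \<in> resolvent T z \<longleftrightarrow> (g, f + z *\<^sub>C g) \<in> T"
  by (simp add: resolvent_def mem_op_shift_iff)

lemma linear_rel_shift:
  assumes "linear_rel T"
  shows "linear_rel (op_shift T z)"
proof -
  have eq: "g + g' + z *\<^sub>C (f + f') = (g + z *\<^sub>C f) + (g' + z *\<^sub>C f')"
    "c *\<^sub>C g + z *\<^sub>C c *\<^sub>C f = c *\<^sub>C (g + z *\<^sub>C f)" for f f' g g' :: 'a and c
    by (simp_all add: scaleC_add_right scaleC_scaleC mult.commute)
  have "(0, 0 + z *\<^sub>C 0) \<in> T"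
    using assms by (simp add: linear_rel_zero)
  then show ?thesis
    unfolding linear_rel_def mem_op_shift_iff eq
    using linear_rel_add[OF assms] linear_rel_scale[OF assms] by blast
qed

lemma linear_rel_resolvent: "linear_rel T \<Longrightarrow> linear_rel (resolvent T z)"
  unfolding resolvent_def by (intro linear_rel_converse linear_rel_shift)

lemma tendsto_scaleC:
  fixes f :: "'b \<Rightarrow> 'a::complex_normed_vector"
  assumes "(f \<longlongrightarrow> l) F"
  shows "((\<lambda>x. c *\<^sub>C f x) \<longlongrightarrow> c *\<^sub>C l) F"
proof -
  have "((\<lambda>x. cmod c * norm (f x - l)) \<longlongrightarrow> 0) F"
    using assms by (intro tendsto_mult_right_zero) (simp add: LIM_zero tendsto_norm_zero)
  then have "((\<lambda>x. norm (c *\<^sub>C f x - c *\<^sub>C l)) \<longlongrightarrow> 0) F"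
    by (simp add: norm_scaleC flip: complex_vector.scale_right_diff_distrib)
  then show ?thesis
    by (rule LIM_zero_cancel[OF tendsto_norm_zero_cancel])
qed

lemma linear_rel_closure:
  assumes "linear_rel T"
  shows "linear_rel (closure T)"
  unfolding linear_rel_def
proof (intro conjI allI impI)
  show "(0, 0) \<in> closure T"
    using linear_rel_zero[OF assms] closure_subset by blast
  fix f g f' g'
  assume "(f, g) \<in> closure T \<and> (f', g') \<in> closure T"
  then obtain a b where "\<And>n. a n \<in> T" "a \<longlonglongrightarrow> (f, g)" "\<And>n. b n \<in> T" "b \<longlonglongrightarrow> (f', g')"
    by (auto simp: closure_sequential)
  moreover from this have "a n + b n \<in> T" for n
    using linear_rel_add[OF assms] by (metis add_Pair prod.collapse)
  moreover from calculation have "(\<lambda>n. a n + b n) \<longlonglongrightarrow> (f + f', g + g')"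
    using tendsto_add[of a "(f, g)" sequentially b "(f', g')"] by simp
  ultimately show "(f + f', g + g') \<in> closure T"
    unfolding closure_sequential by (intro exI[of _ "\<lambda>n. a n + b n"]) simp
next
  fix c f g
  assume "(f, g) \<in> closure T"
  then obtain a where a: "\<And>n. a n \<in> T" "a \<longlonglongrightarrow> (f, g)"
    by (auto simp: closure_sequential)
  then have "\<And>n. (c *\<^sub>C fst (a n), c *\<^sub>C snd (a n)) \<in> T"
    using linear_rel_scale[OF assms] by (metis prod.collapse)
  moreover have "(\<lambda>n. (c *\<^sub>C fst (a n), c *\<^sub>C snd (a n))) \<longlonglongrightarrow> (c *\<^sub>C f, c *\<^sub>C g)"
    using tendsto_fst[OF a(2)] tendsto_snd[OF a(2)] by (intro tendsto_Pair tendsto_scaleC) simp_all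
  ultimately show "(c *\<^sub>C f, c *\<^sub>C g) \<in> closure T"
    unfolding closure_sequential
    by (intro exI[of _ "\<lambda>n. (c *\<^sub>C fst (a n), c *\<^sub>C snd (a n))"]) simp
qed

text \<open>The inequality cuts out a closed set of pairs, so the constant survives unchanged. In
  this way a bound below 1 reaches \<open>op_Q\<close>, which is defined as a closure.\<close>

lemma bounded_rel_closure:
  assumes "bounded_rel C T"
  shows "bounded_rel C (closure T)"
proof -
  have "closed {p :: 'a \<times> 'a. norm (snd p) \<le> C * norm (fst p)}"
    by (intro closed_Collect_le continuous_intros)
  moreover have "T \<subseteq> {p. norm (snd p) \<le> C * norm (fst p)}"
    using assms by (auto simp: bounded_rel_def)
  ultimately have "closure T \<subseteq> {p. norm (snd p) \<le> C * norm (fst p)}"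
    by (rule closure_minimal[rotated])
  then show ?thesis
    by (auto simp: bounded_rel_def)
qed

text \<open>Two values at one argument differ by a value at 0, which the bound forces to vanish;
  totality then gives a function.\<close>

lemma linear_rel_bounded_eq_op_of:
  assumes "linear_rel T" "bounded_rel C T" "Domain T = UNIV"
  shows "\<exists>F. bounded_clinear F \<and> T = op_of F"
proof -
  have "\<exists>g. (f, g) \<in> T" for f
    using assms(3) by blast
  then obtain F where F: "\<And>f. (f, F f) \<in> T"
    by metis
  have uniq: "g = F f" if "(f, g) \<in> T" for f g
    using bounded_relD[OF assms(2) linear_rel_diff[OF assms(1) that F[of f]]] by simp
  have F_scale: "F (c *\<^sub>C f) = c *\<^sub>C F f" for c f
    using uniq[OF linear_rel_scale[OF assms(1) F]] by simp
  have "bounded_linear F"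
  proof (rule bounded_linear_intro)
    show "F (f + g) = F f + F g" for f g
      using uniq[OF linear_rel_add[OF assms(1) F F]] by simp
    show "F (r *\<^sub>R f) = r *\<^sub>R F f" for r f
      using F_scale[of "complex_of_real r" f] by (simp add: scaleC_of_real)
    show "norm (F f) \<le> norm f * C" for f
      using bounded_relD[OF assms(2) F] by (simp add: mult.commute)
  qed
  then have "bounded_clinear F"
    by (simp add: bounded_clinear_def F_scale)
  moreover have "T = op_of F"
    using F uniq by (auto simp: op_of_def)
  ultimately show ?thesis by blast
qed

lemma resolvent_setI:
  assumes "linear_rel T" "bounded_rel C (resolvent T z)" "Domain (resolvent T z) = UNIV"
  shows "z \<in> resolvent_set T"
  using linear_rel_bounded_eq_op_of[OF linear_rel_resolvent[OF assms(1)] assms(2,3)]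
  by (auto simp: resolvent_set_def)

lemma resolvent_setE:
  assumes "z \<in> resolvent_set T"
  obtains C where "bounded_rel C (resolvent T z)" "0 \<le> C" "Domain (resolvent T z) = UNIV"
    "single_valued (resolvent T z)"
proof -
  obtain F where F: "bounded_linear F" "resolvent T z = op_of F"
    using assms by (auto simp: resolvent_set_def bounded_clinear_def)
  obtain C where "0 \<le> C" "\<And>f. norm (F f) \<le> norm f * C"
    using bounded_linear.nonneg_bounded[OF F(1)] by blast
  then show thesis
    by (intro that[of C]) (auto simp: F(2) op_of_def bounded_rel_def single_valued_def mult.commute)
qed

text \<open>Continuous extension by density: the bound, applied to differences, makes the values
  along an approximating sequence Cauchy.\<close>

lemma Domain_closure_bounded_rel:
  fixes T :: "'a::{complex_normed_vector, complete_space} op"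
  assumes T: "linear_rel T" "bounded_rel C T" and dense: "closure (Domain T) = UNIV"
  shows "Domain (closure T) = UNIV"
proof -
  have "\<exists>g. (f, g) \<in> closure T" for f
  proof -
    have "f \<in> closure (Domain T)"
      using dense by simp
    then obtain a where a: "\<And>n. a n \<in> Domain T" "a \<longlonglongrightarrow> f"
      unfolding closure_sequential by blast
    from a(1) have "\<exists>g. (a n, g) \<in> T" for n
      by blast
    then obtain b where b: "\<And>n. (a n, b n) \<in> T"
      by metis
    have le: "norm (b m - b n) \<le> \<bar>C\<bar> * norm (a m - a n)" for m n
      using bounded_relD[OF T(2) linear_rel_diff[OF T(1) b b], of m n]
      by (smt (verit) mult_right_mono norm_ge_zero)
    have "Cauchy b"
    proof (rule CauchyI)
      fix e :: real assume "0 < e"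
      \<comment> \<open>\<open>C\<close> carries no sign condition; |C| + 1 is a positive constant
        that is also valid.\<close>
      then have "0 < e / (\<bar>C\<bar> + 1)" by simp
      with CauchyD[OF LIMSEQ_imp_Cauchy[OF a(2)]] obtain M where
        M: "\<And>m n. m \<ge> M \<Longrightarrow> n \<ge> M \<Longrightarrow> norm (a m - a n) < e / (\<bar>C\<bar> + 1)"
        by meson
      have "norm (b m - b n) < e" if "m \<ge> M" "n \<ge> M" for m n
      proof -
        have "norm (b m - b n) \<le> (\<bar>C\<bar> + 1) * norm (a m - a n)"
          using le[of m n] by (smt (verit) mult_right_mono norm_ge_zero)
        also have "\<dots> < (\<bar>C\<bar> + 1) * (e / (\<bar>C\<bar> + 1))"
          using M[OF that] by (intro mult_strict_left_mono) auto
        also have "\<dots> = e" by simp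
        finally show ?thesis .
      qed
      then show "\<exists>M. \<forall>m\<ge>M. \<forall>n\<ge>M. norm (b m - b n) < e" by blast
    qed
    then obtain g where "b \<longlonglongrightarrow> g"
      using Cauchy_convergent convergent_def by blast
    then have "(\<lambda>n. (a n, b n)) \<longlonglongrightarrow> (f, g)"
      using a(2) by (intro tendsto_Pair)
    then have "(f, g) \<in> closure T"
      unfolding closure_sequential using b by (intro exI[of _ "\<lambda>n. (a n, b n)"]) simp
    then show ?thesis ..
  qed
  then show ?thesis by blast
qed

text \<open>The Neumann series appears as a fixed-point argument: f + T f = h means f = h - T f, and
  the right side is a contraction with factor \<open>q\<close>. The inverse is bounded because |h|
  is at least (1 - q) |f|.\<close>

lemma minus_one_in_resolvent_set:
  fixes T :: "'a::{complex_normed_vector, complete_space} op"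
  assumes T: "linear_rel T" "bounded_rel q T" and total: "Domain T = UNIV" and q: "0 \<le> q" "q < 1"
  shows "- 1 \<in> resolvent_set T"
proof (rule resolvent_setI[OF T(1)])
  have mem: "(h, f) \<in> resolvent T (- 1) \<longleftrightarrow> (f, h - f) \<in> T" for f h
    by (simp add: mem_resolvent_iff scaleC_minus_one)
  show "bounded_rel (1 / (1 - q)) (resolvent T (- 1))"
    unfolding bounded_rel_def
  proof safe
    fix h f assume "(h, f) \<in> resolvent T (- 1)"
    then have "norm (h - f) \<le> q * norm f"
      using bounded_relD[OF T(2)] by (simp add: mem)
    then have "norm f * (1 - q) \<le> norm h"
      using norm_triangle_ineq2[of f h] norm_minus_commute[of f h] by (simp add: algebra_simps)
    with q(2) show "norm f \<le> 1 / (1 - q) * norm h"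
      by (simp add: field_simps)
  qed
  have "\<exists>g. (f, g) \<in> T" for f
    using total by blast
  then obtain F where F: "\<And>f. (f, F f) \<in> T"
    by metis
  have "\<exists>f. (h, f) \<in> resolvent T (- 1)" for h
  proof -
    have "\<forall>f g. dist (h - F f) (h - F g) \<le> q * dist f g"
    proof (intro allI)
      fix f g
      have "norm (F g - F f) \<le> q * norm (g - f)"
        by (rule bounded_relD[OF T(2) linear_rel_diff[OF T(1) F F]])
      then show "dist (h - F f) (h - F g) \<le> q * dist f g"
        by (simp add: dist_norm norm_minus_commute)
    qed
    from banach_fix_type[OF q this] obtain f where "h - F f = f"
      by blast
    then have "h - f = F f"
      by (metis diff_diff_eq2 add_diff_cancel_left')
    with F[of f] have "(h, f) \<in> resolvent T (- 1)"
      by (simp add: mem)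
    then show ?thesis ..
  qed
  then show "Domain (resolvent T (- 1)) = UNIV" by blast
qed

section \<open>Square roots and polar decomposition of two-by-two matrices\<close>

lemma mat2_eq_iff:
  "M = N \<longleftrightarrow> M$1$1 = N$1$1 \<and> M$1$2 = N$1$2 \<and> M$2$1 = N$2$1 \<and> M$2$2 = N$2$2"
  for M N :: "'a^2^2"
  by (auto simp: vec_eq_iff forall_2)

lemma vec2_eq_iff: "v = w \<longleftrightarrow> v$1 = w$1 \<and> v$2 = w$2" for v w :: "'a^2"
  by (auto simp: vec_eq_iff forall_2)

lemma mat2_mult_nth: "(M ** N)$i$j = M$i$1 * N$1$j + M$i$2 * N$2$j" for M N :: "complex^2^2"
  by (simp add: matrix_matrix_mult_def sum_2)

lemma mat2_vec_nth: "(M *v v)$i = M$i$1 * v$1 + M$i$2 * v$2" for M :: "complex^2^2"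
  by (simp add: matrix_vector_mult_def sum_2)

lemma norm_vec2: "(norm v)\<^sup>2 = (cmod (v$1))\<^sup>2 + (cmod (v$2))\<^sup>2" for v :: "complex^2"
  by (simp add: norm_vec_def L2_set_def sum_2)

lemma inner_vec2: "inner v w = Re (cnj (v$1) * w$1) + Re (cnj (v$2) * w$2)" for v w :: "complex^2"
  by (simp add: inner_vec_def sum_2 inner_complex_def)

lemma inner_mat_adjoint: "inner v (M *v w) = inner (mat_adjoint M *v v) w" for M :: "complex^2^2"
  by (simp add: inner_vec2 mat2_vec_nth mat_adjoint_def algebra_simps)

definition hermitian2 :: "real \<Rightarrow> complex \<Rightarrow> real \<Rightarrow> complex^2^2" where
  "hermitian2 a b d = vector [vector [of_real a, b], vector [cnj b, of_real d]]"

lemma hermitian2_nth [simp]: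
  "hermitian2 a b d $ 1 $ 1 = of_real a" "hermitian2 a b d $ 1 $ 2 = b"
  "hermitian2 a b d $ 2 $ 1 = cnj b" "hermitian2 a b d $ 2 $ 2 = of_real d"
  by (simp_all add: hermitian2_def)

lemma inner_hermitian2:
  "inner v (hermitian2 a b d *v v) =
     a * (cmod (v$1))\<^sup>2 + d * (cmod (v$2))\<^sup>2 + 2 * Re (cnj (v$1) * b * v$2)"
  unfolding cmod_power2 by (simp add: inner_vec2 mat2_vec_nth power2_eq_square algebra_simps)

text \<open>Complete the square: the diagonal terms dominate 2 sqrt(a d) |v_1| |v_2|, and sqrt(a d)
  is at least |b|.\<close>

lemma mat_psd_hermitian2:
  assumes "0 \<le> a" "0 \<le> d" "(cmod b)\<^sup>2 \<le> a * d"
  shows "mat_psd (hermitian2 a b d)"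
  unfolding mat_psd_def
proof (intro conjI allI)
  show "mat_adjoint (hermitian2 a b d) = hermitian2 a b d"
    by (simp add: mat2_eq_iff mat_adjoint_def)
  fix v :: "complex^2"
  have "cmod b \<le> sqrt a * sqrt d"
    using assms by (metis real_le_rsqrt real_sqrt_mult)
  then have "cmod (v$1) * cmod b * cmod (v$2) \<le> cmod (v$1) * (sqrt a * sqrt d) * cmod (v$2)"
    by (intro mult_left_mono mult_right_mono) auto
  moreover have "0 \<le> (sqrt a * cmod (v$1) - sqrt d * cmod (v$2))\<^sup>2"
    by simp
  moreover have "(sqrt a * cmod (v$1) - sqrt d * cmod (v$2))\<^sup>2 = a * (cmod (v$1))\<^sup>2 + d * (cmod (v$2))\<^sup>2
      - 2 * (cmod (v$1) * (sqrt a * sqrt d) * cmod (v$2))"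
    using assms by (simp add: power2_diff power_mult_distrib)
  moreover have "- (cmod (v$1) * cmod b * cmod (v$2)) \<le> Re (cnj (v$1) * b * v$2)"
    using abs_Re_le_cmod[of "cnj (v$1) * b * v$2"] by (simp add: norm_mult)
  ultimately show "0 \<le> inner v (hermitian2 a b d *v v)"
    unfolding inner_hermitian2 by linarith
qed

lemma mat_psd_cases:
  fixes P :: "complex^2^2"
  assumes "mat_psd P"
  obtains a b d where "0 \<le> a" "0 \<le> d" "(cmod b)\<^sup>2 \<le> a * d" "P = hermitian2 a b d"
proof -
  have adj: "mat_adjoint P = P" and pos: "\<And>v. 0 \<le> inner v (P *v v)"
    using assms by (auto simp: mat_psd_def)
  define a b d where abd: "a = Re (P$1$1)" "b = P$1$2" "d = Re (P$2$2)"
  have "cnj (P$1$1) = P$1$1" "cnj (P$2$2) = P$2$2" "cnj (P$1$2) = P$2$1"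
    using arg_cong[OF adj, of "\<lambda>M. M$1$1"] arg_cong[OF adj, of "\<lambda>M. M$2$2"]
      arg_cong[OF adj, of "\<lambda>M. M$2$1"] by (simp_all add: mat_adjoint_def)
  then have P: "P = hermitian2 a b d"
    by (simp add: mat2_eq_iff abd complex_eq_iff)
  have a: "0 \<le> a"
    using pos[of "vector [1, 0]"] by (simp add: P inner_hermitian2)
  have d: "0 \<le> d"
    using pos[of "vector [0, 1]"] by (simp add: P inner_hermitian2)
  \<comment> \<open>The factor \<open>b\<close> in the test vector makes the off-diagonal term the
    real number -2 x y |b|^2. The choice x = 1, y = a then gives a times the determinant.\<close>
  have form: "0 \<le> a * x\<^sup>2 * (cmod b)\<^sup>2 + d * y\<^sup>2 - 2 * x * y * (cmod b)\<^sup>2" for x y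
  proof -
    have "0 \<le> inner (vector [- of_real x * b, of_real y]) (P *v vector [- of_real x * b, of_real y])"
      by (rule pos)
    also have "\<dots> = a * x\<^sup>2 * (cmod b)\<^sup>2 + d * y\<^sup>2 - 2 * x * y * (cmod b)\<^sup>2"
      by (simp add: P inner_hermitian2 norm_mult power_mult_distrib cmod_power2)
        (simp add: power2_eq_square algebra_simps)
    finally show ?thesis .
  qed
  have "(cmod b)\<^sup>2 \<le> a * d"
  proof (cases "a = 0")
    case True
    have "b = 0"
    proof (rule ccontr)
      assume "b \<noteq> 0"
      \<comment> \<open>With \<open>a = 0\<close> this choice gives the form the value d - 2 (d +
        1), which is negative.\<close>
      with form[of "(d + 1) / (cmod b)\<^sup>2" 1] True d show False
        by simp
    qed
    with True show ?thesis by simp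
  next
    case False
    have "0 \<le> a * (a * d - (cmod b)\<^sup>2)"
      using form[of 1 a] by (simp add: power2_eq_square algebra_simps)
    with a False show ?thesis
      by (simp add: zero_le_mult_iff)
  qed
  with a d P show thesis
    by (intro that)
qed

text \<open>By Cayley-Hamilton, \<open>P = (P\<^sup>2 + det P) / tr P\<close>, where \<open>(tr P)\<^sup>2 = tr P\<^sup>2 + 2 det P\<close>; for
  \<open>P = 0\<close> the division by zero gives the right value.\<close>

definition psd_sqrt :: "complex^2^2 \<Rightarrow> complex^2^2" where
  "psd_sqrt M = (\<chi> i j. (M$i$j + (if i = j then complex_of_real (sqrt (Re (det M))) else 0)) /
      complex_of_real (sqrt (Re (trace M) + 2 * sqrt (Re (det M)))))"

lemma psd_sqrt_hermitian2:
  fixes a d :: real and b :: complex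
  defines "s \<equiv> sqrt (a * d - (cmod b)\<^sup>2)"
  defines "t \<equiv> sqrt (a + d + 2 * s)"
  shows "psd_sqrt (hermitian2 a b d) = hermitian2 ((a + s) / t) (b / t) ((d + s) / t)"
proof -
  have "Re (det (hermitian2 a b d)) = a * d - (cmod b)\<^sup>2" "Re (trace (hermitian2 a b d)) = a + d"
    by (simp_all add: det_2 trace_def sum_2 complex_norm_square[symmetric] del: of_real_power)
  then show ?thesis
    by (simp add: mat2_eq_iff psd_sqrt_def s_def t_def)
qed

lemma hermitian2_mult_self:
  "hermitian2 a b d ** hermitian2 a b d =
     hermitian2 (a\<^sup>2 + (cmod b)\<^sup>2) (b * of_real (a + d)) (d\<^sup>2 + (cmod b)\<^sup>2)"
  by (simp add: mat2_eq_iff mat2_mult_nth complex_norm_square[symmetric] algebra_simps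
      power2_eq_square[of a] power2_eq_square[of d])

text \<open>The inner root of the formula returns det P, since det (P^2) = (det P)^2 and det P \<ge>
  0, and the outer root returns tr P. This is the uniqueness half: every positive root of M equals
  \<open>psd_sqrt M\<close>.\<close>

lemma psd_sqrt_mult_self:
  assumes "mat_psd P"
  shows "psd_sqrt (P ** P) = P"
proof -
  from assms obtain a b d where abd: "0 \<le> a" "0 \<le> d" "(cmod b)\<^sup>2 \<le> a * d" "P = hermitian2 a b d"
    by (rule mat_psd_cases)
  define q where "q = a * d - (cmod b)\<^sup>2"
  have q: "0 \<le> q" "(cmod b)\<^sup>2 = a * d - q"
    using abd by (simp_all add: q_def)
  have "(a\<^sup>2 + (cmod b)\<^sup>2) * (d\<^sup>2 + (cmod b)\<^sup>2) - (cmod (b * of_real (a + d)))\<^sup>2 = q\<^sup>2"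
    unfolding norm_mult power_mult_distrib norm_of_real power2_abs q(2)
    by (simp add: power2_eq_square algebra_simps)
  then have s: "sqrt ((a\<^sup>2 + (cmod b)\<^sup>2) * (d\<^sup>2 + (cmod b)\<^sup>2) - (cmod (b * of_real (a + d)))\<^sup>2) = q"
    using q(1) by simp
  have "a\<^sup>2 + (cmod b)\<^sup>2 + (d\<^sup>2 + (cmod b)\<^sup>2) + 2 * q = (a + d)\<^sup>2"
    unfolding q(2) by (simp add: power2_eq_square algebra_simps)
  then have t: "sqrt (a\<^sup>2 + (cmod b)\<^sup>2 + (d\<^sup>2 + (cmod b)\<^sup>2) + 2 * q) = a + d"
    using abd by simp
  have eq: "psd_sqrt (P ** P) = hermitian2 ((a\<^sup>2 + (cmod b)\<^sup>2 + q) / (a + d))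
     (b * of_real (a + d) / of_real (a + d)) ((d\<^sup>2 + (cmod b)\<^sup>2 + q) / (a + d))"
    unfolding abd(4) hermitian2_mult_self psd_sqrt_hermitian2 s t ..
  show ?thesis
  proof (cases "a + d = 0")
    case True
    then have "a = 0" "d = 0" using abd by auto
    with abd have "b = 0" by simp
    with \<open>a = 0\<close> \<open>d = 0\<close> show ?thesis
      unfolding eq unfolding abd(4) by (simp add: mat2_eq_iff)
  next
    case False
    have *: "a\<^sup>2 + (cmod b)\<^sup>2 + q = a * (a + d)" "d\<^sup>2 + (cmod b)\<^sup>2 + q = d * (a + d)"
      unfolding q(2) by (simp_all add: power2_eq_square algebra_simps)
    have "complex_of_real (a + d) \<noteq> 0"
      using False by (metis of_real_eq_0_iff)
    with False show ?thesis
      unfolding eq unfolding abd(4) * by (simp add: mat2_eq_iff)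
  qed
qed

lemma psd_sqrt:
  assumes "mat_psd M"
  shows "mat_psd (psd_sqrt M)" "psd_sqrt M ** psd_sqrt M = M"
proof -
  from assms obtain a b d where abd: "0 \<le> a" "0 \<le> d" "(cmod b)\<^sup>2 \<le> a * d" "M = hermitian2 a b d"
    by (rule mat_psd_cases)
  define s where "s = sqrt (a * d - (cmod b)\<^sup>2)"
  define t where "t = sqrt (a + d + 2 * s)"
  have s: "0 \<le> s" "s\<^sup>2 = a * d - (cmod b)\<^sup>2"
    using abd by (simp_all add: s_def)
  have t: "0 \<le> t" "t\<^sup>2 = a + d + 2 * s"
    using abd s by (simp_all add: t_def)
  have eq: "psd_sqrt M = hermitian2 ((a + s) / t) (b / t) ((d + s) / t)"
    unfolding abd(4) psd_sqrt_hermitian2 s_def t_def ..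
  have "(cmod b)\<^sup>2 \<le> (a + s) * (d + s)"
    using abd(3) mult_nonneg_nonneg[OF abd(1) s(1)] mult_nonneg_nonneg[OF s(1) abd(2)]
      mult_nonneg_nonneg[OF s(1) s(1)] unfolding distrib_left distrib_right by linarith
  then have "(cmod b)\<^sup>2 / t\<^sup>2 \<le> (a + s) * (d + s) / t\<^sup>2"
    by (intro divide_right_mono) auto
  moreover have "(a + s) * (d + s) / t\<^sup>2 = (a + s) / t * ((d + s) / t)"
    by (simp add: power2_eq_square)
  ultimately have "(cmod (b / t))\<^sup>2 \<le> (a + s) / t * ((d + s) / t)"
    by (simp add: norm_divide power_divide)
  then show "mat_psd (psd_sqrt M)"
    unfolding eq using abd s t by (intro mat_psd_hermitian2) simp_all
  show "psd_sqrt M ** psd_sqrt M = M"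
  proof (cases "t = 0")
    case True
    then have "a = 0" "d = 0" using abd s t by auto
    with abd have "b = 0" by simp
    with True \<open>a = 0\<close> \<open>d = 0\<close> show ?thesis
      unfolding eq hermitian2_mult_self unfolding abd(4) by (simp add: mat2_eq_iff)
  next
    case False
    have bb: "(cmod b)\<^sup>2 = a * d - s\<^sup>2" using s by simp
    have t_sum: "(a + s)\<^sup>2 + (cmod b)\<^sup>2 = a * t\<^sup>2" "(d + s)\<^sup>2 + (cmod b)\<^sup>2 = d * t\<^sup>2"
      "a + s + (d + s) = t\<^sup>2"
      unfolding t bb by (simp_all add: power2_eq_square algebra_simps)
    have "((a + s) / t)\<^sup>2 + (cmod (b / t))\<^sup>2 = ((a + s)\<^sup>2 + (cmod b)\<^sup>2) / t\<^sup>2"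
      "((d + s) / t)\<^sup>2 + (cmod (b / t))\<^sup>2 = ((d + s)\<^sup>2 + (cmod b)\<^sup>2) / t\<^sup>2"
      by (simp_all add: norm_divide power_divide flip: add_divide_distrib)
    moreover have "(a + s) / t + (d + s) / t = (a + s + (d + s)) / t"
      by (simp only: add_divide_distrib)
    ultimately have "((a + s) / t)\<^sup>2 + (cmod (b / t))\<^sup>2 = a" "((d + s) / t)\<^sup>2 + (cmod (b / t))\<^sup>2 = d"
      "(a + s) / t + (d + s) / t = t"
      unfolding t_sum using False by (simp_all add: power2_eq_square)
    with False show ?thesis
      unfolding eq hermitian2_mult_self unfolding abd(4) by (simp add: mat2_eq_iff)
  qed
qed

lemma mat_sqrt_eq_psd_sqrt:
  assumes "mat_psd M"
  shows "mat_sqrt M = psd_sqrt M"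
  unfolding mat_sqrt_def
  using psd_sqrt[OF assms] psd_sqrt_mult_self by (intro the_equality) auto

section \<open>Absolute value and polar decomposition\<close>

lemma mat_psd_adjoint_mult_self: "mat_psd (mat_adjoint M ** M)" for M :: "complex^2^2"
proof -
  have "inner v ((mat_adjoint M ** M) *v v) = (norm (M *v v))\<^sup>2" for v
  proof -
    have "inner v ((mat_adjoint M ** M) *v v) = inner v (mat_adjoint M *v (M *v v))"
      by (simp add: matrix_vector_mul_assoc)
    also have "mat_adjoint (mat_adjoint M) = M"
      by (simp add: mat_adjoint_def vec_eq_iff)
    then have "inner v (mat_adjoint M *v (M *v v)) = inner (M *v v) (M *v v)"
      by (simp add: inner_mat_adjoint)
    finally show ?thesis by (simp add: power2_norm_eq_inner)
  qed
  moreover have "mat_adjoint (mat_adjoint M ** M) = mat_adjoint M ** M"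
    by (simp add: mat2_eq_iff mat_adjoint_def mat2_mult_nth mult.commute)
  ultimately show ?thesis
    by (simp add: mat_psd_def)
qed

lemma mat_abs_eq: "mat_abs M = psd_sqrt (mat_adjoint M ** M)" for M :: "complex^2^2"
  by (simp add: mat_abs_def mat_sqrt_eq_psd_sqrt mat_psd_adjoint_mult_self)

lemma
  fixes M :: "complex^2^2"
  shows mat_psd_mat_abs: "mat_psd (mat_abs M)"
    and mat_abs_mult_self: "mat_abs M ** mat_abs M = mat_adjoint M ** M"
  by (simp_all add: mat_abs_eq psd_sqrt mat_psd_adjoint_mult_self)

lemma inner_mat_psd_mult_self:
  fixes P :: "complex^2^2"
  assumes "mat_psd P"
  shows "(norm (P *v v))\<^sup>2 = inner v ((P ** P) *v v)"
  using assms by (simp add: mat_psd_def power2_norm_eq_inner inner_mat_adjoint matrix_vector_mul_assoc[symmetric])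

lemma norm_mat_abs: "norm (mat_abs M *v v) = norm (M *v v)" for M :: "complex^2^2"
proof -
  have "(norm (mat_abs M *v v))\<^sup>2 = inner v ((mat_adjoint M ** M) *v v)"
    by (simp add: inner_mat_psd_mult_self mat_psd_mat_abs mat_abs_mult_self)
  also have "\<dots> = inner (mat_adjoint (mat_adjoint M) *v v) (M *v v)"
    by (simp add: matrix_vector_mul_assoc[symmetric] inner_mat_adjoint)
  also have "mat_adjoint (mat_adjoint M) = M"
    by (simp add: mat_adjoint_def vec_eq_iff)
  finally show ?thesis
    by (simp add: power2_norm_eq_inner[symmetric])
qed

text \<open>The left side is the quadratic form of |M| at v, and |M| v has the norm of M v. So each
  half of the factorization carries the square root of the operator norm.\<close>

lemma norm_sqrt_mat_abs:
  fixes M :: "complex^2^2"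
  assumes "\<And>w. norm (M *v w) \<le> K * norm w"
  shows "(norm (mat_sqrt (mat_abs M) *v v))\<^sup>2 \<le> K * (norm v)\<^sup>2"
proof -
  have "(norm (mat_sqrt (mat_abs M) *v v))\<^sup>2 = inner v (mat_abs M *v v)"
    by (simp add: mat_sqrt_eq_psd_sqrt mat_psd_mat_abs psd_sqrt inner_mat_psd_mult_self)
  also have "\<dots> \<le> norm v * norm (M *v v)"
    using norm_cauchy_schwarz[of v "mat_abs M *v v"] by (simp add: norm_mat_abs)
  also have "\<dots> \<le> norm v * (K * norm v)"
    by (intro mult_left_mono assms) simp
  finally show ?thesis by (simp add: power2_eq_square mult_ac)
qed

text \<open>The phase of an invertible \<open>M\<close> is \<open>(M + sgn (det M) adj(M)\<^sup>*) / tr |M|\<close>, and since \<open>sgn 0 = 0\<close> the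
  same formula covers the singular matrices.\<close>

definition cofactor_adjoint :: "complex^2^2 \<Rightarrow> complex^2^2" where
  "cofactor_adjoint M =
     vector [vector [cnj (M$2$2), - cnj (M$2$1)], vector [- cnj (M$1$2), cnj (M$1$1)]]"

lemma cofactor_adjoint_nth [simp]:
  "cofactor_adjoint M $ 1 $ 1 = cnj (M$2$2)" "cofactor_adjoint M $ 1 $ 2 = - cnj (M$2$1)"
  "cofactor_adjoint M $ 2 $ 1 = - cnj (M$1$2)" "cofactor_adjoint M $ 2 $ 2 = cnj (M$1$1)"
  by (simp_all add: cofactor_adjoint_def)

text \<open>The trace s1 + s2 of |M|: the singular values satisfy s1^2 + s2^2 =
  \<open>(norm M)\<^sup>2\<close> (the Frobenius norm) and s1 s2 = |det M|.\<close>

definition polar_denom :: "complex^2^2 \<Rightarrow> real" where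
  "polar_denom M = sqrt ((norm M)\<^sup>2 + 2 * cmod (det M))"

definition polar_phase :: "complex^2^2 \<Rightarrow> complex^2^2" where
  "polar_phase M = (\<chi> i j. (M$i$j + sgn (det M) * cofactor_adjoint M$i$j) / of_real (polar_denom M))"

lemma norm_mat2: "(norm M)\<^sup>2 = (cmod (M$1$1))\<^sup>2 + (cmod (M$1$2))\<^sup>2 + ((cmod (M$2$1))\<^sup>2 + (cmod (M$2$2))\<^sup>2)"
  for M :: "complex^2^2"
  by (simp add: norm_vec_def L2_set_def sum_2)

lemma polar_denom_eq_0_iff: "polar_denom M = 0 \<longleftrightarrow> M = 0"
proof
  assume "polar_denom M = 0"
  then have "(norm M)\<^sup>2 + 2 * cmod (det M) = 0"
    by (simp add: polar_denom_def)
  then have "(norm M)\<^sup>2 = 0"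
    by (smt (verit) norm_ge_zero zero_le_power2)
  then show "M = 0" by simp
qed (simp add: polar_denom_def det_2)

lemma polar_denom_mult_self:
  "of_real (polar_denom M) * of_real (polar_denom M) =
     M$1$1 * cnj (M$1$1) + M$1$2 * cnj (M$1$2) + (M$2$1 * cnj (M$2$1) + M$2$2 * cnj (M$2$2)) +
     2 * complex_of_real (cmod (det M))"
proof -
  have "(polar_denom M)\<^sup>2 = (norm M)\<^sup>2 + 2 * cmod (det M)"
    by (simp add: polar_denom_def)
  then have "complex_of_real ((polar_denom M)\<^sup>2) = complex_of_real ((norm M)\<^sup>2 + 2 * cmod (det M))"
    by simp
  then show ?thesis
    by (simp add: norm_mat2 power2_eq_square[of "complex_of_real (polar_denom M)"]
        complex_norm_square[symmetric] del: of_real_power) (simp add: power2_eq_square)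
qed

lemma mat_abs_nth:
  "mat_abs M $ i $ j = ((mat_adjoint M ** M) $ i $ j +
     (if i = j then of_real (cmod (det M)) else 0)) / of_real (polar_denom M)"
proof -
  have "det (mat_adjoint M ** M) = of_real ((cmod (det M))\<^sup>2)"
    unfolding complex_norm_square by (simp add: det_2 mat2_mult_nth mat_adjoint_def algebra_simps)
  then have d: "sqrt (Re (det (mat_adjoint M ** M))) = cmod (det M)"
    by simp
  have "trace (mat_adjoint M ** M) = of_real ((norm M)\<^sup>2)"
    unfolding norm_mat2 of_real_add complex_norm_square
    by (simp add: trace_def sum_2 mat2_mult_nth mat_adjoint_def algebra_simps)
  then have t: "Re (trace (mat_adjoint M ** M)) = (norm M)\<^sup>2"
    by simp
  show ?thesis
    unfolding mat_abs_eq psd_sqrt_def d t polar_denom_def by simp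
qed

lemma sgn_complex_identities:
  fixes z :: complex
  shows "sgn z * of_real (cmod z) = z" "sgn z * cnj z = of_real (cmod z)"
    and "z \<noteq> 0 \<Longrightarrow> sgn z * cnj (sgn z) = 1"
proof -
  show *: "sgn z * of_real (cmod z) = z"
    by (simp add: sgn_eq)
  show "sgn z * cnj z = of_real (cmod z)"
    by (cases "z = 0") (simp_all add: sgn_eq complex_norm_square[symmetric] power2_eq_square)
  assume "z \<noteq> 0"
  then show "sgn z * cnj (sgn z) = 1"
    by (simp add: complex_norm_square[symmetric] norm_sgn del: of_real_power)
qed

text \<open>Conjugates become independent variables (\<open>a'\<close> for \<open>cnj a\<close>);
  \<open>e\<close> stands for the sign of the determinant, \<open>s\<close> for its modulus and
  \<open>t\<close> for the trace of |M|. The claims are then polynomial consequences of the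
  hypotheses, a question of ideal membership.\<close>

lemma polar_identities:
  fixes a b c d a' b' c' d' e s t :: complex
  assumes "t * t = a * a' + b * b' + (c * c' + d * d') + 2 * s"
    and "e * s = a * d - b * c" and "e * (a' * d' - b' * c') = s"
  shows "(a + e * d') * (a' * a + c' * c + s) + (b - e * c') * (b' * a + d' * c) = a * (t * t)"
    and "(a + e * d') * (a' * b + c' * d) + (b - e * c') * (b' * b + d' * d + s) = b * (t * t)"
    and "(c - e * b') * (a' * a + c' * c + s) + (d + e * a') * (b' * a + d' * c) = c * (t * t)"
    and "(c - e * b') * (a' * b + c' * d) + (d + e * a') * (b' * b + d' * d + s) = d * (t * t)"
  using assms by algebra+

lemma polar_phase_mult_mat_abs: "polar_phase M ** mat_abs M = M"
proof (cases "M = 0")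
  case True
  then show ?thesis
    by (simp add: mat2_eq_iff mat2_mult_nth polar_phase_def det_2)
next
  case False
  define t where "t = complex_of_real (polar_denom M)"
  have t: "t \<noteq> 0"
    using False by (simp add: t_def polar_denom_eq_0_iff)
  define e where "e = sgn (det M)"
  define s where "s = complex_of_real (cmod (det M))"
  have tt: "t * t = M$1$1 * cnj (M$1$1) + M$1$2 * cnj (M$1$2) + (M$2$1 * cnj (M$2$1) + M$2$2 * cnj (M$2$2)) + 2 * s"
    unfolding t_def s_def by (rule polar_denom_mult_self)
  have es: "e * s = M$1$1 * M$2$2 - M$1$2 * M$2$1"
    using sgn_complex_identities(1)[of "det M"] by (simp add: e_def s_def det_2)
  have ed: "e * (cnj (M$1$1) * cnj (M$2$2) - cnj (M$1$2) * cnj (M$2$1)) = s"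
    using sgn_complex_identities(2)[of "det M"] by (simp add: e_def s_def det_2)
  note * = polar_identities[OF tt es ed]
  have frac: "x / t * (y / t) + u / t * (v / t) = w" if "x * y + u * v = w * (t * t)" for x y u v w
  proof -
    have "x / t * (y / t) + u / t * (v / t) = (x * y + u * v) / (t * t)"
      by (simp add: add_divide_distrib)
    with that t show ?thesis by simp
  qed
  show ?thesis
    unfolding mat2_eq_iff mat2_mult_nth polar_phase_def vec_lambda_beta mat_abs_nth
      e_def[symmetric] s_def[symmetric] t_def[symmetric]
    by (intro conjI frac; (simp add: mat_adjoint_def; fail)?)
      (use * in \<open>simp_all add: mat_adjoint_def\<close>)
qed

text \<open>The same device, with \<open>f\<close> for the conjugate of \<open>e\<close>; the
  equation \<open>e * f = 1\<close> encodes that the determinant does not vanish.\<close>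

lemma polar_phase_isometry_identities:
  fixes a b c d a' b' c' d' e f s t :: complex
  assumes "t * t = a * a' + b * b' + (c * c' + d * d') + 2 * s"
    and "f * (a * d - b * c) = s" and "e * (a' * d' - b' * c') = s" and "e * f = 1"
  shows "(a' + f * d) * (a + e * d') + (c' - f * b) * (c - e * b') = t * t"
    and "(a' + f * d) * (b - e * c') + (c' - f * b) * (d + e * a') = 0"
    and "(b' - f * c) * (a + e * d') + (d' + f * a) * (c - e * b') = 0"
    and "(b' - f * c) * (b - e * c') + (d' + f * a) * (d + e * a') = t * t"
  using assms by algebra+

lemma polar_phase_isometry:
  assumes "det M \<noteq> 0"
  shows "mat_adjoint (polar_phase M) ** polar_phase M = mat 1"
proof -
  have "M \<noteq> 0" using assms by (auto simp: det_2)
  define t where "t = complex_of_real (polar_denom M)"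
  have t: "t \<noteq> 0"
    using \<open>M \<noteq> 0\<close> by (simp add: t_def polar_denom_eq_0_iff)
  define e where "e = sgn (det M)"
  define s where "s = complex_of_real (cmod (det M))"
  have tt: "t * t = M$1$1 * cnj (M$1$1) + M$1$2 * cnj (M$1$2) + (M$2$1 * cnj (M$2$1) + M$2$2 * cnj (M$2$2)) + 2 * s"
    unfolding t_def s_def by (rule polar_denom_mult_self)
  have ed: "e * (cnj (M$1$1) * cnj (M$2$2) - cnj (M$1$2) * cnj (M$2$1)) = s"
    using sgn_complex_identities(2)[of "det M"] by (simp add: e_def s_def det_2)
  have ed': "cnj e * (M$1$1 * M$2$2 - M$1$2 * M$2$1) = s"
    using arg_cong[OF ed, of cnj] by (simp add: s_def)
  have ee: "e * cnj e = 1"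
    using assms sgn_complex_identities(3) by (simp add: e_def)
  note * = polar_phase_isometry_identities[OF tt ed' ed ee]
  have frac: "x / t * (y / t) + u / t * (v / t) = w / (t * t)" if "x * y + u * v = w" for x y u v w
    using that by (simp flip: add_divide_distrib)
  have ct: "cnj t = t" by (simp add: t_def)
  show ?thesis
    using frac[OF *(1)] frac[OF *(2)] frac[OF *(3)] frac[OF *(4)] t
    unfolding mat2_eq_iff mat2_mult_nth polar_phase_def mat_adjoint_def vec_lambda_beta
      e_def[symmetric] t_def[symmetric]
    by (simp add: mat_def ct)
qed

text \<open>A singular nonzero \<open>M\<close> has one nonzero singular value t =
  \<open>polar_denom M\<close>. Its phase is therefore M / t and, by the next lemma, its absolute
  value is M^* M / t.\<close>

lemma polar_phase_singular:
  assumes "det M = 0"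
  shows "polar_phase M *v v = inverse (of_real (polar_denom M)) *s (M *v v)"
  using assms by (simp add: vec2_eq_iff mat2_vec_nth polar_phase_def field_simps add_divide_distrib)

lemma mat_abs_singular:
  assumes "det M = 0"
  shows "of_real (polar_denom M) *s (mat_abs M *v v) = mat_adjoint M *v (M *v v)"
proof (cases "M = 0")
  case True
  then show ?thesis
    by (simp add: vec2_eq_iff mat2_vec_nth mat_adjoint_def polar_denom_eq_0_iff)
next
  case False
  then have "polar_denom M \<noteq> 0"
    by (simp add: polar_denom_eq_0_iff)
  with assms have "of_real (polar_denom M) *s (mat_abs M *v v) = (mat_adjoint M ** M) *v v"
    by (simp add: vec2_eq_iff mat2_vec_nth mat_abs_nth field_simps)
  then show ?thesis
    by (simp add: matrix_vector_mul_assoc)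
qed

lemma mat_eqI: "(\<And>v. M *v v = N *v v) \<Longrightarrow> M = N" for M N :: "complex^2^2"
  by (simp add: matrix_eq)

lemma vector_smult_mat: "M *v (c *s v) = c *s (M *v v)" for M :: "complex^2^2"
  by (simp add: vec2_eq_iff mat2_vec_nth algebra_simps)

text \<open>For singular \<open>M\<close> the two matrices are proportional; otherwise both are
  injective, the phase because it is an isometry.\<close>

lemma polar_phase_kernel: "polar_phase M *v v = 0 \<longleftrightarrow> M *v v = 0"
proof (cases "det M = 0")
  case True
  show ?thesis
  proof (cases "M = 0")
    case False
    then have "of_real (polar_denom M) \<noteq> (0::complex)"
      by (simp add: polar_denom_eq_0_iff)
    then show ?thesis
      by (simp add: polar_phase_singular[OF True] vec2_eq_iff)
  qed (simp add: polar_phase_def vec2_eq_iff mat2_vec_nth det_2)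
next
  case False
  have "v = 0" if "polar_phase M *v v = 0"
    using arg_cong[OF that, of "\<lambda>w. mat_adjoint (polar_phase M) *v w"]
    by (simp add: matrix_vector_mul_assoc polar_phase_isometry[OF False])
  moreover have "v = 0" if "M *v v = 0"
  proof -
    from False obtain N where "N ** M = mat 1"
      using invertible_det_nz[of M] invertible_left_inverse by blast
    with arg_cong[OF that, of "\<lambda>w. N *v w"] show ?thesis
      by (simp add: matrix_vector_mul_assoc)
  qed
  ultimately show ?thesis by auto
qed

lemma polar_phase_partial_isometry:
  "polar_phase M ** mat_adjoint (polar_phase M) ** polar_phase M = polar_phase M"
proof (cases "det M = 0")
  case True
  define t where "t = complex_of_real (polar_denom M)"
  have adj: "mat_adjoint (polar_phase M) *v v = inverse t *s (mat_adjoint M *v v)" for v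
    using True by (simp add: vec2_eq_iff mat2_vec_nth polar_phase_def mat_adjoint_def t_def field_simps add_divide_distrib)
  show ?thesis
  proof (cases "M = 0")
    case True
    then show ?thesis
      by (simp add: mat2_eq_iff polar_phase_def mat2_mult_nth det_2)
  next
    case False
    then have t: "t \<noteq> 0"
      by (simp add: polar_denom_eq_0_iff t_def)
    show ?thesis
    proof (rule mat_eqI)
      fix v
      have "(polar_phase M ** mat_adjoint (polar_phase M) ** polar_phase M) *v v =
          polar_phase M *v (inverse t *s (mat_adjoint M *v (inverse t *s (M *v v))))"
        by (simp add: matrix_vector_mul_assoc[symmetric] adj polar_phase_singular[OF True] t_def)
      \<comment> \<open>M^* M v equals t |M| v, so phase and absolute value become adjacent and
        recombine to \<open>M\<close>.\<close>
      also have "\<dots> = inverse t *s (inverse t *s (polar_phase M *v (t *s (mat_abs M *v v))))"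
        unfolding vector_smult_mat t_def mat_abs_singular[OF True] ..
      also have "\<dots> = inverse t *s ((polar_phase M ** mat_abs M) *v v)"
        using t by (simp add: vector_smult_mat matrix_vector_mul_assoc)
      also have "\<dots> = polar_phase M *v v"
        by (simp add: polar_phase_mult_mat_abs polar_phase_singular[OF True] t_def)
      finally show "(polar_phase M ** mat_adjoint (polar_phase M) ** polar_phase M) *v v = polar_phase M *v v" .
    qed
  qed
next
  case False
  then show ?thesis
    by (simp add: matrix_mul_assoc[symmetric] polar_phase_isometry)
qed

text \<open>An invertible |M| can be cancelled. In the singular case t v and |M| v have the same
  image under \<open>M\<close>, hence under \<open>U\<close> by equality of kernels, so t U v = U
  |M| v = M v.\<close>

lemma polar_phase_unique:
  assumes U: "M = U ** mat_abs M" and ker: "\<And>v. U *v v = 0 \<longleftrightarrow> M *v v = 0"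
  shows "U = polar_phase M"
proof (cases "det M = 0")
  case True
  define t where "t = complex_of_real (polar_denom M)"
  show ?thesis
  proof (cases "M = 0")
    case True
    show ?thesis
      using ker polar_phase_kernel[of M] by (intro mat_eqI) (simp add: True)
  next
    case False
    then have t: "t \<noteq> 0"
      by (simp add: polar_denom_eq_0_iff t_def)
    show ?thesis
    proof (rule mat_eqI)
      fix v
      have "M *v (mat_abs M *v v) = t *s (polar_phase M *v (mat_abs M *v v))"
        using t by (simp add: polar_phase_singular[OF True] t_def)
      also have "\<dots> = t *s (M *v v)"
        by (simp add: matrix_vector_mul_assoc polar_phase_mult_mat_abs)
      finally have "M *v (t *s v - mat_abs M *v v) = 0"
        by (simp add: matrix_vector_mult_diff_distrib vector_smult_mat)
      then have "U *v (t *s v - mat_abs M *v v) = 0"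
        by (simp add: ker)
      then have "t *s (U *v v) = U *v (mat_abs M *v v)"
        by (simp add: matrix_vector_mult_diff_distrib vector_smult_mat)
      also have "\<dots> = M *v v"
        using U by (simp add: matrix_vector_mul_assoc)
      finally have "inverse t *s (t *s (U *v v)) = inverse t *s (M *v v)" by simp
      with t show "U *v v = polar_phase M *v v"
        by (simp add: polar_phase_singular[OF True] t_def)
    qed
  qed
next
  case False
  have "det (mat_abs M) * det (mat_abs M) = det (mat_adjoint M) * det M"
    by (simp add: mat_abs_mult_self flip: det_mul)
  moreover have "det (mat_adjoint M) = cnj (det M)"
    by (simp add: det_2 mat_adjoint_def mult.commute)
  ultimately have "det (mat_abs M) \<noteq> 0"
    using False by auto
  then obtain N where N: "mat_abs M ** N = mat 1"
    using invertible_det_nz invertible_right_inverse by blast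
  have "U = U ** mat_abs M ** N"
    using N by (simp add: matrix_mul_assoc[symmetric])
  also have "\<dots> = polar_phase M ** mat_abs M ** N"
    using U by (simp add: polar_phase_mult_mat_abs)
  also have "\<dots> = polar_phase M"
    using N by (simp add: matrix_mul_assoc[symmetric])
  finally show ?thesis .
qed

lemma mat_phase_eq_polar_phase: "mat_phase M = polar_phase M" for M :: "complex^2^2"
  unfolding mat_phase_def
proof (rule the_equality)
  show "M = polar_phase M ** mat_abs M \<and>
    polar_phase M ** mat_adjoint (polar_phase M) ** polar_phase M = polar_phase M \<and>
    (\<forall>v. (polar_phase M *v v = 0) = (M *v v = 0))"
    by (simp add: polar_phase_mult_mat_abs polar_phase_partial_isometry polar_phase_kernel)
qed (use polar_phase_unique in blast)

text \<open>With w = U^* U v the hypothesis says U w = U v. Hence w has the norm of U v, and |U v|^2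
  is the inner product of v and w, at most |v| |U v|.\<close>

lemma norm_partial_isometry_le:
  fixes U :: "complex^2^2"
  assumes "U ** mat_adjoint U ** U = U"
  shows "norm (U *v v) \<le> norm v"
proof -
  have adj: "mat_adjoint (mat_adjoint U) = U"
    by (simp add: mat_adjoint_def vec_eq_iff)
  define w where "w = mat_adjoint U *v (U *v v)"
  have "(norm w)\<^sup>2 = inner (U *v w) (U *v v)"
    unfolding power2_norm_eq_inner using inner_mat_adjoint[of w "mat_adjoint U" "U *v v"]
    by (simp add: adj w_def)
  also have "U *v w = U *v v"
    using assms by (simp add: w_def matrix_vector_mul_assoc matrix_mul_assoc)
  finally have norm_w: "norm w = norm (U *v v)"
    by (simp add: power2_norm_eq_inner[symmetric])
  have "(norm (U *v v))\<^sup>2 = inner v w"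
    unfolding power2_norm_eq_inner w_def by (simp add: inner_mat_adjoint adj)
  also have "\<dots> \<le> norm v * norm (U *v v)"
    using norm_cauchy_schwarz[of v w] by (simp add: norm_w)
  finally have "norm (U *v v) * norm (U *v v) \<le> norm v * norm (U *v v)"
    by (simp add: power2_eq_square)
  then show ?thesis
    by (cases "norm (U *v v) = 0") auto
qed

lemma norm_phase_sqrt_mat_abs:
  fixes M :: "complex^2^2"
  assumes "\<And>w. norm (M *v w) \<le> K * norm w"
  shows "(norm ((mat_phase M ** mat_sqrt (mat_abs M)) *v v))\<^sup>2 \<le> K * (norm v)\<^sup>2"
proof -
  have "norm ((mat_phase M ** mat_sqrt (mat_abs M)) *v v) \<le> norm (mat_sqrt (mat_abs M) *v v)"
    using norm_partial_isometry_le[OF polar_phase_partial_isometry]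
    by (simp add: mat_phase_eq_polar_phase matrix_vector_mul_assoc[symmetric])
  then have "(norm ((mat_phase M ** mat_sqrt (mat_abs M)) *v v))\<^sup>2 \<le> (norm (mat_sqrt (mat_abs M) *v v))\<^sup>2"
    by (intro power_mono) auto
  also have "\<dots> \<le> K * (norm v)\<^sup>2"
    by (rule norm_sqrt_mat_abs[OF assms])
  finally show ?thesis .
qed

section \<open>Measurability and integrability of matrix-valued functions\<close>

lemma borel_measurable_vec_nth [measurable]:
  fixes f :: "'b \<Rightarrow> 'a::euclidean_space^'n"
  assumes "f \<in> borel_measurable M"
  shows "(\<lambda>x. f x $ i) \<in> borel_measurable M"
proof -
  have "(\<lambda>v::'a^'n. v $ i) \<in> borel_measurable borel"
    by (intro borel_measurable_continuous_onI continuous_intros)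
  from measurable_compose[OF assms this] show ?thesis .
qed

lemma borel_measurable_vecI:
  fixes f :: "'b \<Rightarrow> 'a::euclidean_space^'n"
  assumes "\<And>i. (\<lambda>x. f x $ i) \<in> borel_measurable M"
  shows "f \<in> borel_measurable M"
proof (rule borel_measurable_euclidean_space[THEN iffD2], intro ballI)
  fix b :: "'a^'n" assume "b \<in> Basis"
  then obtain i u where "b = axis i u"
    by (auto simp: Basis_vec_def)
  then show "(\<lambda>x. f x \<bullet> b) \<in> borel_measurable M"
    using assms by (simp add: inner_axis)
qed

lemma borel_measurable_cnj [measurable (raw)]:
  "f \<in> borel_measurable M \<Longrightarrow> (\<lambda>x. cnj (f x)) \<in> borel_measurable M"
  by (rule borel_measurable_continuous_on[where f = cnj]) (auto intro: continuous_intros)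

lemma borel_measurable_mat_vec_mult [measurable (raw)]:
  fixes W :: "'b \<Rightarrow> complex^2^2"
  assumes [measurable]: "W \<in> borel_measurable M" "f \<in> borel_measurable M"
  shows "(\<lambda>x. W x *v f x) \<in> borel_measurable M"
  by (rule borel_measurable_vecI) (simp add: mat2_vec_nth)

lemma borel_measurable_mat_mult [measurable (raw)]:
  fixes W W' :: "'b \<Rightarrow> complex^2^2"
  assumes [measurable]: "W \<in> borel_measurable M" "W' \<in> borel_measurable M"
  shows "(\<lambda>x. W x ** W' x) \<in> borel_measurable M"
  by (intro borel_measurable_vecI) (simp add: mat2_mult_nth)

lemma borel_measurable_mat_adjoint [measurable (raw)]:
  fixes W :: "'b \<Rightarrow> complex^2^2"
  assumes [measurable]: "W \<in> borel_measurable M"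
  shows "(\<lambda>x. mat_adjoint (W x)) \<in> borel_measurable M"
  by (intro borel_measurable_vecI) (simp add: mat_adjoint_def)

lemma borel_measurable_psd_sqrt [measurable (raw)]:
  assumes [measurable]: "W \<in> borel_measurable M"
  shows "(\<lambda>x. psd_sqrt (W x)) \<in> borel_measurable M"
proof (intro borel_measurable_vecI)
  fix i j
  show "(\<lambda>x. psd_sqrt (W x) $ i $ j) \<in> borel_measurable M"
    by (cases "i = j") (simp_all add: psd_sqrt_def det_2 trace_def sum_2)
qed

lemma borel_measurable_polar_phase [measurable (raw)]:
  assumes [measurable]: "W \<in> borel_measurable M"
  shows "(\<lambda>x. polar_phase (W x)) \<in> borel_measurable M"
proof -
  have [measurable]: "(\<lambda>x. cofactor_adjoint (W x)) \<in> borel_measurable M"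
  proof (intro borel_measurable_vecI)
    fix i j :: 2
    show "(\<lambda>x. cofactor_adjoint (W x) $ i $ j) \<in> borel_measurable M"
      using exhaust_2[of i] exhaust_2[of j] by auto
  qed
  show ?thesis
    by (intro borel_measurable_vecI) (simp add: polar_phase_def polar_denom_def norm_mat2 det_2)
qed

text \<open>A definite description says nothing about measurability; it is read off from the closed
  formulas.\<close>

lemma borel_measurable_sqrt_mat_abs [measurable (raw)]:
  fixes W :: "'b \<Rightarrow> complex^2^2"
  assumes [measurable]: "W \<in> borel_measurable M"
  shows "(\<lambda>x. mat_sqrt (mat_abs (W x))) \<in> borel_measurable M"
  by (simp add: mat_sqrt_eq_psd_sqrt mat_psd_mat_abs) (simp add: mat_abs_eq)

lemma borel_measurable_phase_sqrt_mat_abs [measurable (raw)]: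
  fixes W :: "'b \<Rightarrow> complex^2^2"
  assumes [measurable]: "W \<in> borel_measurable M"
  shows "(\<lambda>x. mat_phase (W x) ** mat_sqrt (mat_abs (W x))) \<in> borel_measurable M"
  by (simp add: mat_phase_eq_polar_phase)

lemma norm_mat2_vec_le: "norm (M *v v) \<le> norm M * norm v" for M :: "complex^2^2"
proof -
  have row: "(cmod ((M *v v)$i))\<^sup>2 \<le> (norm (M$i))\<^sup>2 * (norm v)\<^sup>2" for i
  proof -
    have "cmod ((M *v v)$i) \<le> cmod (M$i$1) * cmod (v$1) + cmod (M$i$2) * cmod (v$2)"
      unfolding mat2_vec_nth by (rule order.trans[OF norm_triangle_ineq]) (simp add: norm_mult)
    then have "(cmod ((M *v v)$i))\<^sup>2 \<le> (cmod (M$i$1) * cmod (v$1) + cmod (M$i$2) * cmod (v$2))\<^sup>2"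
      by (intro power_mono) auto
    also have "\<dots> \<le> (norm (M$i))\<^sup>2 * (norm v)\<^sup>2"
      unfolding norm_vec2
      \<comment> \<open>Lagrange's identity: this square is the defect in the Cauchy-Schwarz
        inequality for a row.\<close>
      using zero_le_power2[of "cmod (M$i$1) * cmod (v$2) - cmod (M$i$2) * cmod (v$1)"]
      by (simp add: power2_eq_square algebra_simps)
    finally show ?thesis .
  qed
  have "(norm (M *v v))\<^sup>2 \<le> (norm (M$1))\<^sup>2 * (norm v)\<^sup>2 + (norm (M$2))\<^sup>2 * (norm v)\<^sup>2"
    unfolding norm_vec2[of "M *v v"] by (intro add_mono row)
  also have "\<dots> = (norm M * norm v)\<^sup>2"
    unfolding power_mult_distrib by (simp add: norm_vec_def[of M] L2_set_def sum_2 algebra_simps)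
  finally show ?thesis
    by (rule power2_le_imp_le) simp
qed

lemma bounded_linear_mat2: "bounded_linear (\<lambda>v. M *v v)" for M :: "complex^2^2"
proof (rule bounded_linear_intro)
  show "M *v (v + w) = M *v v + M *v w" for v w
    by (rule matrix_vector_right_distrib)
  show "M *v (r *\<^sub>R v) = r *\<^sub>R (M *v v)" for r v
    by (simp add: vec2_eq_iff mat2_vec_nth scaleR_add_right)
  show "norm (M *v v) \<le> norm v * norm M" for v
    using norm_mat2_vec_le[of M v] by (simp add: mult.commute)
qed

lemma onorm_mat2_le_norm: "onorm (\<lambda>v. M *v v) \<le> norm M" for M :: "complex^2^2"
  by (rule onorm_le) (rule norm_mat2_vec_le)

text \<open>By the triangle inequality the operator norm is 1-Lipschitz for the Frobenius norm.
  Continuity makes the integrand of \<open>potential_norm\<close> measurable.\<close>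

lemma continuous_on_onorm_mat2: "continuous_on UNIV (\<lambda>M::complex^2^2. onorm (\<lambda>v. M *v v))"
proof -
  have le: "onorm (\<lambda>v. M *v v) \<le> onorm (\<lambda>v. N *v v) + norm (M - N)" for M N :: "complex^2^2"
  proof -
    have "(\<lambda>v. M *v v) = (\<lambda>v. N *v v + (M - N) *v v)"
      by (simp add: vec2_eq_iff mat2_vec_nth algebra_simps)
    then have "onorm (\<lambda>v. M *v v) \<le> onorm (\<lambda>v. N *v v) + onorm (\<lambda>v. (M - N) *v v)"
      by (simp add: onorm_triangle bounded_linear_mat2)
    with onorm_mat2_le_norm[of "M - N"] show ?thesis by simp
  qed
  have "1-lipschitz_on UNIV (\<lambda>M::complex^2^2. onorm (\<lambda>v. M *v v))"
  proof (rule lipschitz_onI)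
    fix M N :: "complex^2^2"
    show "dist (onorm (\<lambda>v. M *v v)) (onorm (\<lambda>v. N *v v)) \<le> 1 * dist M N"
      using le[of M N] le[of N M] by (simp add: dist_norm norm_minus_commute abs_le_iff)
  qed simp
  then show ?thesis
    by (rule lipschitz_on_continuous_on)
qed

lemma norm_vec2_le: "norm v \<le> norm (v$1) + norm (v$2)" for v :: "'a::real_normed_vector^2"
  using L2_set_le_sum[of UNIV "\<lambda>i. norm (v$i)"] by (simp add: norm_vec_def sum_2)

lemma integrable_onorm_mat2:
  fixes V :: "real \<Rightarrow> complex^2^2"
  assumes "\<And>i j. integrable lborel (\<lambda>x. V x $ i $ j)"
  shows "V \<in> borel_measurable lborel" "integrable lborel (\<lambda>x. onorm (\<lambda>v. V x *v v))"
proof -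
  show [measurable]: "V \<in> borel_measurable lborel"
    using assms by (intro borel_measurable_vecI borel_measurable_integrable)
  have int: "integrable lborel (\<lambda>x. cmod (V x$1$1) + cmod (V x$1$2) + (cmod (V x$2$1) + cmod (V x$2$2)))"
    using assms by (intro Bochner_Integration.integrable_add integrable_norm)
  have "onorm (\<lambda>v. M *v v) \<le> cmod (M$1$1) + cmod (M$1$2) + (cmod (M$2$1) + cmod (M$2$2))" for M :: "complex^2^2"
  proof -
    have "norm M \<le> norm (M$1) + norm (M$2)"
      by (rule norm_vec2_le)
    also have "norm (M$1) + norm (M$2) \<le> cmod (M$1$1) + cmod (M$1$2) + (cmod (M$2$1) + cmod (M$2$2))"
      by (intro add_mono norm_vec2_le)
    finally show ?thesis
      using onorm_mat2_le_norm[of M] by simp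
  qed
  moreover have "0 \<le> onorm (\<lambda>v. M *v v)" for M :: "complex^2^2"
    by (rule onorm_pos_le[OF bounded_linear_mat2])
  moreover have "(\<lambda>x. onorm (\<lambda>v. V x *v v)) \<in> borel_measurable lborel"
    using measurable_compose[OF _ borel_measurable_continuous_onI[OF continuous_on_onorm_mat2], of V lborel]
    by simp
  ultimately show "integrable lborel (\<lambda>x. onorm (\<lambda>v. V x *v v))"
    by (intro Bochner_Integration.integrable_bound[OF int]) auto
qed

section \<open>The free resolvent\<close>

text \<open>An antiderivative settles the half line and symmetry the rest. It serves the exponential
  kernel and the Lorentzian profile of the wave packets.\<close>

lemma integrable_even_FTC:
  fixes f F :: "real \<Rightarrow> real"
  assumes [measurable]: "f \<in> borel_measurable borel"
    and F: "\<And>x. 0 \<le> x \<Longrightarrow> DERIV F x :> f x" and nonneg: "\<And>x. 0 \<le> f x"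
    and lim: "(F \<longlongrightarrow> T) at_top" and even: "\<And>x. f (- x) = f x"
  shows "integrable lborel f"
proof -
  have "(\<integral>\<^sup>+x. ennreal (f x) * indicator {0..} x \<partial>lborel) = ennreal (T - F 0)"
    by (rule nn_integral_FTC_atLeast) (use assms in auto)
  then have int: "integrable lborel (\<lambda>x. f x * indicator {0..} x)"
    by (intro integrableI_bounded) (auto simp: nonneg ennreal_mult ennreal_indicator)
  \<comment> \<open>The reflected copy covers the negative half line; counting 0 twice is harmless,
    since the sum only has to dominate \<open>f\<close>.\<close>
  from lborel_integrable_real_affine[OF this, of "-1" 0]
  have "integrable lborel (\<lambda>x. f x * indicator {0..} (- x))"
    by (simp add: even)
  from Bochner_Integration.integrable_add[OF int this] show ?thesis
    by (rule Bochner_Integration.integrable_bound) (auto simp: indicator_def nonneg split: if_splits)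
qed

lemma integrable_exp_minus_abs:
  assumes "0 < (c::real)"
  shows "integrable lborel (\<lambda>t. exp (- (c * \<bar>t\<bar>)))"
proof (rule integrable_even_FTC)
  show "DERIV (\<lambda>x. - exp (- (c * x)) / c) x :> exp (- (c * \<bar>x\<bar>))" if "0 \<le> x" for x
    using that assms by (auto intro!: derivative_eq_intros)
  have "((\<lambda>x. exp (- (c * x))) \<longlongrightarrow> 0) at_top"
    using assms by (intro filterlim_compose[OF exp_at_bot]) 
      (auto simp: filterlim_uminus_at_bot intro!: filterlim_tendsto_pos_mult_at_top[OF tendsto_const] filterlim_ident)
  then show "((\<lambda>x. - exp (- (c * x)) / c) \<longlongrightarrow> - 0 / c) at_top"
    using assms by (intro tendsto_intros) auto
qed auto

lemma integrable_inverse_one_plus_square: "integrable lborel (\<lambda>x::real. inverse (1 + x\<^sup>2))"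
proof (rule integrable_even_FTC[OF _ _ _ tendsto_arctan_at_top])
  show "DERIV arctan x :> inverse (1 + x\<^sup>2)" for x
    by (rule DERIV_arctan)
qed (auto intro!: add_nonneg_nonneg)

lemma nn_integral_translate:
  fixes f :: "real \<Rightarrow> ennreal"
  assumes [measurable]: "f \<in> borel_measurable borel"
  shows "(\<integral>\<^sup>+x. f (x - y) \<partial>lborel) = (\<integral>\<^sup>+x. f x \<partial>lborel)"
  using nn_integral_real_affine[of f 1 "- y"] by (simp add: add.commute)

lemma nn_integral_reflect:
  fixes f :: "real \<Rightarrow> ennreal"
  assumes [measurable]: "f \<in> borel_measurable borel"
  shows "(\<integral>\<^sup>+y. f (x - y) \<partial>lborel) = (\<integral>\<^sup>+y. f y \<partial>lborel)"
  using nn_integral_real_affine[of f "-1" x] by simp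

lemma nn_integral_convolution:
  fixes e \<phi> :: "real \<Rightarrow> ennreal"
  assumes [measurable]: "e \<in> borel_measurable borel" "\<phi> \<in> borel_measurable borel"
  shows "(\<integral>\<^sup>+x. (\<integral>\<^sup>+y. e (x - y) * \<phi> y \<partial>lborel) \<partial>lborel) = (\<integral>\<^sup>+x. e x \<partial>lborel) * (\<integral>\<^sup>+y. \<phi> y \<partial>lborel)"
proof -
  have "(\<integral>\<^sup>+x. (\<integral>\<^sup>+y. e (x - y) * \<phi> y \<partial>lborel) \<partial>lborel) = (\<integral>\<^sup>+y. (\<integral>\<^sup>+x. e (x - y) * \<phi> y \<partial>lborel) \<partial>lborel)"
    by (rule lborel_pair.Fubini'[symmetric]) measurable
  also have "\<dots> = (\<integral>\<^sup>+y. (\<integral>\<^sup>+x. e x \<partial>lborel) * \<phi> y \<partial>lborel)"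
    by (simp add: nn_integral_multc nn_integral_translate)
  also have "\<dots> = (\<integral>\<^sup>+x. e x \<partial>lborel) * (\<integral>\<^sup>+y. \<phi> y \<partial>lborel)"
    by (simp add: nn_integral_cmult)
  finally show ?thesis .
qed

section \<open>Differences of the scalar kernels\<close>

abbreviation decay :: "complex \<Rightarrow> real \<Rightarrow> real" where
  "decay k t \<equiv> exp (- (Im k * \<bar>t\<bar>))"

definition wave :: "complex \<Rightarrow> real \<Rightarrow> complex" where
  "wave k t = exp (\<i> * k * of_real \<bar>t\<bar>)"

text \<open>The value 1 at \<open>t = 0\<close> decides which end point belongs to the interval
  \<open>{a<..b}\<close> in the jump term of \<open>signed_wave_diff\<close>.\<close>

definition signed_wave :: "complex \<Rightarrow> real \<Rightarrow> complex" where
  "signed_wave k t = (if 0 \<le> t then wave k t else - wave k t)"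

lemma cmod_wave: "cmod (wave k t) = decay k t"
  and cmod_signed_wave: "cmod (signed_wave k t) = decay k t"
  by (simp_all add: wave_def signed_wave_def norm_exp_eq_Re)

lemma borel_measurable_wave [measurable]: "wave k \<in> borel_measurable borel"
  unfolding wave_def by (intro borel_measurable_continuous_onI continuous_intros)

lemma borel_measurable_signed_wave [measurable]: "signed_wave k \<in> borel_measurable borel"
  unfolding signed_wave_def by measurable

lemma set_integrable_bounded_Icc:
  fixes f :: "real \<Rightarrow> complex"
  assumes [measurable]: "f \<in> borel_measurable borel" and "\<And>x. x \<in> {a..b} \<Longrightarrow> cmod (f x) \<le> B"
  shows "set_integrable lborel {a..b} f"
  unfolding set_integrable_def
proof (rule Bochner_Integration.integrable_bound)
  show "integrable lborel (\<lambda>x. B * indicator {a..b} x :: real)"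
    by (auto intro!: integrable_real_indicator simp: emeasure_lborel_Icc_eq)
  show "AE x in lborel. norm (indicator {a..b} x *\<^sub>R f x) \<le> norm (B * indicator {a..b} x)"
    using assms(2) by (intro AE_I2) (auto simp: indicator_def intro: order.trans[OF _ abs_ge_self])
qed simp

text \<open>The exceptional set takes up the singularity of the kernels at x = y. The bound makes
  \<open>f\<close> Lebesgue integrable, so that the gauge integral supplied by the fundamental
  theorem is also its Lebesgue integral.\<close>

lemma integral_eq_FTC_except:
  fixes F f :: "real \<Rightarrow> complex"
  assumes "a \<le> b" "finite S" "continuous_on {a..b} F"
    and "\<And>x. x \<in> {a<..<b} - S \<Longrightarrow> (F has_vector_derivative f x) (at x)"
    and "f \<in> borel_measurable borel" "\<And>x. x \<in> {a..b} \<Longrightarrow> cmod (f x) \<le> B"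
  shows "(LINT x:{a..b}|lborel. f x) = F b - F a"
proof -
  have "(f has_integral (F b - F a)) {a..b}"
    using assms by (intro fundamental_theorem_of_calculus_interior_strong)
  then have "integral {a..b} f = F b - F a"
    by (rule integral_unique)
  with set_borel_integral_eq_integral(2)[OF set_integrable_bounded_Icc] assms show ?thesis
    by metis
qed

lemma wave_half_line_derivative:
  "((\<lambda>x. exp (\<i> * k * of_real (x - y))) has_vector_derivative (\<i> * k * exp (\<i> * k * of_real (x - y)))) (at x)"
  "((\<lambda>x. exp (\<i> * k * of_real (y - x))) has_vector_derivative (- (\<i> * k * exp (\<i> * k * of_real (y - x))))) (at x)"
proof -
  show "((\<lambda>x. exp (\<i> * k * of_real (x - y))) has_vector_derivative (\<i> * k * exp (\<i> * k * of_real (x - y)))) (at x)"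
    unfolding of_real_diff
    by (rule has_vector_derivative_real_field[where f = "\<lambda>w. exp (\<i> * k * (w - of_real y))"])
      (auto intro!: derivative_eq_intros)
  show "((\<lambda>x. exp (\<i> * k * of_real (y - x))) has_vector_derivative (- (\<i> * k * exp (\<i> * k * of_real (y - x))))) (at x)"
    unfolding of_real_diff
    by (rule has_vector_derivative_real_field[where f = "\<lambda>w. exp (\<i> * k * (of_real y - w))"])
      (auto intro!: derivative_eq_intros)
qed

lemma cmod_wave_le_1: "0 < Im k \<Longrightarrow> cmod (wave k t) \<le> 1" "0 < Im k \<Longrightarrow> cmod (signed_wave k t) \<le> 1"
  by (simp_all add: cmod_wave cmod_signed_wave)

lemma wave_diff:
  assumes "a \<le> b" "0 < Im k"
  shows "wave k (b - y) - wave k (a - y) = (LINT x:{a..b}|lborel. \<i> * k * signed_wave k (x - y))"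
proof (rule integral_eq_FTC_except[OF assms(1), of "{y}", symmetric])
  show "continuous_on {a..b} (\<lambda>x. wave k (x - y))"
    unfolding wave_def by (intro continuous_intros)
  show "cmod (\<i> * k * signed_wave k (x - y)) \<le> cmod k" for x
    using cmod_wave_le_1(2)[OF assms(2)] by (simp add: norm_mult mult_left_le)
  show "((\<lambda>x. wave k (x - y)) has_vector_derivative \<i> * k * signed_wave k (x - y)) (at x)"
    if x: "x \<in> {a<..<b} - {y}" for x
  proof (cases "y < x")
    case True
    have "((\<lambda>x. wave k (x - y)) has_vector_derivative \<i> * k * exp (\<i> * k * of_real (x - y))) (at x)"
      by (rule has_vector_derivative_transform_within_open[OF wave_half_line_derivative(1), of "{y<..}"])
        (use True in \<open>auto simp: wave_def\<close>)
    with True show ?thesis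
      by (simp add: signed_wave_def wave_def)
  next
    case False
    with x have lt: "x < y" by auto
    have "((\<lambda>x. wave k (x - y)) has_vector_derivative - (\<i> * k * exp (\<i> * k * of_real (y - x)))) (at x)"
      by (rule has_vector_derivative_transform_within_open[OF wave_half_line_derivative(2), of "{..<y}"])
        (use lt in \<open>auto simp: wave_def\<close>)
    with lt show ?thesis
      by (simp add: signed_wave_def wave_def)
  qed
qed auto

text \<open>The jump of height 2 of the signed wave at 0 is subtracted to obtain a continuous primitive.\<close>

lemma signed_wave_diff:
  assumes "a \<le> b" "0 < Im k"
  shows "signed_wave k (b - y) - signed_wave k (a - y) =
    (LINT x:{a..b}|lborel. \<i> * k * wave k (x - y)) + 2 * indicator {a<..b} y"
proof -
  \<comment> \<open>Each \<open>max\<close> freezes the exponential on the wrong side of y at the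
    value 1; the two branches meet at y with the value 0.\<close>
  define F where "F x = exp (\<i> * k * of_real (max (x - y) 0)) - exp (\<i> * k * of_real (max (y - x) 0))" for x
  have F1: "F x = exp (\<i> * k * of_real (x - y)) - 1" if "y \<le> x" for x
    using that by (simp add: F_def max_def)
  have F2: "F x = 1 - exp (\<i> * k * of_real (y - x))" if "x \<le> y" for x
    using that by (simp add: F_def max_def)
  have "(LINT x:{a..b}|lborel. \<i> * k * wave k (x - y)) = F b - F a"
  proof (rule integral_eq_FTC_except[OF assms(1), of "{y}"])
    show "continuous_on {a..b} F"
      unfolding F_def by (intro continuous_intros)
    show "cmod (\<i> * k * wave k (x - y)) \<le> cmod k" for x
      using cmod_wave_le_1(1)[OF assms(2)] by (simp add: norm_mult mult_left_le)
    show "(F has_vector_derivative \<i> * k * wave k (x - y)) (at x)"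
      if x: "x \<in> {a<..<b} - {y}" for x
    proof (cases "y < x")
      case True
      have "(F has_vector_derivative \<i> * k * exp (\<i> * k * of_real (x - y)) - 0) (at x)"
        by (rule has_vector_derivative_transform_within_open[
              OF has_vector_derivative_diff[OF wave_half_line_derivative(1) has_vector_derivative_const], of "{y<..}"])
          (use True F1 in auto)
      with True show ?thesis
        by (simp add: wave_def)
    next
      case False
      with x have lt: "x < y" by auto
      have "(F has_vector_derivative 0 - - (\<i> * k * exp (\<i> * k * of_real (y - x)))) (at x)"
        by (rule has_vector_derivative_transform_within_open[
              OF has_vector_derivative_diff[OF has_vector_derivative_const wave_half_line_derivative(2)], of "{..<y}"])
          (use lt F2 in auto)
      with lt show ?thesis
        by (simp add: wave_def)
    qed
  qed auto
  moreover have "signed_wave k (x - y) = F x + (if y \<le> x then 1 else - 1)" for x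
    using F1[of x] F2[of x] by (auto simp: signed_wave_def wave_def)
  ultimately show ?thesis
    using assms(1) by (auto simp: indicator_def)
qed

lemma integral_reflect:
  fixes f :: "real \<Rightarrow> 'a::{banach, second_countable_topology}"
  shows "(LINT y|lborel. f (x - y)) = (LINT y|lborel. f y)"
  using lborel_integral_real_affine[of "-1" f x] by simp

text \<open>This follows from 2 E p \<le> E^2 + p^2 and E^2 \<le> E for E \<le> 1. The bound is
  crude but uniform in \<open>x\<close>, which is what the Fubini argument over a bounded interval
  asks for.\<close>

lemma integrable_decay_mult:
  fixes p :: "real \<Rightarrow> 'a::{real_normed_vector, second_countable_topology}"
  assumes c: "0 < (c::real)" and [measurable]: "p \<in> borel_measurable borel"
    and p: "integrable lborel (\<lambda>y. (norm (p y))\<^sup>2)"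
  shows "integrable lborel (\<lambda>y. exp (- (c * \<bar>x - y\<bar>)) * norm (p y))"
    and "(LINT y|lborel. exp (- (c * \<bar>x - y\<bar>)) * norm (p y)) \<le>
      (LINT t|lborel. exp (- (c * \<bar>t\<bar>))) + (LINT y|lborel. (norm (p y))\<^sup>2)"
proof -
  have e: "integrable lborel (\<lambda>y. exp (- (c * \<bar>x - y\<bar>)))"
    using lborel_integrable_real_affine[OF integrable_exp_minus_abs[OF c], of "-1" x] by simp
  have le: "exp (- (c * \<bar>x - y\<bar>)) * norm (p y) \<le> exp (- (c * \<bar>x - y\<bar>)) + (norm (p y))\<^sup>2" for y
  proof -
    define E where "E = exp (- (c * \<bar>x - y\<bar>))"
    have E: "0 \<le> E" "E \<le> 1" using c by (auto simp: E_def)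
    have "2 * (E * norm (p y)) \<le> E\<^sup>2 + (norm (p y))\<^sup>2"
      using zero_le_power2[of "E - norm (p y)"] by (simp add: power2_diff)
    moreover have "E\<^sup>2 \<le> E"
      using E by (simp add: power2_eq_square mult_left_le)
    moreover have "0 \<le> E * norm (p y)" using E by simp
    ultimately show ?thesis
      using E(1) unfolding E_def[symmetric] by linarith
  qed
  have sum: "integrable lborel (\<lambda>y. exp (- (c * \<bar>x - y\<bar>)) + (norm (p y))\<^sup>2)"
    using e p by (rule Bochner_Integration.integrable_add)
  show int: "integrable lborel (\<lambda>y. exp (- (c * \<bar>x - y\<bar>)) * norm (p y))"
    by (rule Bochner_Integration.integrable_bound[OF sum]) (use le in \<open>auto intro!: AE_I2\<close>)
  have "(LINT y|lborel. exp (- (c * \<bar>x - y\<bar>)) * norm (p y)) \<le>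
      (LINT y|lborel. exp (- (c * \<bar>x - y\<bar>)) + (norm (p y))\<^sup>2)"
    by (intro integral_mono int sum le)
  also have "\<dots> = (LINT t|lborel. exp (- (c * \<bar>t\<bar>))) + (LINT y|lborel. (norm (p y))\<^sup>2)"
    using integral_reflect[of "\<lambda>t. exp (- (c * \<bar>t\<bar>))" x] by (simp add: Bochner_Integration.integral_add e p)
  finally show "(LINT y|lborel. exp (- (c * \<bar>x - y\<bar>)) * norm (p y)) \<le>
      (LINT t|lborel. exp (- (c * \<bar>t\<bar>))) + (LINT y|lborel. (norm (p y))\<^sup>2)" .
qed

lemma integrable_decay_kernel_mult:
  fixes e p :: "real \<Rightarrow> complex"
  assumes "0 < (c::real)" and [measurable]: "e \<in> borel_measurable borel" "p \<in> borel_measurable borel"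
    and "integrable lborel (\<lambda>y. (cmod (p y))\<^sup>2)" and "\<And>t. cmod (e t) = exp (- (c * \<bar>t\<bar>))"
  shows "integrable lborel (\<lambda>y. e (x - y) * p y)"
  by (rule Bochner_Integration.integrable_bound[OF integrable_decay_mult(1)[OF assms(1,3,4)]])
    (auto simp: norm_mult assms(5))

lemma set_integrable_square_integrable:
  fixes q :: "real \<Rightarrow> complex"
  assumes [measurable]: "q \<in> borel_measurable borel" and q: "integrable lborel (\<lambda>y. (cmod (q y))\<^sup>2)"
  shows "set_integrable lborel {a..b} q"
  unfolding set_integrable_def
proof (rule Bochner_Integration.integrable_bound)
  have "integrable lborel (indicator {a..b} :: real \<Rightarrow> real)"
    by (auto intro!: integrable_real_indicator simp: emeasure_lborel_Icc_eq)
  with q show "integrable lborel (\<lambda>y. indicator {a..b} y + (cmod (q y))\<^sup>2)"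
    by (intro Bochner_Integration.integrable_add)
  have "x \<le> 1 + x\<^sup>2" for x :: real
    using zero_le_power2[of "x - 1"] zero_le_power2[of x] unfolding power2_diff
    by (simp only: mult_1_right one_power2)
  then show "AE y in lborel. norm (indicator {a..b} y *\<^sub>R q y) \<le> norm (indicator {a..b} y + (cmod (q y))\<^sup>2)"
    by (intro AE_I2) (auto simp: indicator_def)
qed simp

text \<open>Instead of differentiating under the integral sign, the kernel differences are written
  as integrals for each fixed y and the order of integration is exchanged. Differentiation swaps the
  two waves up to the factor \<i> k, and the jump of height 2 of the signed wave contributes
  \<open>2 * q\<close>.\<close>

lemma wave_convolution_ac:
  fixes p q :: "real \<Rightarrow> complex"
  assumes k: "0 < Im k" and ab: "a \<le> b"
    and [measurable]: "p \<in> borel_measurable borel" "q \<in> borel_measurable borel"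
    and p2: "integrable lborel (\<lambda>y. (cmod (p y))\<^sup>2)" and q2: "integrable lborel (\<lambda>y. (cmod (q y))\<^sup>2)"
  defines "f \<equiv> \<lambda>x. LINT y|lborel. wave k (x - y) * p y + signed_wave k (x - y) * q y"
    and "g \<equiv> \<lambda>x. LINT y|lborel. signed_wave k (x - y) * p y + wave k (x - y) * q y"
  shows "set_integrable lborel {a..b} (\<lambda>x. \<i> * k * g x + 2 * q x)"
    and "f b - f a = (LINT x:{a..b}|lborel. \<i> * k * g x + 2 * q x)"
proof -
  note ik = integrable_decay_kernel_mult[OF k _ _ _ cmod_wave]
    integrable_decay_kernel_mult[OF k _ _ _ cmod_signed_wave]
  have int: "integrable lborel (\<lambda>y. wave k (x - y) * p y)" "integrable lborel (\<lambda>y. signed_wave k (x - y) * p y)"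
    "integrable lborel (\<lambda>y. wave k (x - y) * q y)" "integrable lborel (\<lambda>y. signed_wave k (x - y) * q y)" for x
    by (intro ik p2 q2; measurable)+
  define h where "h x y = indicator {a..b} x *\<^sub>R
    (\<i> * k * (signed_wave k (x - y) * p y + wave k (x - y) * q y))" for x y
  have h_meas [measurable]: "(\<lambda>(x, y). h x y) \<in> borel_measurable (lborel \<Otimes>\<^sub>M lborel)"
    unfolding h_def by measurable
  have h_int: "integrable lborel (\<lambda>y. h x y)" for x
    unfolding h_def by (intro integrable_scaleR_right integrable_mult_right Bochner_Integration.integrable_add int)
  define J where "J = (LINT t|lborel. decay k t)"
  define P where "P = (LINT y|lborel. (cmod (p y))\<^sup>2)"
  define Q where "Q = (LINT y|lborel. (cmod (q y))\<^sup>2)"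
  have h_bound: "(LINT y|lborel. norm (h x y)) \<le> indicator {a..b} x * (cmod k * ((J + P) + (J + Q)))" for x
  proof -
    let ?E = "\<lambda>y. decay k (x - y)"
    have ip: "integrable lborel (\<lambda>y. ?E y * norm (p y))" and iq: "integrable lborel (\<lambda>y. ?E y * norm (q y))"
      by (intro integrable_decay_mult(1) k p2 q2; measurable)+
    have "(LINT y|lborel. norm (h x y)) \<le> (LINT y|lborel. indicator {a..b} x * (cmod k * (?E y * norm (p y) + ?E y * norm (q y))))"
    proof (intro integral_mono integrable_norm h_int integrable_mult_right Bochner_Integration.integrable_add ip iq)
      fix y
      have "cmod (signed_wave k (x - y) * p y + wave k (x - y) * q y) \<le> ?E y * norm (p y) + ?E y * norm (q y)"
        by (rule order.trans[OF norm_triangle_ineq]) (simp add: norm_mult cmod_wave cmod_signed_wave)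
      then show "norm (h x y) \<le> indicator {a..b} x * (cmod k * (?E y * norm (p y) + ?E y * norm (q y)))"
        unfolding h_def by (simp add: norm_mult mult_left_mono)
    qed
    also have "\<dots> = indicator {a..b} x * (cmod k * ((LINT y|lborel. ?E y * norm (p y)) + (LINT y|lborel. ?E y * norm (q y))))"
      by (simp add: Bochner_Integration.integral_add ip iq)
    also have "\<dots> \<le> indicator {a..b} x * (cmod k * ((J + P) + (J + Q)))"
      unfolding J_def P_def Q_def
      by (intro mult_left_mono add_mono integrable_decay_mult(2) k p2 q2; (measurable; fail)?)
    finally show ?thesis .
  qed
  have h_prod: "integrable (lborel \<Otimes>\<^sub>M lborel) (\<lambda>(x, y). h x y)"
  proof (rule lborel_pair.Fubini_integrable)
    have ind: "integrable lborel (\<lambda>x. indicator {a..b} x * (cmod k * ((J + P) + (J + Q))) :: real)"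
      by (auto intro!: integrable_mult_left integrable_real_indicator simp: emeasure_lborel_Icc_eq)
    show "integrable lborel (\<lambda>x. LINT y|lborel. norm (case (x, y) of (x, y) \<Rightarrow> h x y))"
    proof (rule Bochner_Integration.integrable_bound[OF ind])
      have "0 \<le> (LINT y|lborel. norm (h x y))" for x by simp
      with h_bound show "AE x in lborel. norm (LINT y|lborel. norm (case (x, y) of (x, y) \<Rightarrow> h x y))
          \<le> norm (indicator {a..b} x * (cmod k * ((J + P) + (J + Q))))"
        by (intro AE_I2) (smt (verit) case_prod_conv real_norm_def Bochner_Integration.integral_cong)
    qed (simp add: split_beta')
    show "AE x in lborel. integrable lborel (\<lambda>y. case (x, y) of (x, y) \<Rightarrow> h x y)"
      by (simp add: h_int)
  qed (rule h_meas)
  have g_int: "(LINT y|lborel. h x y) = indicator {a..b} x *\<^sub>R (\<i> * k * g x)" for x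
    unfolding h_def g_def by simp
  have sg: "set_integrable lborel {a..b} (\<lambda>x. \<i> * k * g x)"
    using lborel_pair.integrable_fst[OF h_prod] by (simp add: set_integrable_def g_int)
  have sq: "set_integrable lborel {a..b} q"
    by (rule set_integrable_square_integrable) (use q2 in auto)
  then have sq2: "set_integrable lborel {a..b} (\<lambda>x. 2 * q x)"
    by simp
  show "set_integrable lborel {a..b} (\<lambda>x. \<i> * k * g x + 2 * q x)"
    using sg sq2 by (rule set_integral_add(1))
  \<comment> \<open>The jump term lives on a half-open interval, the set integral on a closed one;
    they differ by one point.\<close>
  have AE: "AE y in lborel. indicator {a<..b} y *\<^sub>R q y = indicator {a..b} y *\<^sub>R q y"
    using AE_lborel_singleton[of a] by eventually_elim (auto simp: indicator_def)
  have sq': "integrable lborel (\<lambda>y. indicator {a<..b} y *\<^sub>R q y)"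
    using sq AE by (subst integrable_cong_AE) (auto simp: set_integrable_def)
  then have sq2': "integrable lborel (\<lambda>y. 2 * (indicator {a<..b} y *\<^sub>R q y))"
    by (intro integrable_mult_right)
  have pointwise: "(wave k (b - y) - wave k (a - y)) * p y + (signed_wave k (b - y) - signed_wave k (a - y)) * q y =
      (LINT x|lborel. h x y) + 2 * (indicator {a<..b} y *\<^sub>R q y)" for y
  proof -
    have s1: "set_integrable lborel {a..b} (\<lambda>x. \<i> * k * signed_wave k (x - y) * p y)"
      by (rule set_integrable_bounded_Icc[of _ _ _ "cmod k * cmod (p y)"])
        (auto simp: norm_mult intro!: mult_right_mono mult_left_le cmod_wave_le_1 k)
    have s2: "set_integrable lborel {a..b} (\<lambda>x. \<i> * k * wave k (x - y) * q y)"
      by (rule set_integrable_bounded_Icc[of _ _ _ "cmod k * cmod (q y)"])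
        (auto simp: norm_mult intro!: mult_right_mono mult_left_le cmod_wave_le_1 k)
    have "(LINT x|lborel. h x y) = (LINT x:{a..b}|lborel. \<i> * k * signed_wave k (x - y) * p y + \<i> * k * wave k (x - y) * q y)"
      unfolding set_lebesgue_integral_def h_def by (simp add: algebra_simps)
    also have "\<dots> = (LINT x:{a..b}|lborel. \<i> * k * signed_wave k (x - y)) * p y + (LINT x:{a..b}|lborel. \<i> * k * wave k (x - y)) * q y"
      using set_integral_add(2)[OF s1 s2] by simp
    finally show ?thesis
      unfolding wave_diff[OF ab k] signed_wave_diff[OF ab k]
      by (simp add: algebra_simps indicator_def)
  qed
  have "f b - f a = (LINT y|lborel. (wave k (b - y) - wave k (a - y)) * p y + (signed_wave k (b - y) - signed_wave k (a - y)) * q y)"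
    unfolding f_def
    by (subst Bochner_Integration.integral_diff[symmetric]; (intro Bochner_Integration.integrable_add int)?)
      (simp add: algebra_simps)
  also have "\<dots> = (LINT y|lborel. (LINT x|lborel. h x y) + 2 * (indicator {a<..b} y *\<^sub>R q y))"
    unfolding pointwise ..
  also have "\<dots> = (LINT y|lborel. (LINT x|lborel. h x y)) + 2 * (LINT y|lborel. indicator {a<..b} y *\<^sub>R q y)"
    using Bochner_Integration.integral_add[OF lborel_pair.integrable_snd[OF h_prod] sq2']
    by (simp del: mult_scaleR_right)
  also have "(LINT y|lborel. (LINT x|lborel. h x y)) = (LINT x|lborel. (LINT y|lborel. h x y))"
    by (rule lborel_pair.Fubini_integral[OF h_prod])
  also have "\<dots> = (LINT x:{a..b}|lborel. \<i> * k * g x)"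
    by (simp only: g_int set_lebesgue_integral_def)
  also have "(LINT y|lborel. indicator {a<..b} y *\<^sub>R q y) = (LINT y:{a..b}|lborel. q y)"
    unfolding set_lebesgue_integral_def using AE by (intro integral_cong_AE) auto
  also have "(LINT x:{a..b}|lborel. \<i> * k * g x) + 2 * (LINT y:{a..b}|lborel. q y) = (LINT x:{a..b}|lborel. \<i> * k * g x + 2 * q x)"
    using set_integral_add(2)[OF sg sq2] by (simp only: set_integral_mult_right)
  finally show "f b - f a = (LINT x:{a..b}|lborel. \<i> * k * g x + 2 * q x)" .
qed

section \<open>Convolution inequalities and bounds for the Green operator\<close>

lemma young_L2:
  fixes e \<phi> :: "real \<Rightarrow> real"
  assumes [measurable]: "e \<in> borel_measurable borel" "\<phi> \<in> borel_measurable borel"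
    and e: "\<And>t. 0 \<le> e t" and \<phi>: "\<And>t. 0 \<le> \<phi> t"
  shows "(\<integral>\<^sup>+x. (\<integral>\<^sup>+y. ennreal (e (x - y)) * ennreal (\<phi> y) \<partial>lborel)\<^sup>2 \<partial>lborel)
    \<le> (\<integral>\<^sup>+t. ennreal (e t) \<partial>lborel)\<^sup>2 * (\<integral>\<^sup>+y. ennreal ((\<phi> y)\<^sup>2) \<partial>lborel)"
proof -
  let ?J = "\<integral>\<^sup>+t. ennreal (e t) \<partial>lborel"
  have "(\<integral>\<^sup>+y. ennreal (e (x - y)) * ennreal (\<phi> y) \<partial>lborel)\<^sup>2 \<le>
      ?J * (\<integral>\<^sup>+y. ennreal (e (x - y)) * ennreal ((\<phi> y)\<^sup>2) \<partial>lborel)" for x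
  proof -
    \<comment> \<open>Splitting \<open>e\<close> into two square roots lets Cauchy-Schwarz leave the
      total mass of \<open>e\<close> times the convolution of \<open>e\<close> with the square of
      \<phi>.\<close>
    have "(\<integral>\<^sup>+y. ennreal (e (x - y)) * ennreal (\<phi> y) \<partial>lborel)\<^sup>2 =
        (\<integral>\<^sup>+y. ennreal (sqrt (e (x - y))) * ennreal (sqrt (e (x - y)) * \<phi> y) \<partial>lborel)\<^sup>2"
      using e \<phi> by (simp add: ennreal_mult[symmetric] mult.assoc[symmetric])
    also have "\<dots> \<le> (\<integral>\<^sup>+y. (ennreal (sqrt (e (x - y))))\<^sup>2 \<partial>lborel) *
        (\<integral>\<^sup>+y. (ennreal (sqrt (e (x - y)) * \<phi> y))\<^sup>2 \<partial>lborel)"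
      by (rule Cauchy_Schwarz_nn_integral) measurable
    also have "\<dots> = (\<integral>\<^sup>+y. ennreal (e (x - y)) \<partial>lborel) *
        (\<integral>\<^sup>+y. ennreal (e (x - y)) * ennreal ((\<phi> y)\<^sup>2) \<partial>lborel)"
      using e \<phi> by (simp add: ennreal_power ennreal_mult[symmetric] power_mult_distrib)
    finally show ?thesis
      by (simp add: nn_integral_reflect[of "\<lambda>t. ennreal (e t)"])
  qed
  then have "(\<integral>\<^sup>+x. (\<integral>\<^sup>+y. ennreal (e (x - y)) * ennreal (\<phi> y) \<partial>lborel)\<^sup>2 \<partial>lborel) \<le>
      (\<integral>\<^sup>+x. ?J * (\<integral>\<^sup>+y. ennreal (e (x - y)) * ennreal ((\<phi> y)\<^sup>2) \<partial>lborel) \<partial>lborel)"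
    by (rule nn_integral_mono)
  also have "\<dots> = ?J * (?J * (\<integral>\<^sup>+y. ennreal ((\<phi> y)\<^sup>2) \<partial>lborel))"
    by (subst nn_integral_cmult) (measurable, subst nn_integral_convolution, auto)
  finally show ?thesis
    by (simp add: power2_eq_square mult.assoc)
qed

text \<open>Because e \<le> 1, one of the two factors is at most the L^1 norm of \<phi>; the other
  is integrated by Tonelli.\<close>

lemma young_L1_L2:
  fixes e \<phi> :: "real \<Rightarrow> ennreal"
  assumes [measurable]: "e \<in> borel_measurable borel" "\<phi> \<in> borel_measurable borel"
    and e: "\<And>t. e t \<le> 1"
  shows "(\<integral>\<^sup>+x. (\<integral>\<^sup>+y. e (x - y) * \<phi> y \<partial>lborel)\<^sup>2 \<partial>lborel)
    \<le> (\<integral>\<^sup>+t. e t \<partial>lborel) * (\<integral>\<^sup>+y. \<phi> y \<partial>lborel)\<^sup>2"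
proof -
  have "(\<integral>\<^sup>+x. (\<integral>\<^sup>+y. e (x - y) * \<phi> y \<partial>lborel)\<^sup>2 \<partial>lborel)
      \<le> (\<integral>\<^sup>+x. (\<integral>\<^sup>+y. \<phi> y \<partial>lborel) * (\<integral>\<^sup>+y. e (x - y) * \<phi> y \<partial>lborel) \<partial>lborel)"
    unfolding power2_eq_square
    by (intro nn_integral_mono mult_right_mono) (use mult_right_mono[OF e] in auto)
  also have "\<dots> = (\<integral>\<^sup>+y. \<phi> y \<partial>lborel) * ((\<integral>\<^sup>+t. e t \<partial>lborel) * (\<integral>\<^sup>+y. \<phi> y \<partial>lborel))"
    by (subst nn_integral_cmult) (measurable, subst nn_integral_convolution, auto)
  finally show ?thesis
    by (simp add: power2_eq_square mult_ac)
qed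

lemma integrable_vec2I:
  fixes f :: "'b \<Rightarrow> complex^2"
  assumes f: "\<And>i. integrable M (\<lambda>x. f x $ i)"
  shows "integrable M f"
proof (rule Bochner_Integration.integrable_bound)
  show "integrable M (\<lambda>x. norm (f x $ 1) + norm (f x $ 2))"
    by (intro Bochner_Integration.integrable_add integrable_norm f)
  show "f \<in> borel_measurable M"
    by (intro borel_measurable_vecI borel_measurable_integrable f)
qed (auto intro: order.trans[OF norm_vec2_le])

lemma integral_vec_nth:
  fixes f :: "'b \<Rightarrow> complex^2"
  assumes "integrable M f"
  shows "(LINT x|M. f x) $ i = (LINT x|M. f x $ i)"
  using integral_bounded_linear[OF bounded_linear_vec_nth assms] by simp

lemma integrable_vec_nth:
  fixes f :: "'b \<Rightarrow> complex^2"
  assumes "integrable M f"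
  shows "integrable M (\<lambda>x. f x $ i)"
  by (rule integrable_bounded_linear[OF bounded_linear_vec_nth assms])

lemma ac_with_derivative_iff_nth:
  "ac_with_derivative f f' \<longleftrightarrow> (\<forall>a b i. a \<le> b \<longrightarrow> set_integrable lborel {a..b} (\<lambda>x. f' x $ i) \<and>
     f b $ i - f a $ i = (LINT x:{a..b}|lborel. f' x $ i))"
proof -
  have 1: "set_integrable lborel {a..b} f' \<longleftrightarrow> (\<forall>i. set_integrable lborel {a..b} (\<lambda>x. f' x $ i))" for a b
    unfolding set_integrable_def
    using integrable_vec2I[of lborel "\<lambda>x. indicator {a..b} x *\<^sub>R f' x"]
      integrable_vec_nth[of lborel "\<lambda>x. indicator {a..b} x *\<^sub>R f' x"] by auto
  have 2: "(LINT x:{a..b}|lborel. f' x) $ i = (LINT x:{a..b}|lborel. f' x $ i)"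
    if "set_integrable lborel {a..b} f'" for a b i
    using integral_vec_nth[OF that[unfolded set_integrable_def]] by (simp add: set_lebesgue_integral_def)
  show ?thesis
    unfolding ac_with_derivative_def vec_eq_iff[of "_ - _"] using 1 2 by (auto simp: vec_eq_iff)
qed

definition green_kernel :: "complex \<Rightarrow> complex \<Rightarrow> real \<Rightarrow> complex^2 \<Rightarrow> complex^2" where
  "green_kernel k \<zeta> t w = vector [\<i> / 2 * (\<zeta> * wave k t * w$1 + signed_wave k t * w$2),
     \<i> / 2 * (signed_wave k t * w$1 + wave k t * w$2 / \<zeta>)]"

definition green :: "complex \<Rightarrow> complex \<Rightarrow> (real \<Rightarrow> complex^2) \<Rightarrow> real \<Rightarrow> complex^2" where
  "green k \<zeta> f x = (LINT y|lborel. green_kernel k \<zeta> (x - y) (f y))"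

text \<open>For nonzero \<zeta> this is (|\<zeta>| + 1/|\<zeta>|)/2. The radicand is (|\<zeta>|^2 +
  1)(1 + 1/|\<zeta>|^2), the product of the squared norms of the two factors of the rank-one
  kernel.\<close>

definition green_bound :: "complex \<Rightarrow> real" where
  "green_bound \<zeta> = sqrt (2 + (cmod \<zeta>)\<^sup>2 + 1 / (cmod \<zeta>)\<^sup>2) / 2"

lemma green_kernel_nth:
  "green_kernel k \<zeta> t w $ 1 = \<i> / 2 * (\<zeta> * wave k t * w$1 + signed_wave k t * w$2)"
  "green_kernel k \<zeta> t w $ 2 = \<i> / 2 * (signed_wave k t * w$1 + wave k t * w$2 / \<zeta>)"
  by (simp_all add: green_kernel_def)

lemma green_bound_nonneg: "0 \<le> green_bound \<zeta>"
  by (simp add: green_bound_def)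

text \<open>The matrix of the kernel has determinant 0, so it is an outer product.\<close>

lemma norm_green_kernel_le:
  assumes \<zeta>: "\<zeta> \<noteq> 0"
  shows "norm (green_kernel k \<zeta> t w) \<le> green_bound \<zeta> * (decay k t * norm w)"
proof -
  define \<sigma> :: complex where "\<sigma> = (if 0 \<le> t then 1 else - 1)"
  have \<sigma>: "\<sigma> * \<sigma> = 1" "cmod \<sigma> = 1" "signed_wave k t = \<sigma> * wave k t"
    by (auto simp: \<sigma>_def signed_wave_def)
  \<comment> \<open>Up to the scalar \<open>\<i> / 2 * wave k t\<close>, the kernel sends
    \<open>w\<close> to \<open>r\<close> times the vector (\<zeta>, \<sigma>).\<close>
  define r where "r = w$1 + \<sigma> * w$2 / \<zeta>"
  define E where "E = decay k t"
  have g1: "green_kernel k \<zeta> t w $ 1 = \<i> / 2 * wave k t * r * \<zeta>"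
    using \<zeta> by (simp add: green_kernel_nth \<sigma>(3) r_def field_simps)
  have g2: "green_kernel k \<zeta> t w $ 2 = \<i> / 2 * wave k t * r * \<sigma>"
    using \<sigma>(1) by (simp add: green_kernel_nth \<sigma>(3) r_def field_simps)
  have norm: "(norm (green_kernel k \<zeta> t w))\<^sup>2 = (E / 2)\<^sup>2 * ((cmod r)\<^sup>2 * ((cmod \<zeta>)\<^sup>2 + 1))"
    unfolding norm_vec2 g1 g2 by (simp add: norm_mult norm_divide cmod_wave E_def power_divide \<sigma>(2) power_mult_distrib algebra_simps)
  have "cmod r \<le> cmod (w$1) * 1 + cmod (w$2) * inverse (cmod \<zeta>)"
    unfolding r_def by (rule order.trans[OF norm_triangle_ineq]) (simp add: norm_mult norm_divide \<sigma>(2) field_simps)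
  then have "(cmod r)\<^sup>2 \<le> (cmod (w$1) * 1 + cmod (w$2) * inverse (cmod \<zeta>))\<^sup>2"
    by (intro power_mono) auto
  also have "\<dots> \<le> (norm w)\<^sup>2 * (1 + (inverse (cmod \<zeta>))\<^sup>2)"
    unfolding norm_vec2
    using zero_le_power2[of "cmod (w$1) * inverse (cmod \<zeta>) - cmod (w$2)"]
    by (simp add: power2_eq_square algebra_simps)
  finally have "(cmod r)\<^sup>2 * ((cmod \<zeta>)\<^sup>2 + 1) \<le> (norm w)\<^sup>2 * (1 + (inverse (cmod \<zeta>))\<^sup>2) * ((cmod \<zeta>)\<^sup>2 + 1)"
    by (intro mult_right_mono) auto
  also have "(norm w)\<^sup>2 * (1 + (inverse (cmod \<zeta>))\<^sup>2) * ((cmod \<zeta>)\<^sup>2 + 1) = (norm w)\<^sup>2 * (2 + (cmod \<zeta>)\<^sup>2 + 1 / (cmod \<zeta>)\<^sup>2)"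
    using \<zeta> by (simp add: field_simps)
  finally have "(norm (green_kernel k \<zeta> t w))\<^sup>2 \<le> (E / 2)\<^sup>2 * ((norm w)\<^sup>2 * (2 + (cmod \<zeta>)\<^sup>2 + 1 / (cmod \<zeta>)\<^sup>2))"
    unfolding norm by (intro mult_left_mono) auto
  also have "\<dots> = (green_bound \<zeta> * (E * norm w))\<^sup>2"
    by (simp add: green_bound_def power_mult_distrib power_divide)
  finally show ?thesis
    unfolding E_def[symmetric]
    by (rule power2_le_imp_le) (simp add: green_bound_nonneg E_def)
qed

lemma borel_measurable_green_kernel [measurable (raw)]:
  assumes [measurable]: "h \<in> borel_measurable M" "f \<in> borel_measurable M"
  shows "(\<lambda>x. green_kernel k \<zeta> (h x) (f x)) \<in> borel_measurable M"
proof (rule borel_measurable_vecI)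
  fix i :: 2
  show "(\<lambda>x. green_kernel k \<zeta> (h x) (f x) $ i) \<in> borel_measurable M"
    using exhaust_2[of i] by (auto simp: green_kernel_nth)
qed

lemma borel_measurable_green [measurable]:
  assumes [measurable]: "f \<in> borel_measurable borel"
  shows "green k \<zeta> f \<in> borel_measurable borel"
  unfolding green_def by measurable

lemma square_integrable_borel: "square_integrable f \<Longrightarrow> f \<in> borel_measurable borel"
  by (simp add: square_integrable_def)

lemma integrable_green_kernel:
  assumes "\<zeta> \<noteq> 0" "0 < Im k" and f: "square_integrable f"
  shows "integrable lborel (\<lambda>y. green_kernel k \<zeta> (x - y) (f y))"
proof (rule Bochner_Integration.integrable_bound)
  note [measurable] = square_integrable_borel[OF f]
  show "integrable lborel (\<lambda>y. green_bound \<zeta> * (decay k (x - y) * norm (f y)))"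
    using f by (intro integrable_mult_right integrable_decay_mult assms) (auto simp: square_integrable_def)
  show "(\<lambda>y. green_kernel k \<zeta> (x - y) (f y)) \<in> borel_measurable lborel"
    by measurable
  show "AE y in lborel. norm (green_kernel k \<zeta> (x - y) (f y)) \<le> norm (green_bound \<zeta> * (decay k (x - y) * norm (f y)))"
    using norm_green_kernel_le[OF assms(1)] by (intro AE_I2) (auto intro: order.trans[OF _ abs_ge_self])
qed

lemma green_le_convolution:
  assumes "\<zeta> \<noteq> 0" "0 < Im k" "square_integrable f"
  shows "ennreal (norm (green k \<zeta> f x)) \<le>
    ennreal (green_bound \<zeta>) * (\<integral>\<^sup>+y. ennreal (decay k (x - y)) * ennreal (norm (f y)) \<partial>lborel)"
proof -
  note [measurable] = square_integrable_borel[OF assms(3)]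
  have "ennreal (norm (green k \<zeta> f x)) \<le> (\<integral>\<^sup>+y. norm (green_kernel k \<zeta> (x - y) (f y)) \<partial>lborel)"
    unfolding green_def by (rule integral_norm_bound_ennreal[OF integrable_green_kernel[OF assms]])
  also have "\<dots> \<le> (\<integral>\<^sup>+y. ennreal (green_bound \<zeta>) * (ennreal (decay k (x - y)) * ennreal (norm (f y))) \<partial>lborel)"
  proof (rule nn_integral_mono)
    fix y
    show "ennreal (norm (green_kernel k \<zeta> (x - y) (f y))) \<le> ennreal (green_bound \<zeta>) * (ennreal (decay k (x - y)) * ennreal (norm (f y)))"
      using norm_green_kernel_le[OF assms(1), of k "x - y" "f y"]
      by (simp add: ennreal_mult[symmetric] green_bound_nonneg)
  qed
  also have "\<dots> = ennreal (green_bound \<zeta>) * (\<integral>\<^sup>+y. ennreal (decay k (x - y)) * ennreal (norm (f y)) \<partial>lborel)"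
    by (intro nn_integral_cmult) measurable
  finally show ?thesis .
qed

text \<open>The estimate behind the norm of \<open>op_Q\<close>: unlike the L^2 bound below, its
  constant does not contain the mass of the decaying exponential, which blows up as Im k tends to
  0.\<close>

lemma green_sup_bound:
  assumes "\<zeta> \<noteq> 0" "0 < Im k" "square_integrable f"
  shows "ennreal (norm (green k \<zeta> f x)) \<le> ennreal (green_bound \<zeta>) * (\<integral>\<^sup>+y. ennreal (norm (f y)) \<partial>lborel)"
proof -
  have "ennreal (decay k (x - y)) \<le> 1" for y
    using assms(2) by simp
  then have "(\<integral>\<^sup>+y. ennreal (decay k (x - y)) * ennreal (norm (f y)) \<partial>lborel) \<le> (\<integral>\<^sup>+y. ennreal (norm (f y)) \<partial>lborel)"
    by (intro nn_integral_mono) (metis mult_1 mult_right_mono zero_le)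
  then show ?thesis
    using green_le_convolution[OF assms] by (meson mult_left_mono order.trans zero_le)
qed

definition decay_mass :: "complex \<Rightarrow> real" where
  "decay_mass k = (LINT t|lborel. decay k t)"

lemma decay_mass:
  assumes "0 < Im k"
  shows "(\<integral>\<^sup>+t. ennreal (decay k t) \<partial>lborel) = ennreal (decay_mass k)" "0 \<le> decay_mass k"
  unfolding decay_mass_def
  using integrable_exp_minus_abs[OF assms] by (auto simp: nn_integral_eq_integral)

lemma green_square_le:
  assumes "\<zeta> \<noteq> 0" "0 < Im k" "square_integrable f"
  shows "(\<integral>\<^sup>+x. ennreal ((norm (green k \<zeta> f x))\<^sup>2) \<partial>lborel) \<le> (ennreal (green_bound \<zeta>))\<^sup>2 *
    (\<integral>\<^sup>+x. (\<integral>\<^sup>+y. ennreal (decay k (x - y)) * ennreal (norm (f y)) \<partial>lborel)\<^sup>2 \<partial>lborel)"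
proof -
  note [measurable] = square_integrable_borel[OF assms(3)]
  have "(\<integral>\<^sup>+x. ennreal ((norm (green k \<zeta> f x))\<^sup>2) \<partial>lborel) = (\<integral>\<^sup>+x. (ennreal (norm (green k \<zeta> f x)))\<^sup>2 \<partial>lborel)"
    by (simp add: ennreal_power)
  also have "\<dots> \<le> (\<integral>\<^sup>+x. (ennreal (green_bound \<zeta>) *
      (\<integral>\<^sup>+y. ennreal (decay k (x - y)) * ennreal (norm (f y)) \<partial>lborel))\<^sup>2 \<partial>lborel)"
    by (intro nn_integral_mono power_mono green_le_convolution assms) auto
  also have "\<dots> = (ennreal (green_bound \<zeta>))\<^sup>2 *
      (\<integral>\<^sup>+x. (\<integral>\<^sup>+y. ennreal (decay k (x - y)) * ennreal (norm (f y)) \<partial>lborel)\<^sup>2 \<partial>lborel)"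
    unfolding power_mult_distrib by (rule nn_integral_cmult) measurable
  finally show ?thesis .
qed

lemma green_L2_bound:
  assumes "\<zeta> \<noteq> 0" "0 < Im k" "square_integrable f"
  shows "square_integrable (green k \<zeta> f)"
    and "norm (abs_spinor (green k \<zeta> f)) \<le> green_bound \<zeta> * decay_mass k * norm (abs_spinor f)"
proof -
  note [measurable] = square_integrable_borel[OF assms(3)]
  have "(\<integral>\<^sup>+x. (\<integral>\<^sup>+y. ennreal (decay k (x - y)) * ennreal (norm (f y)) \<partial>lborel)\<^sup>2 \<partial>lborel)
    \<le> (ennreal (decay_mass k))\<^sup>2 * ennreal ((norm (abs_spinor f))\<^sup>2)"
    using young_L2[of "\<lambda>t. decay k t" "\<lambda>y. norm (f y)"]
    by (simp add: decay_mass(1)[OF assms(2)] square_integrable_nn_integral[OF assms(3)])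
  then have "(\<integral>\<^sup>+x. ennreal ((norm (green k \<zeta> f x))\<^sup>2) \<partial>lborel) \<le>
      (ennreal (green_bound \<zeta>))\<^sup>2 * ((ennreal (decay_mass k))\<^sup>2 * ennreal ((norm (abs_spinor f))\<^sup>2))"
    by (intro order.trans[OF green_square_le[OF assms]] mult_left_mono) auto
  also have "\<dots> = ennreal ((green_bound \<zeta> * decay_mass k * norm (abs_spinor f))\<^sup>2)"
    using decay_mass(2)[OF assms(2)] green_bound_nonneg[of \<zeta>]
    by (simp add: ennreal_power ennreal_mult[symmetric] power_mult_distrib mult.assoc)
  finally have le: "(\<integral>\<^sup>+x. ennreal ((norm (green k \<zeta> f x))\<^sup>2) \<partial>lborel) \<le>
    ennreal ((green_bound \<zeta> * decay_mass k * norm (abs_spinor f))\<^sup>2)" .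
  show si: "square_integrable (green k \<zeta> f)"
    by (rule square_integrableI) (use le in \<open>auto simp: le_less_trans\<close>)
  show "norm (abs_spinor (green k \<zeta> f)) \<le> green_bound \<zeta> * decay_mass k * norm (abs_spinor f)"
    using decay_mass(2)[OF assms(2)] green_bound_nonneg[of \<zeta>]
    by (intro norm_abs_spinor_le si le) auto
qed

text \<open>This makes R_0 B bounded, as B maps L^2 into L^1.\<close>

lemma green_L1_L2_bound:
  assumes "\<zeta> \<noteq> 0" "0 < Im k" "square_integrable f"
    and L: "0 \<le> L" "(\<integral>\<^sup>+y. ennreal (norm (f y)) \<partial>lborel) \<le> ennreal L"
  shows "norm (abs_spinor (green k \<zeta> f)) \<le> green_bound \<zeta> * sqrt (decay_mass k) * L"
proof -
  note [measurable] = square_integrable_borel[OF assms(3)]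
  have "(\<integral>\<^sup>+x. (\<integral>\<^sup>+y. ennreal (decay k (x - y)) * ennreal (norm (f y)) \<partial>lborel)\<^sup>2 \<partial>lborel)
    \<le> ennreal (decay_mass k) * (\<integral>\<^sup>+y. ennreal (norm (f y)) \<partial>lborel)\<^sup>2"
    using young_L1_L2[of "\<lambda>t. ennreal (decay k t)" "\<lambda>y. ennreal (norm (f y))"] assms(2)
    by (simp add: decay_mass(1)[OF assms(2)])
  also have "\<dots> \<le> ennreal (decay_mass k) * (ennreal L)\<^sup>2"
    by (intro mult_left_mono power_mono L) auto
  finally have "(\<integral>\<^sup>+x. ennreal ((norm (green k \<zeta> f x))\<^sup>2) \<partial>lborel) \<le>
      (ennreal (green_bound \<zeta>))\<^sup>2 * (ennreal (decay_mass k) * (ennreal L)\<^sup>2)"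
    by (intro order.trans[OF green_square_le[OF assms(1-3)]] mult_left_mono) auto
  also have "\<dots> = ennreal ((green_bound \<zeta> * sqrt (decay_mass k) * L)\<^sup>2)"
    using decay_mass(2)[OF assms(2)] green_bound_nonneg[of \<zeta>] L(1)
    by (simp add: ennreal_power ennreal_mult[symmetric] power_mult_distrib mult.assoc)
  finally show ?thesis
    using decay_mass(2)[OF assms(2)] green_bound_nonneg[of \<zeta>] L(1)
    by (intro norm_abs_spinor_le green_L2_bound(1) assms(1-3)) auto
qed

lemma integrable_square_le:
  fixes h :: "real \<Rightarrow> complex" and f :: "real \<Rightarrow> complex^2"
  assumes f: "square_integrable f" and [measurable]: "h \<in> borel_measurable borel"
    and le: "\<And>x. cmod (h x) \<le> C * norm (f x)"
  shows "integrable lborel (\<lambda>x. (cmod (h x))\<^sup>2)"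
proof (rule Bochner_Integration.integrable_bound)
  show "integrable lborel (\<lambda>x. C\<^sup>2 * (norm (f x))\<^sup>2)"
    using f by (simp add: square_integrable_def)
  have "(cmod (h x))\<^sup>2 \<le> C\<^sup>2 * (norm (f x))\<^sup>2" for x
    using power_mono[OF le norm_ge_zero, of x 2] by (simp add: power_mult_distrib)
  then show "AE x in lborel. norm ((cmod (h x))\<^sup>2) \<le> norm (C\<^sup>2 * (norm (f x))\<^sup>2)"
    by (intro AE_I2) simp
qed simp

lemma green_nth:
  assumes "\<zeta> \<noteq> 0" "0 < Im k" "square_integrable f"
  shows "green k \<zeta> f x $ 1 = (LINT y|lborel. wave k (x - y) * (\<i> / 2 * \<zeta> * f y $ 1) + signed_wave k (x - y) * (\<i> / 2 * f y $ 2))"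
    and "green k \<zeta> f x $ 2 = (LINT y|lborel. wave k (x - y) * (\<i> / 2 / \<zeta> * f y $ 2) + signed_wave k (x - y) * (\<i> / 2 * f y $ 1))"
  unfolding green_def integral_vec_nth[OF integrable_green_kernel[OF assms]] green_kernel_nth
  by (auto intro!: Bochner_Integration.integral_cong simp: algebra_simps)

text \<open>\<open>k\<close> is the momentum at energy \<open>z\<close>, namely that square root of
  z^2 - m^2 for which the kernel decays.\<close>

locale dirac_resolvent =
  fixes m :: real and z k :: complex
  assumes k: "k\<^sup>2 = z\<^sup>2 - (of_real m)\<^sup>2" "0 < Im k"
begin

definition "\<zeta> = (z + of_real m) / k"

lemma factorization: "(z + of_real m) * (z - of_real m) = k * k"
  using k(1) by (simp add: power2_eq_square algebra_simps)

lemma k_nonzero: "k \<noteq> 0"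
  using k(2) by auto

lemma \<zeta>: "\<zeta> \<noteq> 0" "z + of_real m = k * \<zeta>" "z - of_real m = k / \<zeta>"
proof -
  have "z + of_real m \<noteq> 0"
    using factorization k_nonzero by auto
  with factorization k_nonzero show "\<zeta> \<noteq> 0" "z + of_real m = k * \<zeta>" "z - of_real m = k / \<zeta>"
    by (simp_all add: \<zeta>_def field_simps)
qed

text \<open>The derivative is what solving (H_0 - z) g = f for g' dictates. Both components of g
  have the shape treated in \<open>wave_convolution_ac\<close>.\<close>

lemma green_ac:
  assumes f: "square_integrable f"
  defines "g \<equiv> green k \<zeta> f"
  shows "ac_with_derivative g (\<lambda>x. vector [\<i> * (z + of_real m) * g x $ 2 + \<i> * f x $ 2,
    \<i> * (z - of_real m) * g x $ 1 + \<i> * f x $ 1])"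
proof -
  note [measurable] = square_integrable_borel[OF f]
  have c: "integrable lborel (\<lambda>x. (cmod (c * f x $ i))\<^sup>2)" for c i
    by (rule integrable_square_le[OF f, of _ "cmod c"])
      (auto simp: norm_mult intro!: mult_left_mono Finite_Cartesian_Product.norm_nth_le)
  note nth = green_nth[OF \<zeta>(1) k(2) f, folded g_def]
  \<comment> \<open>Exchanging the two waves turns the integrand of one component into a multiple of
    the integrand of the other; this closes the first-order system.\<close>
  have e1: "(LINT y|lborel. signed_wave k (x - y) * (\<i> / 2 * \<zeta> * f y $ 1) + wave k (x - y) * (\<i> / 2 * f y $ 2)) = \<zeta> * g x $ 2" for x
    unfolding nth(2) integral_mult_right_zero[symmetric] using \<zeta>(1)
    by (intro Bochner_Integration.integral_cong refl) (simp add: field_simps)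
  have e2: "(LINT y|lborel. signed_wave k (x - y) * (\<i> / 2 / \<zeta> * f y $ 2) + wave k (x - y) * (\<i> / 2 * f y $ 1)) = inverse \<zeta> * g x $ 1" for x
    unfolding nth(1) integral_mult_right_zero[symmetric] using \<zeta>(1)
    by (intro Bochner_Integration.integral_cong refl) (simp add: field_simps)
  have k\<zeta>: "\<i> * k * (\<zeta> * w) + 2 * (\<i> / 2 * w') = \<i> * (z + of_real m) * w + \<i> * w'"
    "\<i> * k * (inverse \<zeta> * w) + 2 * (\<i> / 2 * w') = \<i> * (z - of_real m) * w + \<i> * w'" for w w'
    unfolding \<zeta>(2,3) divide_inverse by (simp_all add: mult.assoc)
  have meas: "(\<lambda>y. c * f y $ i) \<in> borel_measurable borel" for c i
    by measurable
  show ?thesis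
    unfolding ac_with_derivative_iff_nth
  proof (intro allI impI)
    fix a b :: real and i :: 2
    assume ab: "a \<le> b"
    note 1 = wave_convolution_ac[OF k(2) ab meas meas c c, of "\<i> / 2 * \<zeta>" 1 "\<i> / 2" 2, unfolded e1 k\<zeta>, folded nth]
    note 2 = wave_convolution_ac[OF k(2) ab meas meas c c, of "\<i> / 2 / \<zeta>" 2 "\<i> / 2" 1, unfolded e2 k\<zeta>, folded nth]
    show "set_integrable lborel {a..b} (\<lambda>x. vector [\<i> * (z + of_real m) * g x $ 2 + \<i> * f x $ 2,
        \<i> * (z - of_real m) * g x $ 1 + \<i> * f x $ 1] $ i) \<and>
      g b $ i - g a $ i = (LINT x:{a..b}|lborel. vector [\<i> * (z + of_real m) * g x $ 2 + \<i> * f x $ 2,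
        \<i> * (z - of_real m) * g x $ 1 + \<i> * f x $ 1] $ i)"
      using exhaust_2[of i] 1 2 by auto
  qed
qed

end

section \<open>The free Dirac operator as a linear relation\<close>

lemma dirac_expression_nth:
  "((- \<i>) *s (sigma1 *v w') + c *s (sigma3 *v w)) $ 1 = - \<i> * w' $ 2 + c * w $ 1"
  "((- \<i>) *s (sigma1 *v w') + c *s (sigma3 *v w)) $ 2 = - \<i> * w' $ 1 - c * w $ 2"
  by (simp_all add: mat2_vec_nth sigma1_def sigma3_def)

lemma square_integrable_sigma:
  assumes "square_integrable f"
  shows "square_integrable (\<lambda>x. sigma1 *v f x)" "square_integrable (\<lambda>x. sigma3 *v f x)"
proof -
  note [measurable] = square_integrable_borel[OF assms]
  have "(norm (sigma1 *v w))\<^sup>2 = (norm w)\<^sup>2" "(norm (sigma3 *v w))\<^sup>2 = (norm w)\<^sup>2" for w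
    by (simp_all add: norm_vec2 mat2_vec_nth sigma1_def sigma3_def)
  with assms show "square_integrable (\<lambda>x. sigma1 *v f x)" "square_integrable (\<lambda>x. sigma3 *v f x)"
    by (simp_all add: square_integrable_def)
qed

lemma square_integrable_dirac_expression:
  assumes "square_integrable f" "square_integrable f'"
  shows "square_integrable (\<lambda>x. (- \<i>) *s (sigma1 *v f' x) + complex_of_real m *s (sigma3 *v f x))"
  by (intro square_integrable_add square_integrable_scale square_integrable_sigma assms)

lemma free_diracI:
  assumes "square_integrable f" "square_integrable f'" "ac_with_derivative f f'"
    and "F = abs_spinor f"
    and "G = abs_spinor (\<lambda>x. (- \<i>) *s (sigma1 *v f' x) + complex_of_real m *s (sigma3 *v f x))"
  shows "(F, G) \<in> free_dirac m"
  using assms by (auto simp: free_dirac_def)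

lemma linear_rel_free_dirac: "linear_rel (free_dirac m)"
  unfolding linear_rel_def
proof (intro conjI allI impI)
  let ?D = "\<lambda>f f' x. (- \<i>) *s (sigma1 *v f' x) + complex_of_real m *s (sigma3 *v f x)"
  have "0 = abs_spinor (\<lambda>x. 0)"
    by (simp add: zero_spinor_def)
  then show "(0, 0) \<in> free_dirac m"
    by (intro free_diracI[of "\<lambda>x. 0" "\<lambda>x. 0"])
      (simp_all add: square_integrable_0 ac_with_derivative_def set_integrable_def)
  fix F G F' G'
  assume "(F, G) \<in> free_dirac m \<and> (F', G') \<in> free_dirac m"
  then obtain f f' g g' where f: "square_integrable f" "square_integrable f'" "ac_with_derivative f f'"
      "F = abs_spinor f" "G = abs_spinor (?D f f')"
    and g: "square_integrable g" "square_integrable g'" "ac_with_derivative g g'"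
      "F' = abs_spinor g" "G' = abs_spinor (?D g g')"
    by (auto simp: free_dirac_def)
  show "(F + F', G + G') \<in> free_dirac m"
  proof (rule free_diracI)
    show "square_integrable (\<lambda>x. f x + g x)" "square_integrable (\<lambda>x. f' x + g' x)"
      using f g by (auto intro: square_integrable_add)
    show "ac_with_derivative (\<lambda>x. f x + g x) (\<lambda>x. f' x + g' x)"
      using f(3) g(3) unfolding ac_with_derivative_def
      by (auto simp: set_integral_add add_diff_add)
    show "F + F' = abs_spinor (\<lambda>x. f x + g x)"
      using f g by (simp add: abs_spinor_add)
    have "G + G' = abs_spinor (\<lambda>x. ?D f f' x + ?D g g' x)"
      unfolding f(5) g(5) by (intro abs_spinor_add square_integrable_dirac_expression f g)
    also have "(\<lambda>x. ?D f f' x + ?D g g' x) = ?D (\<lambda>x. f x + g x) (\<lambda>x. f' x + g' x)"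
      by (simp add: fun_eq_iff vec2_eq_iff mat2_vec_nth algebra_simps)
    finally show "G + G' = abs_spinor (?D (\<lambda>x. f x + g x) (\<lambda>x. f' x + g' x))" .
  qed
next
  let ?D = "\<lambda>f f' x. (- \<i>) *s (sigma1 *v f' x) + complex_of_real m *s (sigma3 *v f x)"
  fix c F G
  assume "(F, G) \<in> free_dirac m"
  then obtain f f' where f: "square_integrable f" "square_integrable f'" "ac_with_derivative f f'"
      "F = abs_spinor f" "G = abs_spinor (?D f f')"
    by (auto simp: free_dirac_def)
  show "(c *\<^sub>C F, c *\<^sub>C G) \<in> free_dirac m"
  proof (rule free_diracI)
    show "square_integrable (\<lambda>x. c *s f x)" "square_integrable (\<lambda>x. c *s f' x)"
      using f by (auto intro: square_integrable_scale)
    show "ac_with_derivative (\<lambda>x. c *s f x) (\<lambda>x. c *s f' x)"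
      using f(3) unfolding ac_with_derivative_iff_nth
      by (auto simp: right_diff_distrib[symmetric])
    show "c *\<^sub>C F = abs_spinor (\<lambda>x. c *s f x)"
      using f by (simp add: abs_spinor_scaleC)
    have "c *\<^sub>C G = abs_spinor (\<lambda>x. c *s ?D f f' x)"
      unfolding f(5) by (intro abs_spinor_scaleC square_integrable_dirac_expression f)
    also have "(\<lambda>x. c *s ?D f f' x) = ?D (\<lambda>x. c *s f x) (\<lambda>x. c *s f' x)"
      by (simp add: fun_eq_iff vec2_eq_iff mat2_vec_nth algebra_simps)
    finally show "c *\<^sub>C G = abs_spinor (?D (\<lambda>x. c *s f x) (\<lambda>x. c *s f' x))" .
  qed
qed

lemma (in dirac_resolvent) green_in_free_resolvent:
  assumes f: "square_integrable f"
  shows "(abs_spinor f, abs_spinor (green k \<zeta> f)) \<in> resolvent (free_dirac m) z"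
proof -
  define g where "g = green k \<zeta> f"
  define g' where "g' x = (vector [\<i> * (z + of_real m) * g x $ 2 + \<i> * f x $ 2,
    \<i> * (z - of_real m) * g x $ 1 + \<i> * f x $ 1] :: complex^2)" for x
  have g: "square_integrable g"
    unfolding g_def by (rule green_L2_bound(1)[OF \<zeta>(1) k(2) f])
  have ac: "ac_with_derivative g g'"
    using green_ac[OF f] unfolding g_def g'_def .
  have eq: "(- \<i>) *s (sigma1 *v g' x) + complex_of_real m *s (sigma3 *v g x) = f x + z *s g x" for x
    unfolding vec2_eq_iff dirac_expression_nth by (simp add: g'_def algebra_simps)
  \<comment> \<open>Solving the equation for g', as \<sigma>_1 squares to 1, exhibits g' as a
    combination of f and g and hence as square integrable.\<close>
  have g'_eq: "g' = (\<lambda>x. \<i> *s (sigma1 *v (f x + z *s g x)) + (- \<i> * of_real m) *s (sigma1 *v (sigma3 *v g x)))"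
    by (simp add: fun_eq_iff vec2_eq_iff mat2_vec_nth sigma1_def sigma3_def g'_def algebra_simps)
  have g': "square_integrable g'"
    unfolding g'_eq by (intro square_integrable_add square_integrable_scale square_integrable_sigma f g)
  have "(abs_spinor g, abs_spinor f + z *\<^sub>C abs_spinor g) \<in> free_dirac m"
    using f g by (intro free_diracI[OF g g' ac])
      (simp_all only: eq abs_spinor_scaleC abs_spinor_add square_integrable_scale)
  then show ?thesis
    unfolding mem_resolvent_iff by (simp only: g_def)
qed

section \<open>No square integrable solutions of the homogeneous equation\<close>

lemma exponential_ode:
  fixes h :: "real \<Rightarrow> complex"
  assumes int: "\<And>a b. a \<le> b \<Longrightarrow> set_integrable lborel {a..b} (\<lambda>x. c * h x)"
    and eq: "\<And>a b. a \<le> b \<Longrightarrow> h b - h a = (LINT x:{a..b}|lborel. c * h x)"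
  shows "h x = h 0 * exp (c * of_real x)"
proof -
  \<comment> \<open>Bootstrapping: the integral equation makes \<open>h\<close> continuous, and then
    its right side is differentiable. The interval is chosen with \<open>x\<close> in its interior,
    so the derivative is two-sided.\<close>
  have deriv: "(h has_vector_derivative c * h x) (at x)" for x
  proof -
    define R where "R = \<bar>x\<bar> + 1"
    have hk: "(\<lambda>x. c * h x) integrable_on {-R..R}"
      by (rule set_borel_integral_eq_integral(1)) (simp add: int R_def)
    have h_eq: "h y = h (- R) + integral {-R..y} (\<lambda>x. c * h x)" if "y \<in> {-R..R}" for y
      using eq[of "- R" y] set_borel_integral_eq_integral(2)[OF int[of "- R" y]] that
      by (simp add: algebra_simps)
    have "continuous_on {-R..R} (\<lambda>y. h (- R) + integral {-R..y} (\<lambda>x. c * h x))"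
      by (intro continuous_intros indefinite_integral_continuous_1 hk)
    then have "continuous_on {-R..R} h"
      by (rule continuous_on_eq) (rule h_eq[symmetric])
    then have "((\<lambda>y. integral {-R..y} (\<lambda>x. c * h x)) has_vector_derivative c * h x) (at x within {-R..R})"
      by (intro integral_has_vector_derivative continuous_intros) (auto simp: R_def)
    then have "((\<lambda>y. h (- R) + integral {-R..y} (\<lambda>x. c * h x)) has_vector_derivative 0 + c * h x) (at x within {-R..R})"
      by (intro has_vector_derivative_add has_vector_derivative_const)
    then have "((\<lambda>y. h (- R) + integral {-R..y} (\<lambda>x. c * h x)) has_vector_derivative c * h x) (at x)"
      by (subst (asm) at_within_interior) (auto simp: R_def)
    then show ?thesis
    proof (rule has_vector_derivative_transform_within_open)
      show "h (- R) + integral {-R..y} (\<lambda>x. c * h x) = h y" if "y \<in> {-R<..<R}" for y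
        using that by (intro h_eq[symmetric]) auto
    qed (auto simp: R_def)
  qed
  have e: "((\<lambda>x. exp (- c * of_real x)) has_vector_derivative - c * exp (- c * of_real x)) (at x)" for x
    by (rule has_vector_derivative_real_field[where f = "\<lambda>w. exp (- c * w)"]) (auto intro!: derivative_eq_intros)
  have "((\<lambda>x. h x * exp (- c * of_real x)) has_vector_derivative 0) (at x within UNIV)" for x
    using has_vector_derivative_mult[OF deriv e, of x] by (simp add: algebra_simps)
  then obtain d where "\<And>x. h x * exp (- c * of_real x) = d"
    using has_vector_derivative_zero_constant[of UNIV "\<lambda>x. h x * exp (- c * of_real x)"] by auto
  then have "h x * exp (- c * of_real x) = h 0 * exp (- c * of_real 0)"
    by metis
  then have "h x * exp (- (c * of_real x)) * exp (c * of_real x) = h 0 * exp (c * of_real x)"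
    by simp
  then show ?thesis
    by (simp add: mult.assoc flip: exp_add)
qed

lemma square_integrable_exponential_zero:
  fixes h :: "real \<Rightarrow> complex"
  assumes h: "\<And>x. h x = h 0 * exp (c * of_real x)" and int: "integrable lborel (\<lambda>x. (cmod (h x))\<^sup>2)"
  shows "h 0 = 0"
proof (rule ccontr)
  assume h0: "h 0 \<noteq> 0"
  define I where "I = (LINT x|lborel. (cmod (h x))\<^sup>2)"
  have norm: "(cmod (h x))\<^sup>2 = (cmod (h 0))\<^sup>2 * exp (2 * (Re c * x))" for x
    by (subst h) (simp add: norm_mult power_mult_distrib norm_exp_eq_Re power2_eq_square flip: exp_add)
  have bound: "(cmod (h 0))\<^sup>2 * n \<le> I" if n: "0 \<le> n" for n
  proof -
    \<comment> \<open>On the half line where \<open>Re c * x\<close> is nonnegative the modulus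
      never falls below |h 0|, so an interval of length \<open>n\<close> contributes at least n |h
      0|^2.\<close>
    define S where "S = (if 0 \<le> Re c then {0..n} else {-n..0})"
    have S: "S \<in> sets lborel" "measure lborel S = n" "emeasure lborel S < \<infinity>"
      using n by (auto simp: S_def emeasure_lborel_Icc_eq)
    have "(LINT x|lborel. (cmod (h 0))\<^sup>2 * indicator S x) \<le> I"
      unfolding I_def
    proof (rule integral_mono[OF _ int])
      show "integrable lborel (\<lambda>x. (cmod (h 0))\<^sup>2 * indicator S x)"
        using S by (intro integrable_mult_right integrable_real_indicator) auto
      fix x
      show "(cmod (h 0))\<^sup>2 * indicator S x \<le> (cmod (h x))\<^sup>2"
      proof (cases "x \<in> S")
        case True
        then have "0 \<le> Re c * x"
          by (auto simp: S_def mult_nonpos_nonpos split: if_splits)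
        with True show ?thesis
          unfolding norm[of x] by (intro mult_left_mono) auto
      qed simp
    qed
    with S show ?thesis by simp
  qed
  have pos: "0 < (cmod (h 0))\<^sup>2" using h0 by simp
  have "0 \<le> I" unfolding I_def by simp
  with bound[of "(I + 1) / (cmod (h 0))\<^sup>2"] pos show False
    by simp
qed

context dirac_resolvent
begin

abbreviation "R0 \<equiv> resolvent (free_dirac m) z"

text \<open>The combinations g_1 + s \<zeta> g_2 with s = 1 and s = -1 diagonalize the homogeneous
  system. Each solves h' = s \<i> k h, so it is an exponential, and a square integrable exponential
  on the line vanishes.\<close>

lemma free_resolvent_zero:
  assumes U: "(0, U) \<in> R0"
  shows "U = 0"
proof -
  from U have "(U, z *\<^sub>C U) \<in> free_dirac m"
    by (simp add: mem_resolvent_iff)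
  then obtain g g' where g: "square_integrable g" "square_integrable g'" "ac_with_derivative g g'" "U = abs_spinor g"
    and zU: "z *\<^sub>C U = abs_spinor (\<lambda>x. (- \<i>) *s (sigma1 *v g' x) + complex_of_real m *s (sigma3 *v g x))"
    by (auto simp: free_dirac_def)
  have "AE x in lborel. z *s g x = (- \<i>) *s (sigma1 *v g' x) + complex_of_real m *s (sigma3 *v g x)"
    using zU unfolding g(4) abs_spinor_scaleC[OF g(1)]
    by (rule abs_spinor_eq_iff[THEN iffD1, rotated 2])
      (intro square_integrable_scale square_integrable_dirac_expression g)+
  then have AE: "AE x in lborel. g' x $ 1 = \<i> * (z + of_real m) * g x $ 2 \<and> g' x $ 2 = \<i> * (z - of_real m) * g x $ 1"
  proof eventually_elim
    case (elim x)
    then have "z * g x $ 1 = - \<i> * g' x $ 2 + of_real m * g x $ 1" "z * g x $ 2 = - \<i> * g' x $ 1 - of_real m * g x $ 2"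
      unfolding vec2_eq_iff dirac_expression_nth by simp_all
    then have "\<i> * (z * g x $ 1) = \<i> * (- \<i> * g' x $ 2 + of_real m * g x $ 1)" "\<i> * (z * g x $ 2) = \<i> * (- \<i> * g' x $ 1 - of_real m * g x $ 2)"
      by simp_all
    then show ?case
      by (simp add: algebra_simps)
  qed
  note [measurable] = square_integrable_borel[OF g(1)]
  have zero: "g x $ 1 + s * (\<zeta> * g x $ 2) = 0" if s: "s * s = 1" for s x
  proof -
    define h where "h x = g x $ 1 + s * (\<zeta> * g x $ 2)" for x
    have ae: "AE x in lborel. g' x $ 1 + s * (\<zeta> * g' x $ 2) = s * \<i> * k * h x"
      using AE
    proof eventually_elim
      case (elim x)
      have "g' x $ 1 + s * (\<zeta> * g' x $ 2) = \<i> * k * \<zeta> * g x $ 2 + s * \<i> * k * g x $ 1"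
        using elim \<zeta> by simp
      also have "\<dots> = s * \<i> * k * h x"
        using s by (simp add: h_def algebra_simps) 
      finally show ?case .
    qed
    have "set_integrable lborel {a..b} (\<lambda>x. s * \<i> * k * h x) \<and>
        h b - h a = (LINT x:{a..b}|lborel. s * \<i> * k * h x)" if ab: "a \<le> b" for a b
    proof -
      have i1: "set_integrable lborel {a..b} (\<lambda>x. g' x $ 1)" "set_integrable lborel {a..b} (\<lambda>x. s * (\<zeta> * g' x $ 2))"
        and e1: "g b $ 1 - g a $ 1 = (LINT x:{a..b}|lborel. g' x $ 1)" "g b $ 2 - g a $ 2 = (LINT x:{a..b}|lborel. g' x $ 2)"
        using g(3) ab unfolding ac_with_derivative_iff_nth by auto
      have hm: "(\<lambda>x. s * \<i> * k * h x) \<in> borel_measurable lborel"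
        unfolding h_def by measurable
      note i = set_integral_add[OF i1]
      have gm: "(\<lambda>x. indicator {a..b} x *\<^sub>R (g' x $ 1 + s * (\<zeta> * g' x $ 2))) \<in> borel_measurable lborel"
        using i(1) unfolding set_integrable_def by (rule borel_measurable_integrable)
      have hm': "(\<lambda>x. indicator {a..b} x *\<^sub>R (s * \<i> * k * h x)) \<in> borel_measurable lborel"
        using hm by simp
      have ae': "AE x in lborel. indicator {a..b} x *\<^sub>R (g' x $ 1 + s * (\<zeta> * g' x $ 2)) =
          indicator {a..b} x *\<^sub>R (s * \<i> * k * h x)"
        using ae by eventually_elim simp
      have "h b - h a = (g b $ 1 - g a $ 1) + s * (\<zeta> * (g b $ 2 - g a $ 2))"
        by (simp add: h_def algebra_simps)
      also have "\<dots> = (LINT x:{a..b}|lborel. g' x $ 1 + s * (\<zeta> * g' x $ 2))"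
        unfolding i(2) e1 by simp
      also have "\<dots> = (LINT x:{a..b}|lborel. s * \<i> * k * h x)"
        unfolding set_lebesgue_integral_def by (rule integral_cong_AE[OF gm hm' ae'])
      finally have "h b - h a = (LINT x:{a..b}|lborel. s * \<i> * k * h x)" .
      moreover have "set_integrable lborel {a..b} (\<lambda>x. s * \<i> * k * h x)"
        using i(1) integrable_cong_AE[OF gm hm' ae'] unfolding set_integrable_def by blast
      ultimately show ?thesis by blast
    qed
    then have ode: "h x = h 0 * exp (s * \<i> * k * of_real x)" for x
      by (intro exponential_ode) auto
    have "integrable lborel (\<lambda>x. (cmod (h x))\<^sup>2)"
    proof (rule integrable_square_le[OF g(1), of _ "1 + cmod s * cmod \<zeta>"])
      show "cmod (h x) \<le> (1 + cmod s * cmod \<zeta>) * norm (g x)" for x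
        unfolding h_def distrib_right
        by (rule order.trans[OF norm_triangle_ineq])
          (auto simp: norm_mult mult.assoc intro!: add_mono mult_left_mono Finite_Cartesian_Product.norm_nth_le)
    qed (simp add: h_def)
    with ode have "h 0 = 0"
      by (rule square_integrable_exponential_zero)
    with ode[of x] show ?thesis
      by (simp only: mult_zero_left h_def)
  qed
  have "g x = 0" for x
    using zero[of 1 x] zero[of "-1" x] \<zeta>(1) by (simp add: vec2_eq_iff)
  then have "g = (\<lambda>x. 0)" by (simp add: fun_eq_iff)
  then show ?thesis
    by (simp add: g(4) zero_spinor_def)
qed

lemma free_resolvent_iff:
  assumes f: "square_integrable f"
  shows "(abs_spinor f, G) \<in> R0 \<longleftrightarrow> G = abs_spinor (green k \<zeta> f)"
proof
  assume "(abs_spinor f, G) \<in> R0"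
  from linear_rel_diff[OF linear_rel_resolvent[OF linear_rel_free_dirac] this green_in_free_resolvent[OF f]]
  have "G - abs_spinor (green k \<zeta> f) = 0"
    by (intro free_resolvent_zero) simp
  then show "G = abs_spinor (green k \<zeta> f)"
    by simp
qed (use green_in_free_resolvent[OF f] in simp)

lemma free_resolvent_set: "z \<in> resolvent_set (free_dirac m)"
proof (rule resolvent_setI[OF linear_rel_free_dirac])
  show "bounded_rel (green_bound \<zeta> * decay_mass k) (R0)"
    unfolding bounded_rel_def
  proof safe
    fix F G assume FG: "(F, G) \<in> R0"
    obtain f where f: "square_integrable f" "F = abs_spinor f"
      by (rule spinor_cases)
    with FG show "norm G \<le> green_bound \<zeta> * decay_mass k * norm F"
      using green_L2_bound(2)[OF \<zeta>(1) k(2) f(1)] by (simp add: free_resolvent_iff)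
  qed
  have "\<exists>G. (F, G) \<in> R0" for F
  proof -
    obtain f where "square_integrable f" "F = abs_spinor f"
      by (rule spinor_cases)
    then show ?thesis
      using green_in_free_resolvent by blast
  qed
  then show "Domain (R0) = UNIV" by blast
qed

end

section \<open>The Birman-Schwinger operator\<close>

lemma ennreal_power2_le_imp_le:
  assumes "x\<^sup>2 \<le> (ennreal c)\<^sup>2" "0 \<le> c"
  shows "x \<le> ennreal c"
proof (cases x)
  case (real r)
  with assms have "r\<^sup>2 \<le> c\<^sup>2"
    by (simp add: ennreal_power)
  with real assms(2) show ?thesis
    by (auto intro: ennreal_leI power2_le_imp_le)
next
  case top
  with assms show ?thesis
    by (simp add: ennreal_power power2_eq_square[of top] ennreal_mult_top top_unique)
qed

lemma square_integrable_cong_AE: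
  assumes "square_integrable g" "h \<in> borel_measurable borel" "AE x in lborel. g x = h x"
  shows "square_integrable h" "abs_spinor g = abs_spinor h"
proof -
  have g: "g \<in> borel_measurable borel" "integrable lborel (\<lambda>x. (norm (g x))\<^sup>2)"
    using assms(1) by (simp_all add: square_integrable_def)
  note [measurable] = g(1) assms(2)
  have "AE x in lborel. (norm (g x))\<^sup>2 = (norm (h x))\<^sup>2"
    using assms(3) by eventually_elim simp
  then have "integrable lborel (\<lambda>x. (norm (h x))\<^sup>2)"
    using g(2) by (subst (asm) integrable_cong_AE) auto
  then show h: "square_integrable h"
    using assms(2) by (simp add: square_integrable_def)
  show "abs_spinor g = abs_spinor h"
    using assms(3) by (simp add: abs_spinor_eq_iff assms(1) h)
qed

text \<open>\<open>mult_op\<close> quantifies over representatives; changing \<open>f\<close> on a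
  null set changes the product only on a null set, so one may be fixed.\<close>

lemma mult_op_iff:
  assumes a: "a \<in> borel_measurable borel" and f: "square_integrable f"
  shows "(abs_spinor f, G) \<in> mult_op a \<longleftrightarrow>
    square_integrable (\<lambda>x. a x *v f x) \<and> G = abs_spinor (\<lambda>x. a x *v f x)"
proof
  assume "(abs_spinor f, G) \<in> mult_op a"
  then obtain f1 g1 where f1: "square_integrable f1" "abs_spinor f = abs_spinor f1"
    and g1: "square_integrable g1" "G = abs_spinor g1" and ae: "AE x in lborel. g1 x = a x *v f1 x"
    by (auto simp: mult_op_def)
  have "AE x in lborel. f x = f1 x"
    using f1 f abs_spinor_eq_iff by blast
  with ae have "AE x in lborel. g1 x = a x *v f x"
    by eventually_elim simp
  moreover have "(\<lambda>x. a x *v f x) \<in> borel_measurable borel"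
    using a square_integrable_borel[OF f] by measurable
  ultimately show "square_integrable (\<lambda>x. a x *v f x) \<and> G = abs_spinor (\<lambda>x. a x *v f x)"
    using square_integrable_cong_AE[OF g1(1)] g1(2) by blast
next
  assume "square_integrable (\<lambda>x. a x *v f x) \<and> G = abs_spinor (\<lambda>x. a x *v f x)"
  with f show "(abs_spinor f, G) \<in> mult_op a"
    unfolding mult_op_def by blast
qed

lemma linear_rel_mult_op:
  assumes a: "a \<in> borel_measurable borel"
  shows "linear_rel (mult_op a)"
  unfolding linear_rel_def
proof (intro conjI allI impI)
  have "(abs_spinor (\<lambda>x. 0), abs_spinor (\<lambda>x. 0)) \<in> mult_op a"
    by (simp add: mult_op_iff[OF a square_integrable_0] square_integrable_0)
  then show "(0, 0) \<in> mult_op a"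
    by (simp add: zero_spinor_def)
next
  fix F G F' G' assume FG: "(F, G) \<in> mult_op a \<and> (F', G') \<in> mult_op a"
  obtain f where f: "square_integrable f" "F = abs_spinor f" by (rule spinor_cases)
  obtain f' where f': "square_integrable f'" "F' = abs_spinor f'" by (rule spinor_cases)
  have "(\<lambda>x. a x *v (f x + f' x)) = (\<lambda>x. a x *v f x + a x *v f' x)"
    by (simp add: matrix_vector_right_distrib)
  with FG f f' show "(F + F', G + G') \<in> mult_op a"
    by (auto simp: mult_op_iff[OF a] abs_spinor_add square_integrable_add)
next
  fix c F G assume FG: "(F, G) \<in> mult_op a"
  obtain f where f: "square_integrable f" "F = abs_spinor f" by (rule spinor_cases)
  have "(\<lambda>x. a x *v (c *s f x)) = (\<lambda>x. c *s (a x *v f x))"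
    by (simp add: vector_smult_mat)
  with FG f show "(c *\<^sub>C F, c *\<^sub>C G) \<in> mult_op a"
    by (auto simp: mult_op_iff[OF a] abs_spinor_scaleC square_integrable_scale)
qed

text \<open>What A and B have in common: with \<open>W\<close> the operator norm of V(x), each is
  pointwise bounded by the square root of \<open>W\<close>.\<close>

locale half_potential =
  fixes a :: "real \<Rightarrow> complex^2^2" and W :: "real \<Rightarrow> real"
  assumes a [measurable]: "a \<in> borel_measurable borel"
    and W_int: "integrable lborel W" and W_nonneg: "\<And>x. 0 \<le> W x"
    and bound: "\<And>x w. (norm (a x *v w))\<^sup>2 \<le> W x * (norm w)\<^sup>2"
begin

lemma W_meas [measurable]: "W \<in> borel_measurable borel"
  using borel_measurable_integrable[OF W_int] by simp

lemma nn_integral_W: "(\<integral>\<^sup>+x. ennreal (W x) \<partial>lborel) = ennreal (LINT x|lborel. W x)"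
  using W_int W_nonneg by (simp add: nn_integral_eq_integral)

text \<open>By Cauchy-Schwarz, the square root of an integrable weight maps L^2 into L^1. The next
  lemma is the dual property, from bounded functions to L^2, with the same constant.\<close>

lemma L1_bound:
  assumes f: "square_integrable f"
  shows "(\<integral>\<^sup>+x. ennreal (norm (a x *v f x)) \<partial>lborel) \<le> ennreal (sqrt (LINT x|lborel. W x) * norm (abs_spinor f))"
proof -
  note [measurable] = square_integrable_borel[OF f]
  let ?I = "\<integral>\<^sup>+x. ennreal (norm (a x *v f x)) \<partial>lborel"
  have "norm (a x *v f x) \<le> sqrt (W x) * norm (f x)" for x
    by (rule power2_le_imp_le) (use bound W_nonneg in \<open>auto simp: power_mult_distrib\<close>)
  then have "?I \<le> (\<integral>\<^sup>+x. ennreal (sqrt (W x)) * ennreal (norm (f x)) \<partial>lborel)"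
    using W_nonneg by (intro nn_integral_mono) (simp add: ennreal_mult[symmetric])
  then have "?I\<^sup>2 \<le> (\<integral>\<^sup>+x. ennreal (sqrt (W x)) * ennreal (norm (f x)) \<partial>lborel)\<^sup>2"
    by (intro power_mono) auto
  also have "\<dots> \<le> (\<integral>\<^sup>+x. (ennreal (sqrt (W x)))\<^sup>2 \<partial>lborel) * (\<integral>\<^sup>+x. (ennreal (norm (f x)))\<^sup>2 \<partial>lborel)"
    by (rule Cauchy_Schwarz_nn_integral) measurable
  also have "\<dots> = ennreal (LINT x|lborel. W x) * ennreal ((norm (abs_spinor f))\<^sup>2)"
    using W_nonneg by (simp add: ennreal_power nn_integral_W square_integrable_nn_integral[OF f])
  also have "\<dots> = (ennreal (sqrt (LINT x|lborel. W x) * norm (abs_spinor f)))\<^sup>2"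
    using W_nonneg by (simp add: ennreal_power ennreal_mult[symmetric] power_mult_distrib)
  finally show ?thesis
    by (rule ennreal_power2_le_imp_le) (use W_nonneg in simp)
qed

lemma L2_bound_of_bounded:
  assumes [measurable]: "f \<in> borel_measurable borel" and K: "0 \<le> K" "\<And>x. norm (f x) \<le> K"
  shows "square_integrable (\<lambda>x. a x *v f x)"
    and "norm (abs_spinor (\<lambda>x. a x *v f x)) \<le> sqrt (LINT x|lborel. W x) * K"
proof -
  have I: "0 \<le> (LINT x|lborel. W x)" using W_nonneg by simp
  have "(\<integral>\<^sup>+x. ennreal ((norm (a x *v f x))\<^sup>2) \<partial>lborel) \<le> (\<integral>\<^sup>+x. ennreal (W x) * ennreal (K\<^sup>2) \<partial>lborel)"
  proof (rule nn_integral_mono)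
    fix x
    have "(norm (a x *v f x))\<^sup>2 \<le> W x * K\<^sup>2"
      by (rule order.trans[OF bound]) (intro mult_left_mono power_mono K W_nonneg norm_ge_zero)
    then show "ennreal ((norm (a x *v f x))\<^sup>2) \<le> ennreal (W x) * ennreal (K\<^sup>2)"
      using W_nonneg by (simp add: ennreal_mult[symmetric])
  qed
  also have "\<dots> = ennreal ((sqrt (LINT x|lborel. W x) * K)\<^sup>2)"
    using I K(1) by (simp add: nn_integral_multc nn_integral_W ennreal_mult[symmetric] power_mult_distrib)
  finally have le: "(\<integral>\<^sup>+x. ennreal ((norm (a x *v f x))\<^sup>2) \<partial>lborel) \<le> ennreal ((sqrt (LINT x|lborel. W x) * K)\<^sup>2)" .
  show si: "square_integrable (\<lambda>x. a x *v f x)"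
    by (rule square_integrableI) (use le in \<open>auto simp: le_less_trans\<close>)
  show "norm (abs_spinor (\<lambda>x. a x *v f x)) \<le> sqrt (LINT x|lborel. W x) * K"
    using I K(1) by (intro norm_abs_spinor_le si le) auto
qed

text \<open>Cut \<open>f\<close> off to the set where W \<le> n: there multiplication by
  \<open>a\<close> is bounded, and dominated convergence recovers \<open>f\<close>.\<close>

lemma dense_Domain: "closure (Domain (mult_op a)) = UNIV"
proof -
  have "F \<in> closure (Domain (mult_op a))" for F
  proof -
    obtain f where f: "square_integrable f" "F = abs_spinor f" by (rule spinor_cases)
    note [measurable] = square_integrable_borel[OF f(1)]
    define S where "S n = {x. W x \<le> real n}" for n :: nat
    have S [measurable]: "S n \<in> sets borel" for n
      unfolding S_def by measurable
    define g where "g n x = indicator (S n) x *\<^sub>R f x" for n x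
    have g_meas [measurable]: "g n \<in> borel_measurable borel" for n
      unfolding g_def by measurable
    have f2: "integrable lborel (\<lambda>x. (norm (f x))\<^sup>2)"
      using f(1) by (simp add: square_integrable_def)
    have g: "square_integrable (g n)" for n
      unfolding square_integrable_def
      by (intro conjI Bochner_Integration.integrable_bound[OF f2]) (auto simp: g_def indicator_def)
    have "square_integrable (\<lambda>x. a x *v g n x)" for n
    proof -
      have "integrable lborel (\<lambda>x. real n * (norm (f x))\<^sup>2)"
        using f2 by simp
      moreover have "(norm (a x *v g n x))\<^sup>2 \<le> real n * (norm (f x))\<^sup>2" for x
      proof (cases "x \<in> S n")
        case True
        then have "W x * (norm (f x))\<^sup>2 \<le> real n * (norm (f x))\<^sup>2"
          by (intro mult_right_mono) (auto simp: S_def)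
        with True show ?thesis
          using bound[of x "f x"] by (simp add: g_def)
      qed (simp add: g_def)
      ultimately have "integrable lborel (\<lambda>x. (norm (a x *v g n x))\<^sup>2)"
        by (elim Bochner_Integration.integrable_bound) (auto intro!: AE_I2)
      then show ?thesis
        by (simp add: square_integrable_def)
    qed
    then have dom: "abs_spinor (g n) \<in> Domain (mult_op a)" for n
      using mult_op_iff[OF a g[of n]] by blast
    have "(\<lambda>n. LINT x|lborel. (norm (g n x - f x))\<^sup>2) \<longlonglongrightarrow> (LINT x::real|lborel. 0)"
    proof (rule integral_dominated_convergence[OF _ _ f2])
      show "AE x in lborel. norm ((norm (g n x - f x))\<^sup>2) \<le> (norm (f x))\<^sup>2" for n
        by (intro AE_I2) (auto simp: g_def indicator_def)
      have "(\<lambda>n. (norm (g n x - f x))\<^sup>2) \<longlonglongrightarrow> 0" for x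
      proof (rule tendsto_eventually)
        show "eventually (\<lambda>n. (norm (g n x - f x))\<^sup>2 = 0) sequentially"
          using eventually_ge_at_top[of "nat \<lceil>W x\<rceil>"]
          by eventually_elim (auto simp: g_def S_def indicator_def)
      qed
      then show "AE x in lborel. (\<lambda>n. (norm (g n x - f x))\<^sup>2) \<longlonglongrightarrow> 0" by simp
    qed measurable
    then have "(\<lambda>n. (norm (abs_spinor (g n) - F))\<^sup>2) \<longlonglongrightarrow> 0"
      by (simp add: f abs_spinor_diff g norm_abs_spinor_power2 square_integrable_diff)
    then have "(\<lambda>n. sqrt ((norm (abs_spinor (g n) - F))\<^sup>2)) \<longlonglongrightarrow> sqrt 0"
      by (rule tendsto_real_sqrt)
    then have "(\<lambda>n. norm (abs_spinor (g n) - F)) \<longlonglongrightarrow> 0"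
      by simp
    then have "(\<lambda>n. abs_spinor (g n)) \<longlonglongrightarrow> F"
      by (rule LIM_zero_cancel[OF tendsto_norm_zero_cancel])
    with dom show ?thesis
      unfolding closure_sequential by (intro exI[of _ "\<lambda>n. abs_spinor (g n)"]) simp
  qed
  then show ?thesis by blast
qed

end

lemma half_potentials:
  assumes V: "\<And>i j. integrable lborel (\<lambda>x. V x $ i $ j)"
  defines "W \<equiv> \<lambda>x. onorm (\<lambda>v. V x *v v)"
  shows "half_potential (\<lambda>x. mat_sqrt (mat_abs (V x))) W"
    and "half_potential (\<lambda>x. mat_phase (V x) ** mat_sqrt (mat_abs (V x))) W"
proof -
  have [measurable]: "V \<in> borel_measurable borel" and W: "integrable lborel W"
    using integrable_onorm_mat2[OF V] by (simp_all add: W_def)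
  have nonneg: "0 \<le> W x" and le: "norm (V x *v w) \<le> W x * norm w" for x w
    unfolding W_def by (auto intro: onorm_pos_le onorm bounded_linear_mat2)
  show "half_potential (\<lambda>x. mat_sqrt (mat_abs (V x))) W"
    using W nonneg norm_sqrt_mat_abs[OF le] by unfold_locales simp_all
  show "half_potential (\<lambda>x. mat_phase (V x) ** mat_sqrt (mat_abs (V x))) W"
    using W nonneg norm_phase_sqrt_mat_abs[OF le] by unfold_locales simp_all
qed

locale dirac_potential = dirac_resolvent +
  fixes V :: "real \<Rightarrow> complex^2^2"
  assumes V: "\<And>i j. integrable lborel (\<lambda>x. V x $ i $ j)"
begin

definition "W x = onorm (\<lambda>v. V x *v v)"

abbreviation "A x \<equiv> mat_sqrt (mat_abs (V x))"

abbreviation "B x \<equiv> mat_phase (V x) ** mat_sqrt (mat_abs (V x))"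

sublocale A: half_potential "\<lambda>x. mat_sqrt (mat_abs (V x))" W
  using half_potentials(1)[OF V] by (simp add: W_def[abs_def])

sublocale B: half_potential "\<lambda>x. mat_phase (V x) ** mat_sqrt (mat_abs (V x))" W
  using half_potentials(2)[OF V] by (simp add: W_def[abs_def])

lemma integral_W: "(LINT x|lborel. W x) = potential_norm V"
  by (simp add: potential_norm_def W_def)

lemma potential_norm_nonneg: "0 \<le> potential_norm V"
  unfolding integral_W[symmetric] using A.W_nonneg by simp

lemma linear_rels:
  "linear_rel (op_A V)" "linear_rel (op_B V)" "linear_rel (R0)"
  unfolding op_A_def op_B_def
  by (intro linear_rel_mult_op A.a B.a linear_rel_resolvent linear_rel_free_dirac)+

lemma A_green_bound:
  assumes f: "square_integrable f" and L: "0 \<le> L" "(\<integral>\<^sup>+x. ennreal (norm (f x)) \<partial>lborel) \<le> ennreal L"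
  shows "square_integrable (\<lambda>x. A x *v green k \<zeta> f x)"
    and "norm (abs_spinor (\<lambda>x. A x *v green k \<zeta> f x)) \<le>
      sqrt (potential_norm V) * (green_bound \<zeta> * L)"
proof -
  have "ennreal (norm (green k \<zeta> f x)) \<le> ennreal (green_bound \<zeta> * L)" for x
    using order.trans[OF green_sup_bound[OF \<zeta>(1) k(2) f] mult_left_mono[OF L(2)]] L(1)
    by (simp add: ennreal_mult green_bound_nonneg)
  then have le: "norm (green k \<zeta> f x) \<le> green_bound \<zeta> * L" for x
    using L(1) green_bound_nonneg[of \<zeta>] by (metis ennreal_le_iff mult_nonneg_nonneg)
  have meas: "green k \<zeta> f \<in> borel_measurable borel"
    by (intro borel_measurable_green square_integrable_borel f)
  show "square_integrable (\<lambda>x. A x *v green k \<zeta> f x)"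
    "norm (abs_spinor (\<lambda>x. A x *v green k \<zeta> f x)) \<le>
      sqrt (potential_norm V) * (green_bound \<zeta> * L)"
    using A.L2_bound_of_bounded[OF meas _ le] L(1) green_bound_nonneg[of \<zeta>] by (simp_all add: integral_W)
qed

abbreviation "ARB \<equiv> op_A V \<cdot>\<^sub>o R0 \<cdot>\<^sub>o op_B V"

text \<open>B maps L^2 to L^1, the free resolvent L^1 to bounded functions, and A these back to L^2.
  The two square roots of \<open>potential_norm V\<close> multiply to its first power.\<close>

lemma bounded_rel_ARB:
  "bounded_rel (green_bound \<zeta> * potential_norm V) ARB"
  unfolding bounded_rel_def
proof safe
  fix F U G Q
  assume F: "(F, U) \<in> op_B V" "(U, G) \<in> R0" "(G, Q) \<in> op_A V"
  obtain f where f: "square_integrable f" "F = abs_spinor f" by (rule spinor_cases)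
  define u where "u = (\<lambda>x. B x *v f x)"
  have u: "square_integrable u" "U = abs_spinor u"
    using F(1) unfolding f(2) op_B_def mult_op_iff[OF B.a f(1)] by (simp_all add: u_def)
  have G: "G = abs_spinor (green k \<zeta> u)"
    using F(2) unfolding u(2) free_resolvent_iff[OF u(1)] .
  have Q: "Q = abs_spinor (\<lambda>x. A x *v green k \<zeta> u x)"
    using F(3) unfolding G op_A_def mult_op_iff[OF A.a green_L2_bound(1)[OF \<zeta>(1) k(2) u(1)]] by simp
  have "norm Q \<le> sqrt (potential_norm V) * (green_bound \<zeta> * (sqrt (potential_norm V) * norm F))"
    unfolding Q using B.L1_bound[OF f(1)] potential_norm_nonneg
    by (intro A_green_bound(2)[OF u(1)]) (simp_all add: u_def integral_W f(2))
  also have "\<dots> = green_bound \<zeta> * potential_norm V * norm F"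
    using potential_norm_nonneg by (simp flip: mult.assoc)
  finally show "norm Q \<le> green_bound \<zeta> * potential_norm V * norm F" .
qed

text \<open>Nothing is lost after B: B f is integrable, its image under the free resolvent is
  bounded, and A takes bounded functions into L^2. Density is thus inherited from the domain of
  B.\<close>

lemma Domain_ARB: "Domain ARB = Domain (op_B V)"
proof
  show "Domain (op_B V) \<subseteq> Domain ARB"
  proof
    fix F assume "F \<in> Domain (op_B V)"
    then obtain U where FU: "(F, U) \<in> op_B V" by blast
    obtain f where f: "square_integrable f" "F = abs_spinor f" by (rule spinor_cases)
    define u where "u = (\<lambda>x. B x *v f x)"
    have u: "square_integrable u" "U = abs_spinor u"
      using FU unfolding f(2) op_B_def mult_op_iff[OF B.a f(1)] by (simp_all add: u_def)
    have "(U, abs_spinor (green k \<zeta> u)) \<in> R0"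
      unfolding u(2) free_resolvent_iff[OF u(1)] ..
    moreover have "square_integrable (\<lambda>x. A x *v green k \<zeta> u x)"
      using B.L1_bound[OF f(1)] potential_norm_nonneg
      by (intro A_green_bound(1)[OF u(1), of "sqrt (potential_norm V) * norm F"])
        (simp_all add: u_def integral_W f(2))
    then have "(abs_spinor (green k \<zeta> u), abs_spinor (\<lambda>x. A x *v green k \<zeta> u x)) \<in> op_A V"
      unfolding op_A_def by (subst mult_op_iff[OF A.a green_L2_bound(1)[OF \<zeta>(1) k(2) u(1)]]) simp
    ultimately show "F \<in> Domain ARB"
      using FU by blast
  qed
qed blast

lemma minus_one_in_resolvent_set_Q:
  assumes "green_bound \<zeta> * potential_norm V < 1"
  shows "- 1 \<in> resolvent_set (op_Q m V z)"
  unfolding op_Q_def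
proof (rule minus_one_in_resolvent_set)
  have lin: "linear_rel ARB"
    by (intro linear_rel_comp linear_rels)
  then show "linear_rel (closure ARB)"
    by (rule linear_rel_closure)
  show "bounded_rel (green_bound \<zeta> * potential_norm V) (closure ARB)"
    by (intro bounded_rel_closure bounded_rel_ARB)
  show "Domain (closure ARB) = UNIV"
  proof (rule Domain_closure_bounded_rel[OF lin bounded_rel_ARB])
    show "closure (Domain ARB) = UNIV"
      unfolding Domain_ARB unfolding op_B_def by (rule B.dense_Domain)
  qed
qed (use assms green_bound_nonneg potential_norm_nonneg in auto)

text \<open>The constant may grow as z approaches the real axis. This is harmless later, because the
  packet is translated only after z has been fixed.\<close>

lemma bounded_rel_RB: "\<exists>C\<ge>0. bounded_rel C (closure (R0 \<cdot>\<^sub>o op_B V))"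
proof (intro exI conjI bounded_rel_closure)
  show "0 \<le> green_bound \<zeta> * sqrt (decay_mass k) * sqrt (potential_norm V)"
    using green_bound_nonneg potential_norm_nonneg decay_mass(2)[OF k(2)] by simp
  show "bounded_rel (green_bound \<zeta> * sqrt (decay_mass k) * sqrt (potential_norm V)) (R0 \<cdot>\<^sub>o op_B V)"
    unfolding bounded_rel_def
  proof safe
    fix F U G
    assume F: "(F, U) \<in> op_B V" "(U, G) \<in> R0"
    obtain f where f: "square_integrable f" "F = abs_spinor f" by (rule spinor_cases)
    define u where "u = (\<lambda>x. B x *v f x)"
    have u: "square_integrable u" "U = abs_spinor u"
      using F(1) unfolding f(2) op_B_def mult_op_iff[OF B.a f(1)] by (simp_all add: u_def)
    have G: "G = abs_spinor (green k \<zeta> u)"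
      using F(2) unfolding u(2) free_resolvent_iff[OF u(1)] .
    have "norm G \<le> green_bound \<zeta> * sqrt (decay_mass k) * (sqrt (potential_norm V) * norm F)"
      unfolding G using B.L1_bound[OF f(1)] potential_norm_nonneg
      by (intro green_L1_L2_bound \<zeta>(1) k(2) u(1)) (simp_all add: u_def integral_W f(2))
    then show "norm G \<le> green_bound \<zeta> * sqrt (decay_mass k) * sqrt (potential_norm V) * norm F"
      by (simp add: mult.assoc)
  qed
qed

end

section \<open>Wave packets\<close>

text \<open>A Lorentzian of width 1/\<delta> centred at \<open>s\<close>. Its slope is at most
  \<delta> times its own height everywhere, so the error of a packet is measured directly against
  the packet.\<close>

definition profile :: "real \<Rightarrow> real \<Rightarrow> real \<Rightarrow> real" where
  "profile \<delta> s x = inverse (1 + (\<delta> * (x - s))\<^sup>2)"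

definition profile' :: "real \<Rightarrow> real \<Rightarrow> real \<Rightarrow> real" where
  "profile' \<delta> s x = - (2 * \<delta> * (\<delta> * (x - s))) * (profile \<delta> s x)\<^sup>2"

lemma one_plus_square_pos: "0 < 1 + (y::real)\<^sup>2"
  by (simp add: add_pos_nonneg)

lemma profile_bounds: "0 < profile \<delta> s x" "profile \<delta> s x \<le> 1"
  by (simp_all add: profile_def one_plus_square_pos inverse_le_1_iff)

lemma profile'_bound:
  assumes "0 < \<delta>"
  shows "\<bar>profile' \<delta> s x\<bar> \<le> \<delta> * profile \<delta> s x"
proof -
  define y where "y = \<delta> * (x - s)"
  have pos: "0 < 1 + y\<^sup>2" by (rule one_plus_square_pos)
  have "\<bar>2 * y\<bar> \<le> 1 + y\<^sup>2"
    using zero_le_power2[of "\<bar>y\<bar> - 1"] unfolding power2_diff by simp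
  then have "\<delta> * (\<bar>2 * y\<bar> * inverse (1 + y\<^sup>2) * inverse (1 + y\<^sup>2)) \<le> \<delta> * ((1 + y\<^sup>2) * inverse (1 + y\<^sup>2) * inverse (1 + y\<^sup>2))"
    using assms pos by (intro mult_left_mono mult_right_mono) auto
  also have "(1 + y\<^sup>2) * inverse (1 + y\<^sup>2) * inverse (1 + y\<^sup>2) = inverse (1 + y\<^sup>2)"
    using pos by simp
  finally show ?thesis
    using assms by (simp add: profile'_def profile_def y_def[symmetric] abs_mult power2_eq_square[of "inverse _"] mult_ac)
qed

lemma DERIV_profile: "DERIV (profile \<delta> s) x :> profile' \<delta> s x"
proof -
  have nz: "1 + (\<delta> * (x - s))\<^sup>2 \<noteq> 0"
    using one_plus_square_pos[of "\<delta> * (x - s)"] by simp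
  have "DERIV (\<lambda>x. inverse (1 + (\<delta> * (x - s))\<^sup>2)) x :>
      - (inverse (1 + (\<delta> * (x - s))\<^sup>2) * (2 * (\<delta> * (x - s)) * \<delta>) * inverse (1 + (\<delta> * (x - s))\<^sup>2))"
    using nz by (auto intro!: derivative_eq_intros)
  then show ?thesis
    by (simp add: profile_def[abs_def] profile'_def power2_eq_square[of "inverse _"] mult_ac)
qed

lemma borel_measurable_profile [measurable]:
  "profile \<delta> s \<in> borel_measurable borel" "profile' \<delta> s \<in> borel_measurable borel"
  unfolding profile_def[abs_def] profile'_def[abs_def] by measurable

lemma integrable_profile_square:
  assumes "0 < \<delta>"
  shows "integrable lborel (\<lambda>x. (profile \<delta> s x)\<^sup>2)"
proof -
  have "integrable lborel (\<lambda>x. inverse (1 + (- \<delta> * s + \<delta> * x)\<^sup>2))"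
    using assms by (intro lborel_integrable_real_affine[OF integrable_inverse_one_plus_square]) simp
  then have int: "integrable lborel (profile \<delta> s)"
    by (simp add: profile_def[abs_def] algebra_simps)
  have "(profile \<delta> s x)\<^sup>2 \<le> profile \<delta> s x" for x
    using profile_bounds[of \<delta> s x] by (simp add: power2_eq_square mult_left_le)
  then show ?thesis
    by (intro Bochner_Integration.integrable_bound[OF int]) (auto intro!: AE_I2 order.trans[OF _ abs_ge_self])
qed

lemma integral_profile_square:
  "(LINT x|lborel. (profile \<delta> s x)\<^sup>2) = (LINT x|lborel. (profile \<delta> 0 x)\<^sup>2)"
  using lborel_integral_real_affine[of 1 "\<lambda>x. (profile \<delta> s x)\<^sup>2" s] by (simp add: profile_def)

lemma integral_profile_square_pos:
  assumes "0 < \<delta>"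
  shows "0 < (LINT x|lborel. (profile \<delta> 0 x)\<^sup>2)"
proof (rule ccontr)
  assume "\<not> 0 < (LINT x|lborel. (profile \<delta> 0 x)\<^sup>2)"
  moreover have "0 \<le> (LINT x|lborel. (profile \<delta> 0 x)\<^sup>2)" by simp
  ultimately have "(LINT x|lborel. (profile \<delta> 0 x)\<^sup>2) = 0" by linarith
  then have "AE x in lborel. (profile \<delta> 0 x)\<^sup>2 = 0"
    by (subst (asm) integral_nonneg_eq_0_iff_AE[OF integrable_profile_square[OF assms]]) auto
  then have "AE x in (lborel :: real measure). False"
    by eventually_elim (use profile_bounds(1)[of \<delta> 0] in \<open>auto simp: less_le\<close>)
  then show False
    by (simp add: eventually_False ae_filter_eq_bot_iff)
qed

lemma square_integrable_le_profile:
  assumes [measurable]: "f \<in> borel_measurable borel" and "0 < \<delta>" and le: "\<And>x. norm (f x) \<le> C * profile \<delta> s x"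
  shows "square_integrable f"
proof -
  have "integrable lborel (\<lambda>x. C\<^sup>2 * (profile \<delta> s x)\<^sup>2)"
    by (intro integrable_mult_right integrable_profile_square assms)
  moreover have "(norm (f x))\<^sup>2 \<le> C\<^sup>2 * (profile \<delta> s x)\<^sup>2" for x
    using power_mono[OF le norm_ge_zero, of x 2] by (simp add: power_mult_distrib)
  ultimately have "integrable lborel (\<lambda>x. (norm (f x))\<^sup>2)"
    by (elim Bochner_Integration.integrable_bound) (auto intro!: AE_I2)
  then show ?thesis
    by (simp add: square_integrable_def)
qed

definition wave_packet :: "real \<Rightarrow> complex^2 \<Rightarrow> real \<Rightarrow> real \<Rightarrow> real \<Rightarrow> complex^2" where
  "wave_packet p w \<delta> s x = (of_real (profile \<delta> s x) * exp (\<i> * of_real (p * x))) *s w"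

lemma norm_wave_packet: "norm (wave_packet p w \<delta> s x) = profile \<delta> s x * norm w"
  using profile_bounds(1)[of \<delta> s x]
  by (simp add: wave_packet_def norm_vector_scalar_mult norm_mult)

lemma borel_measurable_wave_packet [measurable]: "wave_packet p w \<delta> s \<in> borel_measurable borel"
proof -
  have [measurable]: "(\<lambda>x. exp (\<i> * complex_of_real (p * x))) \<in> borel_measurable borel"
    by (intro borel_measurable_continuous_onI continuous_intros)
  show ?thesis
    by (rule borel_measurable_vecI) (simp add: wave_packet_def)
qed

lemma square_integrable_wave_packet: "0 < \<delta> \<Longrightarrow> square_integrable (wave_packet p w \<delta> s)"
  by (rule square_integrable_le_profile[of _ \<delta> "norm w" s]) (auto simp: norm_wave_packet)

text \<open>The value does not depend on the centre \<open>s\<close>: a packet can be moved away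
  without losing norm.\<close>

lemma norm_abs_wave_packet:
  assumes "0 < \<delta>"
  shows "norm (abs_spinor (wave_packet p w \<delta> s)) = norm w * sqrt (LINT x|lborel. (profile \<delta> 0 x)\<^sup>2)"
proof -
  have "(norm (abs_spinor (wave_packet p w \<delta> s)))\<^sup>2 = (norm w * sqrt (LINT x|lborel. (profile \<delta> 0 x)\<^sup>2))\<^sup>2"
    unfolding norm_abs_spinor_power2[OF square_integrable_wave_packet[OF assms]] norm_wave_packet power_mult_distrib
    by (simp add: integral_profile_square[of _ s] mult.commute)
  then show ?thesis
    by (simp add: power2_eq_iff_nonneg)
qed

text \<open>By \<open>w\<close>, the vector is an eigenvector of the symbol p \<sigma>_1 + m
  \<sigma>_3 for the eigenvalue l. The carrier wave is thus an exact generalized eigenfunction, and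
  the remainder comes only from the slope of the profile.\<close>

lemma wave_packet_approximate_eigenvector:
  fixes s :: real
  assumes \<delta>: "0 < \<delta>"
    and w: "of_real p * w$2 + of_real m * w$1 = of_real l * w$1" "of_real p * w$1 - of_real m * w$2 = of_real l * w$2"
  defines "g \<equiv> wave_packet p w \<delta> s"
  shows "\<exists>r. (abs_spinor g, of_real l *\<^sub>C abs_spinor g + r) \<in> free_dirac m \<and> norm r \<le> \<delta> * norm (abs_spinor g)"
proof -
  define e where "e x = exp (\<i> * complex_of_real (p * x))" for x
  have e_norm: "cmod (e x) = 1" for x by (simp add: e_def)
  have [measurable]: "e \<in> borel_measurable borel"
    unfolding e_def by (intro borel_measurable_continuous_onI continuous_intros)
  define g' where "g' x = (of_real (profile' \<delta> s x) * e x + of_real (profile \<delta> s x) * (\<i> * of_real p * e x)) *s w" for x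
  define \<rho> where "\<rho> x = (- \<i> * of_real (profile' \<delta> s x) * e x) *s (sigma1 *v w)" for x
  have g: "g x = (of_real (profile \<delta> s x) * e x) *s w" for x
    by (simp add: g_def wave_packet_def e_def)
  have g_si: "square_integrable g"
    unfolding g_def by (rule square_integrable_wave_packet[OF \<delta>])
  have [measurable]: "g' \<in> borel_measurable borel" "\<rho> \<in> borel_measurable borel"
    by (rule borel_measurable_vecI; simp add: g'_def \<rho>_def)+
  have d_bound: "cmod (of_real (profile' \<delta> s x) * e x + of_real (profile \<delta> s x) * (\<i> * of_real p * e x)) \<le> (\<delta> + \<bar>p\<bar>) * profile \<delta> s x" for x
    using profile'_bound[OF \<delta>, of s x] profile_bounds(1)[of \<delta> s x]
    by (intro order.trans[OF norm_triangle_ineq]) (simp add: norm_mult e_norm algebra_simps)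
  have g'_bound: "norm (g' x) \<le> ((\<delta> + \<bar>p\<bar>) * norm w) * profile \<delta> s x" for x
    using mult_right_mono[OF d_bound norm_ge_zero[of w], of x]
    unfolding g'_def norm_vector_scalar_mult by (simp only: mult_ac)
  have g'_si: "square_integrable g'"
    by (rule square_integrable_le_profile[OF _ \<delta> g'_bound]) measurable
  have norm_sigma1: "norm (sigma1 *v w) = norm w"
    by (rule power2_eq_iff_nonneg[THEN iffD1]) (simp_all add: norm_vec2 mat2_vec_nth sigma1_def)
  have \<rho>_bound: "norm (\<rho> x) \<le> \<delta> * norm (g x)" for x
    using mult_right_mono[OF profile'_bound[OF \<delta>, of s x] norm_ge_zero[of w]]
    by (simp add: \<rho>_def g_def norm_wave_packet norm_vector_scalar_mult norm_mult e_norm norm_sigma1 mult.assoc)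
  have \<rho>_si: "square_integrable \<rho>"
    by (rule square_integrable_le_profile[OF _ \<delta>, of _ "\<delta> * norm w" s])
      (use \<rho>_bound in \<open>auto simp: g_def norm_wave_packet mult_ac\<close>)
  have ac: "ac_with_derivative g g'"
    unfolding ac_with_derivative_iff_nth
  proof (intro allI impI conjI)
    fix a b :: real and i :: 2
    assume ab: "a \<le> b"
    have bd: "cmod (g' x $ i) \<le> ((\<delta> + \<bar>p\<bar>) * norm w)" for x
    proof -
      have "cmod (g' x $ i) \<le> ((\<delta> + \<bar>p\<bar>) * norm w) * profile \<delta> s x"
        using Finite_Cartesian_Product.norm_nth_le[of "g' x" i] g'_bound[of x] by simp
      also have "\<dots> \<le> ((\<delta> + \<bar>p\<bar>) * norm w) * 1"
        using \<delta> profile_bounds(2) by (intro mult_left_mono) auto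
      finally show ?thesis by simp
    qed
    show "set_integrable lborel {a..b} (\<lambda>x. g' x $ i)"
      by (rule set_integrable_bounded_Icc[of _ _ _ "(\<delta> + \<bar>p\<bar>) * norm w"]) (simp, rule bd)
    have der: "((\<lambda>x. g x $ i) has_vector_derivative g' x $ i) (at x)" for x
    proof -
      have 1: "((\<lambda>x. complex_of_real (profile \<delta> s x)) has_vector_derivative of_real (profile' \<delta> s x)) (at x)"
        using DERIV_profile[of \<delta> s x] has_vector_derivative_of_real
          has_real_derivative_iff_has_vector_derivative by blast
      have 2: "(e has_vector_derivative \<i> * of_real p * e x) (at x)"
        unfolding e_def of_real_mult
        by (rule has_vector_derivative_real_field[where f = "\<lambda>v. exp (\<i> * (of_real p * v))"])
          (auto intro!: derivative_eq_intros)
      have "((\<lambda>x. of_real (profile \<delta> s x) * e x * w $ i) has_vector_derivative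
          (of_real (profile \<delta> s x) * (\<i> * of_real p * e x) + of_real (profile' \<delta> s x) * e x) * w $ i) (at x)"
        by (rule has_vector_derivative_mult_left[OF has_vector_derivative_mult[OF 1 2]])
      then show ?thesis
        by (simp add: g g'_def add.commute distrib_right)
    qed
    show "g b $ i - g a $ i = (LINT x:{a..b}|lborel. g' x $ i)"
    proof (rule integral_eq_FTC_except[OF ab, of "{}", symmetric])
      show "continuous_on {a..b} (\<lambda>x. g x $ i)"
        by (intro continuous_at_imp_continuous_on ballI has_vector_derivative_continuous[OF der])
    qed (use der bd in auto)
  qed
  have eq: "(- \<i>) *s (sigma1 *v g' x) + complex_of_real m *s (sigma3 *v g x) = of_real l *s g x + \<rho> x" for x
  proof -
    define h where "h = of_real (profile \<delta> s x) * e x"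
    have "((- \<i>) *s (sigma1 *v g' x) + complex_of_real m *s (sigma3 *v g x)) $ 1 = h * (of_real p * w$2 + of_real m * w$1) + \<rho> x $ 1"
      unfolding dirac_expression_nth
      by (simp add: g g'_def \<rho>_def h_def mat2_vec_nth sigma1_def algebra_simps)
    moreover have "((- \<i>) *s (sigma1 *v g' x) + complex_of_real m *s (sigma3 *v g x)) $ 2 = h * (of_real p * w$1 - of_real m * w$2) + \<rho> x $ 2"
      unfolding dirac_expression_nth
      by (simp add: g g'_def \<rho>_def h_def mat2_vec_nth sigma1_def algebra_simps)
    ultimately show ?thesis
      unfolding vec2_eq_iff w by (simp add: g h_def algebra_simps)
  qed
  have "(abs_spinor g, of_real l *\<^sub>C abs_spinor g + abs_spinor \<rho>) \<in> free_dirac m"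
    by (rule free_diracI[OF g_si g'_si ac])
      (simp_all only: eq abs_spinor_scaleC[OF g_si] abs_spinor_add[OF square_integrable_scale[OF g_si] \<rho>_si])
  moreover have "norm (abs_spinor \<rho>) \<le> \<delta> * norm (abs_spinor g)"
  proof -
    have "(norm (abs_spinor \<rho>))\<^sup>2 \<le> (LINT x|lborel. \<delta>\<^sup>2 * (norm (g x))\<^sup>2)"
      unfolding norm_abs_spinor_power2[OF \<rho>_si]
    proof (rule integral_mono)
      show "(norm (\<rho> x))\<^sup>2 \<le> \<delta>\<^sup>2 * (norm (g x))\<^sup>2" for x
        using power_mono[OF \<rho>_bound norm_ge_zero, of x 2] by (simp add: power_mult_distrib)
    qed (use \<rho>_si g_si in \<open>simp_all add: square_integrable_def\<close>)
    also have "\<dots> = (\<delta> * norm (abs_spinor g))\<^sup>2"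
      by (simp add: power_mult_distrib norm_abs_spinor_power2[OF g_si])
    finally show ?thesis
      by (rule power2_le_imp_le) (use \<delta> in simp)
  qed
  ultimately show ?thesis by blast
qed

text \<open>At every fixed point the profile tends to 0 as its centre moves off, and the integrable
  function W |w|^2 dominates.\<close>

lemma (in half_potential) wave_packet_escapes:
  assumes \<delta>: "0 < \<delta>"
  shows "square_integrable (\<lambda>x. a x *v wave_packet p w \<delta> s x)"
    and "(\<lambda>n. norm (abs_spinor (\<lambda>x. a x *v wave_packet p w \<delta> (real n) x))) \<longlonglongrightarrow> 0"
proof -
  show si: "square_integrable (\<lambda>x. a x *v wave_packet p w \<delta> s x)" for s
  proof (rule L2_bound_of_bounded(1)[of _ "norm w"])
    show "norm (wave_packet p w \<delta> s x) \<le> norm w" for x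
      using mult_right_mono[OF profile_bounds(2) norm_ge_zero[of w]] by (simp add: norm_wave_packet)
  qed auto
  have dom: "(norm (a x *v wave_packet p w \<delta> s x))\<^sup>2 \<le> W x * (norm w)\<^sup>2 * (profile \<delta> s x)\<^sup>2" for x s
    using bound[of x "wave_packet p w \<delta> s x"] by (simp add: norm_wave_packet power_mult_distrib mult_ac)
  have "(\<lambda>n. LINT x|lborel. (norm (a x *v wave_packet p w \<delta> (real n) x))\<^sup>2) \<longlonglongrightarrow> (LINT x::real|lborel. 0)"
  proof (rule integral_dominated_convergence[where w = "\<lambda>x. W x * (norm w)\<^sup>2"])
    show "integrable lborel (\<lambda>x. W x * (norm w)\<^sup>2)"
      using W_int by simp
    show "AE x in lborel. norm ((norm (a x *v wave_packet p w \<delta> (real n) x))\<^sup>2) \<le> W x * (norm w)\<^sup>2" for n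
    proof (rule AE_I2)
      fix x
      have "W x * (norm w)\<^sup>2 * (profile \<delta> (real n) x)\<^sup>2 \<le> W x * (norm w)\<^sup>2 * 1"
        using W_nonneg profile_bounds[of \<delta> "real n" x]
        by (intro mult_left_mono) (auto simp: power_le_one)
      with dom[of x "real n"] show "norm ((norm (a x *v wave_packet p w \<delta> (real n) x))\<^sup>2) \<le> W x * (norm w)\<^sup>2"
        by simp
    qed
    have "(\<lambda>n. (norm (a x *v wave_packet p w \<delta> (real n) x))\<^sup>2) \<longlonglongrightarrow> 0" for x
    proof (rule tendsto_sandwich[OF _ _ tendsto_const])
      show "eventually (\<lambda>n. 0 \<le> (norm (a x *v wave_packet p w \<delta> (real n) x))\<^sup>2) sequentially" by simp
      show "eventually (\<lambda>n. (norm (a x *v wave_packet p w \<delta> (real n) x))\<^sup>2 \<le> W x * (norm w)\<^sup>2 * (profile \<delta> (real n) x)\<^sup>2) sequentially"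
        using dom by simp
      have "filterlim (\<lambda>n. - x + real n) at_top sequentially"
        by (rule filterlim_tendsto_add_at_top[OF tendsto_const filterlim_real_sequentially])
      then have "filterlim (\<lambda>n. \<delta> * (- x + real n)) at_top sequentially"
        by (rule filterlim_tendsto_pos_mult_at_top[OF tendsto_const \<delta>])
      then have "filterlim (\<lambda>n. (\<delta> * (- x + real n))\<^sup>2) at_top sequentially"
        by (intro filterlim_pow_at_top) auto
      then have "filterlim (\<lambda>n. 1 + (\<delta> * (- x + real n))\<^sup>2) at_top sequentially"
        by (rule filterlim_tendsto_add_at_top[OF tendsto_const])
      from tendsto_inverse_0_at_top[OF this]
      have "(\<lambda>n. inverse (1 + (\<delta> * (- x + real n))\<^sup>2)) \<longlonglongrightarrow> 0" .
      moreover have "(\<delta> * (- x + real n))\<^sup>2 = (\<delta> * (x - real n))\<^sup>2" for n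
        by (simp add: power2_eq_square algebra_simps)
      ultimately have "(\<lambda>n. profile \<delta> (real n) x) \<longlonglongrightarrow> 0"
        by (simp add: profile_def)
      from tendsto_mult[OF tendsto_const[of "W x * (norm w)\<^sup>2"] tendsto_power[OF this, of 2]]
      show "(\<lambda>n. W x * (norm w)\<^sup>2 * (profile \<delta> (real n) x)\<^sup>2) \<longlonglongrightarrow> 0"
        by simp
    qed
    then show "AE x in lborel. (\<lambda>n. (norm (a x *v wave_packet p w \<delta> (real n) x))\<^sup>2) \<longlonglongrightarrow> 0" by simp
  qed auto
  then have "(\<lambda>n. (norm (abs_spinor (\<lambda>x. a x *v wave_packet p w \<delta> (real n) x)))\<^sup>2) \<longlonglongrightarrow> 0"
    by (simp add: norm_abs_spinor_power2 si)
  then have "(\<lambda>n. sqrt ((norm (abs_spinor (\<lambda>x. a x *v wave_packet p w \<delta> (real n) x)))\<^sup>2)) \<longlonglongrightarrow> sqrt 0"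
    by (rule tendsto_real_sqrt)
  then show "(\<lambda>n. norm (abs_spinor (\<lambda>x. a x *v wave_packet p w \<delta> (real n) x))) \<longlonglongrightarrow> 0"
    by simp
qed

section \<open>Location of the spectrum\<close>

text \<open>If a root r of z^2 - m^2 were real, then z^2 = r^2 + m^2 would force z to be real with
  |z| \<ge> |m|. Otherwise r or -r lies in the upper half plane.\<close>

lemma wave_number_exists:
  assumes "\<not> (Im z = 0 \<and> m\<^sup>2 \<le> (Re z)\<^sup>2)"
  shows "\<exists>k. dirac_resolvent m z k"
proof -
  define r where "r = csqrt (z\<^sup>2 - (of_real m)\<^sup>2)"
  have r: "r\<^sup>2 = z\<^sup>2 - (of_real m)\<^sup>2"
    by (simp add: r_def)
  have "Im r \<noteq> 0"
  proof
    assume Im: "Im r = 0"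
    from r have "Re (r\<^sup>2) = Re (z\<^sup>2) - m\<^sup>2" "Im (r\<^sup>2) = Im (z\<^sup>2)"
      by (simp_all flip: of_real_power)
    with Im have 1: "(Re r)\<^sup>2 + m\<^sup>2 + (Im z)\<^sup>2 = (Re z)\<^sup>2" and 2: "Re z = 0 \<or> Im z = 0"
      by (auto simp: power2_eq_square)
    have "Im z = 0"
    proof (rule ccontr)
      assume "Im z \<noteq> 0"
      with 2 1 have "(Re r)\<^sup>2 + m\<^sup>2 + (Im z)\<^sup>2 = 0" "0 < (Im z)\<^sup>2" by auto
      then show False
        using zero_le_power2[of "Re r"] zero_le_power2[of m] by linarith
    qed
    moreover have "m\<^sup>2 \<le> (Re z)\<^sup>2"
      using 1 zero_le_power2[of "Re r"] zero_le_power2[of "Im z"] by linarith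
    ultimately show False using assms by blast
  qed
  then consider "0 < Im r" | "0 < Im (- r)" by fastforce
  then show ?thesis
    using r by (cases; intro exI[of _ r] exI[of _ "- r"]) (auto simp: dirac_resolvent_def)
qed

text \<open>From (z + m)(z - m) = k^2 one gets |\<zeta>|^2 = |z + m| / |z - m|, which turns the
  bound into a condition on the distances from z to m and -m.\<close>

lemma (in dirac_resolvent) green_bound_eq:
  "(2 * green_bound \<zeta>)\<^sup>2 = (cmod (z + of_real m) + cmod (z - of_real m))\<^sup>2 / (cmod (z + of_real m) * cmod (z - of_real m))"
  "0 < cmod (z + of_real m)" "0 < cmod (z - of_real m)"
proof -
  define p q where "p = cmod (z + of_real m)" and "q = cmod (z - of_real m)"
  have pq: "p * q = (cmod k)\<^sup>2"
    unfolding p_def q_def by (metis factorization norm_mult power2_eq_square)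
  have "0 < (cmod k)\<^sup>2" using k_nonzero by simp
  then have pos: "0 < p" "0 < q"
    unfolding pq[symmetric] by (auto simp: zero_less_mult_iff p_def q_def)
  then show "0 < cmod (z + of_real m)" "0 < cmod (z - of_real m)"
    by (simp_all add: p_def q_def)
  have "(cmod \<zeta>)\<^sup>2 = p\<^sup>2 / (p * q)"
    unfolding pq by (simp add: \<zeta>_def p_def norm_divide power_divide)
  also have "\<dots> = p / q"
    using pos by (simp add: power2_eq_square)
  finally have z: "(cmod \<zeta>)\<^sup>2 = p / q" .
  have "(2 * green_bound \<zeta>)\<^sup>2 = 2 + p / q + 1 / (p / q)"
    using pos unfolding green_bound_def z by simp
  also have "\<dots> = (p + q)\<^sup>2 / (p * q)"
    using pos by (simp add: field_simps power2_eq_square)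
  finally show "(2 * green_bound \<zeta>)\<^sup>2 = (cmod (z + of_real m) + cmod (z - of_real m))\<^sup>2 / (cmod (z + of_real m) * cmod (z - of_real m))"
    unfolding p_def q_def .
qed

locale disk_data =
  fixes m v x\<^sub>0 r\<^sub>0 :: real
  assumes m: "0 \<le> m" and v: "0 \<le> v" "v < 1"
    and x0: "x\<^sub>0 = sqrt ((v ^ 4 - 2 * v ^ 2 + 2) / (4 * (1 - v ^ 2)) + 1 / 2)"
    and r0: "r\<^sub>0 = sqrt ((v ^ 4 - 2 * v ^ 2 + 2) / (4 * (1 - v ^ 2)) - 1 / 2)"
begin

definition "disks = closed_disk (m * r\<^sub>0) (complex_of_real (m * x\<^sub>0)) \<union>
  closed_disk (m * r\<^sub>0) (complex_of_real (- m * x\<^sub>0))"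

lemma closed_disks: "closed disks"
  by (auto simp: disks_def closed_disk_def)

lemma v_square: "v\<^sup>2 < 1"
  using v by (simp add: power_less_one_iff abs_square_less_1)

text \<open>The radicands simplify to (2 - v^2)^2 and v^4 over 4 (1 - v^2). Their difference is 1,
  which is the condition for both circles to be circles of Apollonius with respect to m and
  -m.\<close>

lemma x0_square: "x\<^sub>0\<^sup>2 * (4 * (1 - v\<^sup>2)) = (2 - v\<^sup>2)\<^sup>2" and x0_nonneg: "0 \<le> x\<^sub>0"
  and r0_square: "r\<^sub>0\<^sup>2 * (4 * (1 - v\<^sup>2)) = (v\<^sup>2)\<^sup>2" and r0_nonneg: "0 \<le> r\<^sub>0"
  and x0_r0: "x\<^sub>0\<^sup>2 = r\<^sub>0\<^sup>2 + 1"
proof -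
  define t where "t = v\<^sup>2"
  have t: "v ^ 4 = t\<^sup>2" "t < 1"
    using v_square by (simp_all add: t_def)
  have X: "(t\<^sup>2 - 2 * t + 2) / (4 * (1 - t)) + 1 / 2 = (2 - t)\<^sup>2 / (4 * (1 - t))"
    and R: "(t\<^sup>2 - 2 * t + 2) / (4 * (1 - t)) - 1 / 2 = t\<^sup>2 / (4 * (1 - t))"
    using t(2) by (simp_all add: field_simps power2_eq_square)
  have "0 \<le> (2 - t)\<^sup>2 / (4 * (1 - t))" "0 \<le> t\<^sup>2 / (4 * (1 - t))"
    using t(2) by simp_all
  then have x: "0 \<le> x\<^sub>0" "x\<^sub>0\<^sup>2 = (2 - t)\<^sup>2 / (4 * (1 - t))"
    and r: "0 \<le> r\<^sub>0" "r\<^sub>0\<^sup>2 = t\<^sup>2 / (4 * (1 - t))"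
    unfolding x0 r0 t(1) t_def[symmetric] X R by simp_all
  show "x\<^sub>0\<^sup>2 * (4 * (1 - v\<^sup>2)) = (2 - v\<^sup>2)\<^sup>2" "r\<^sub>0\<^sup>2 * (4 * (1 - v\<^sup>2)) = (v\<^sup>2)\<^sup>2"
    unfolding x(2) r(2) t_def[symmetric] using t(2) by simp_all
  show "0 \<le> x\<^sub>0" "0 \<le> r\<^sub>0" by (rule x r)+
  show "x\<^sub>0\<^sup>2 = r\<^sub>0\<^sup>2 + 1"
    unfolding x(2) r(2) using t(2) by (simp add: field_simps power2_eq_square)
qed

lemma r0_less_x0: "r\<^sub>0 < x\<^sub>0"
  using x0_r0 by (intro power2_less_imp_less[OF _ x0_nonneg]) simp

lemma disks_disjoint:
  "closed_disk (m * r\<^sub>0) (complex_of_real (m * x\<^sub>0)) \<inter> closed_disk (m * r\<^sub>0) (complex_of_real (- m * x\<^sub>0)) = {}"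
proof (cases "m * r\<^sub>0 = 0")
  case False
  have "False" if "dist (complex_of_real (m * x\<^sub>0)) w \<le> m * r\<^sub>0" "dist (complex_of_real (- m * x\<^sub>0)) w \<le> m * r\<^sub>0" for w
  proof -
    have "dist (complex_of_real (m * x\<^sub>0)) (complex_of_real (- m * x\<^sub>0)) \<le> 2 * (m * r\<^sub>0)"
      using dist_triangle2[of "complex_of_real (m * x\<^sub>0)" "complex_of_real (- m * x\<^sub>0)" w] that by simp
    then have "2 * (m * x\<^sub>0) \<le> 2 * (m * r\<^sub>0)"
      unfolding dist_of_real dist_real_def using m x0_nonneg by simp
    moreover have "m * r\<^sub>0 < m * x\<^sub>0"
      using False m r0_less_x0 by (intro mult_strict_left_mono) auto
    ultimately show False by simp
  qed
  with False show ?thesis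
    by (auto simp: closed_disk_def)
qed (simp add: closed_disk_def)

text \<open>Circles of Apollonius: with \<open>t = |z + m| / |z - m|\<close>, the complement of the disks is the region
  \<open>t + 1 / t < 4 / v\<^sup>2 - 2\<close>.\<close>

lemma outside_disks:
  assumes z: "z \<notin> disks" and pq: "0 < cmod (z + of_real m)" "0 < cmod (z - of_real m)"
  shows "v\<^sup>2 * (cmod (z + of_real m) + cmod (z - of_real m))\<^sup>2 < 4 * (cmod (z + of_real m) * cmod (z - of_real m))"
proof -
  define p q where "p = cmod (z + of_real m)" and "q = cmod (z - of_real m)"
  have pos: "0 < p" "0 < q" using pq by (simp_all add: p_def q_def)
  have "v\<^sup>2 * (p + q)\<^sup>2 < 4 * (p * q)"
  proof (cases "m * r\<^sub>0 = 0")
    \<comment> \<open>Both disks are empty by convention, so nothing is known about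
      \<open>z\<close>. For m = 0 the two distances agree and v < 1 suffices; for v = 0 the left
      side vanishes.\<close>
    case True
    then consider "m = 0" | "v = 0"
      using r0_square by auto
    then show ?thesis
    proof cases
      case 1
      then have "p = q" by (simp add: p_def q_def)
      then have "v\<^sup>2 * (p + q)\<^sup>2 = 4 * (p * q) * v\<^sup>2"
        by (simp add: power2_eq_square)
      also have "\<dots> < 4 * (p * q) * 1"
        using pos v_square by (intro mult_strict_left_mono) auto
      finally show ?thesis by simp
    qed (use pos in simp)
  next
    case False
    then have "m * r\<^sub>0 < cmod (of_real (m * x\<^sub>0) - z)" "m * r\<^sub>0 < cmod (of_real (- m * x\<^sub>0) - z)"
      using z by (auto simp: disks_def closed_disk_def dist_norm)
    then have "(m * r\<^sub>0)\<^sup>2 < (cmod (of_real (m * x\<^sub>0) - z))\<^sup>2" "(m * r\<^sub>0)\<^sup>2 < (cmod (of_real (- m * x\<^sub>0) - z))\<^sup>2"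
      using m r0_nonneg by (auto intro!: power_strict_mono)
    then have out: "2 * m * x\<^sub>0 * Re z < (Re z)\<^sup>2 + (Im z)\<^sup>2 + m\<^sup>2 * (x\<^sub>0\<^sup>2 - r\<^sub>0\<^sup>2)"
      "- (2 * m * x\<^sub>0 * Re z) < (Re z)\<^sup>2 + (Im z)\<^sup>2 + m\<^sup>2 * (x\<^sub>0\<^sup>2 - r\<^sub>0\<^sup>2)"
      unfolding cmod_power2 by (simp_all add: power2_eq_square algebra_simps)
    have p2: "p\<^sup>2 = (Re z + m)\<^sup>2 + (Im z)\<^sup>2" and q2: "q\<^sup>2 = (Re z - m)\<^sup>2 + (Im z)\<^sup>2"
      unfolding p_def q_def cmod_power2 by simp_all
    \<comment> \<open>In terms of the sum and the difference of the squared distances, lying outside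
      both disks reads |x_0 D| < N. With D^2 = N^2 - (2 p q)^2 this becomes a bound on N by a
      multiple of p q.\<close>
    define N where "N = p\<^sup>2 + q\<^sup>2"
    define D where "D = p\<^sup>2 - q\<^sup>2"
    have N_eq: "N = 2 * ((Re z)\<^sup>2 + (Im z)\<^sup>2 + m\<^sup>2)" and D_eq: "D = 4 * m * Re z"
      unfolding N_def D_def p2 q2 by (simp_all add: power2_eq_square algebra_simps)
    have "\<bar>x\<^sub>0 * D\<bar> < N"
      using out unfolding N_eq D_eq x0_r0 by (simp add: abs_less_iff algebra_simps)
    then have "(x\<^sub>0 * D)\<^sup>2 < N\<^sup>2"
      by (metis abs_ge_zero power2_abs power_strict_mono zero_less_numeral)
    then have "(x\<^sub>0 * D)\<^sup>2 * (4 * (1 - v\<^sup>2)) < N\<^sup>2 * (4 * (1 - v\<^sup>2))"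
      using v_square by (intro mult_strict_right_mono) auto
    then have "(2 - v\<^sup>2)\<^sup>2 * D\<^sup>2 < N\<^sup>2 * (4 * (1 - v\<^sup>2))"
      unfolding x0_square[symmetric] by (simp add: power_mult_distrib mult_ac)
    moreover have "D\<^sup>2 = N\<^sup>2 - (2 * (p * q))\<^sup>2"
      unfolding N_def D_def by (simp add: power2_eq_square algebra_simps)
    then have "(2 - v\<^sup>2)\<^sup>2 * D\<^sup>2 = (2 - v\<^sup>2)\<^sup>2 * N\<^sup>2 - ((2 - v\<^sup>2) * (2 * (p * q)))\<^sup>2"
      by (simp add: right_diff_distrib power_mult_distrib)
    moreover have "(2 - v\<^sup>2)\<^sup>2 * N\<^sup>2 = N\<^sup>2 * (4 * (1 - v\<^sup>2)) + (N * v\<^sup>2)\<^sup>2"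
      by (simp add: power2_eq_square algebra_simps)
    ultimately have "(N * v\<^sup>2)\<^sup>2 < ((2 - v\<^sup>2) * (2 * (p * q)))\<^sup>2"
      by linarith
    then have "N * v\<^sup>2 < (2 - v\<^sup>2) * (2 * (p * q))"
      using v_square pos by (intro power2_less_imp_less[of "N * v\<^sup>2"]) auto
    then show ?thesis
      unfolding N_def by (simp add: power2_eq_square algebra_simps)
  qed
  then show ?thesis by (simp add: p_def q_def)
qed

lemma green_bound_outside_disks:
  assumes "dirac_resolvent m z k" and z: "z \<notin> disks"
  shows "green_bound (dirac_resolvent.\<zeta> m z k) * v < 1"
proof -
  interpret dirac_resolvent m z k by fact
  define p q where "p = cmod (z + of_real m)" and "q = cmod (z - of_real m)"
  note pos = green_bound_eq(2,3)[folded p_def q_def]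
  have "(2 * green_bound \<zeta> * v)\<^sup>2 = v\<^sup>2 * (p + q)\<^sup>2 / (p * q)"
    using green_bound_eq(1) by (simp add: power_mult_distrib p_def q_def)
  also have "\<dots> < 4"
    using outside_disks[OF z green_bound_eq(2,3)] pos
    by (simp add: p_def[symmetric] q_def[symmetric] pos_divide_less_eq)
  finally have "(2 * green_bound \<zeta> * v)\<^sup>2 < 2\<^sup>2" by simp
  then have "2 * green_bound \<zeta> * v < 2"
    by (rule power2_less_imp_less) simp
  then show ?thesis by simp
qed

end

text \<open>The symbol p \<sigma>_1 + m \<sigma>_3 has the eigenvalues with l^2 = p^2 + m^2, which
  determines p. The eigenvector (l + m, p) vanishes for l = -m, hence the separate case.\<close>

lemma dirac_momentum_eigenvector:
  assumes "m\<^sup>2 \<le> (l::real)\<^sup>2"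
  shows "\<exists>p w. w \<noteq> (0::complex^2) \<and> of_real p * w$2 + of_real m * w$1 = of_real l * w$1 \<and>
    of_real p * w$1 - of_real m * w$2 = of_real l * w$2"
proof (cases "l = - m")
  case True
  then show ?thesis
    by (intro exI[of _ 0] exI[of _ "vector [0, 1]"]) (simp add: vec2_eq_iff)
next
  case False
  define p where "p = sqrt (l\<^sup>2 - m\<^sup>2)"
  have "p\<^sup>2 = l\<^sup>2 - m\<^sup>2"
    using assms by (simp add: p_def)
  then have p: "complex_of_real p * of_real p = of_real l * of_real l - of_real m * of_real m"
    by (simp add: power2_eq_square flip: of_real_mult of_real_diff)
  have "of_real l + of_real m \<noteq> (0::complex)"
    using False by (metis add_eq_0_iff of_real_add of_real_eq_0_iff add.commute)
  then show ?thesis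
    by (intro exI[of _ p] exI[of _ "vector [of_real l + of_real m, of_real p]"])
      (simp add: vec2_eq_iff p algebra_simps)
qed

lemma is_dirac_operatorD:
  assumes "is_dirac_operator m V H" "z \<in> resolvent_set (free_dirac m)" "- 1 \<in> resolvent_set (op_Q m V z)"
  shows "z \<in> resolvent_set H"
    and "resolvent H z = op_diff (resolvent (free_dirac m) z)
          (closure (resolvent (free_dirac m) z \<cdot>\<^sub>o op_B V) \<cdot>\<^sub>o
           resolvent (op_Q m V z) (- 1) \<cdot>\<^sub>o op_A V \<cdot>\<^sub>o resolvent (free_dirac m) z)"
proof -
  have "z \<in> resolvent_set H \<inter> resolvent_set (free_dirac m)"
    using assms unfolding is_dirac_operator_def by blast
  with assms(1) show "z \<in> resolvent_set H"
    and "resolvent H z = op_diff (resolvent (free_dirac m) z)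
          (closure (resolvent (free_dirac m) z \<cdot>\<^sub>o op_B V) \<cdot>\<^sub>o
           resolvent (op_Q m V z) (- 1) \<cdot>\<^sub>o op_A V \<cdot>\<^sub>o resolvent (free_dirac m) z)"
    unfolding is_dirac_operator_def by blast+
qed

text \<open>Wave packets translated to infinity do not see the potential, so there \<open>(H - z)\<^sup>-\<^sup>1\<close> is as
  large as \<open>(H\<^sub>0 - z)\<^sup>-\<^sup>1\<close>, which blows up as \<open>z\<close> approaches the spectrum of \<open>H\<^sub>0\<close>.\<close>

lemma real_in_spectrum:
  assumes H: "is_dirac_operator m V H" and V: "\<And>i j. integrable lborel (\<lambda>x. V x $ i $ j)"
    and l: "m\<^sup>2 \<le> l\<^sup>2" and e0: "0 < e0"
    and near: "\<And>e. 0 < e \<Longrightarrow> e < e0 \<Longrightarrow>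
      \<exists>k. dirac_resolvent m (Complex l e) k \<and> green_bound (dirac_resolvent.\<zeta> m (Complex l e) k) * potential_norm V < 1"
  shows "complex_of_real l \<in> spectrum H"
proof (rule ccontr)
  assume "complex_of_real l \<notin> spectrum H"
  then have "complex_of_real l \<in> resolvent_set H"
    by (simp add: spectrum_def)
  then obtain C where C: "bounded_rel C (resolvent H (of_real l))" "0 \<le> C"
    by (rule resolvent_setE)
  \<comment> \<open>This makes \<open>C * e\<close> at most 1/8. The final inequality is then |u|
    \<le> (2 c + |u|)/8, that is |u| \<le> 2 c/7, contradicting |u| \<ge> c/2.\<close>
  define e where "e = min (e0 / 2) (1 / (8 * (C + 1)))"
  have e: "0 < e" "e < e0"
    using e0 C(2) by (auto simp: e_def)
  have "C * e \<le> C * (1 / (8 * (C + 1)))"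
    using C(2) by (intro mult_left_mono) (auto simp: e_def)
  also have "\<dots> \<le> 1 / 8"
    using C(2) by (simp add: field_simps)
  finally have Ce: "C * e \<le> 1 / 8" .
  define z where "z = Complex l e"
  obtain k where "dirac_resolvent m z k" and small: "green_bound (dirac_resolvent.\<zeta> m z k) * potential_norm V < 1"
    using near[OF e] unfolding z_def by blast
  then interpret dirac_potential m z k V
    using V by (simp add: dirac_potential_def dirac_potential_axioms_def)
  have zR: "z \<in> resolvent_set (free_dirac m)"
    by (rule free_resolvent_set)
  have zQ: "- 1 \<in> resolvent_set (op_Q m V z)"
    by (rule minus_one_in_resolvent_set_Q[OF small])
  have zH: "z \<in> resolvent_set H"
    by (rule is_dirac_operatorD(1)[OF H zR zQ])
  note RH = is_dirac_operatorD(2)[OF H zR zQ]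
  \<comment> \<open>\<open>KB\<close> and \<open>KQ\<close> depend on \<open>z\<close>, hence on
    \<open>e\<close>, but they are fixed before the packet is translated; no control as e tends to 0
    is required.\<close>
  obtain KB where KB: "0 \<le> KB" "bounded_rel KB (closure (R0 \<cdot>\<^sub>o op_B V))"
    using bounded_rel_RB by blast
  obtain KQ where KQ: "bounded_rel KQ (resolvent (op_Q m V z) (- 1))" "0 \<le> KQ"
    using zQ by (rule resolvent_setE)
  have sv: "single_valued (R0)"
    using zR by (rule resolvent_setE)
  have total: "Domain (resolvent H z) = UNIV"
    using zH by (rule resolvent_setE)
  obtain p and w :: "complex^2" where w: "w \<noteq> 0" "of_real p * w$2 + of_real m * w$1 = of_real l * w$1"
    "of_real p * w$1 - of_real m * w$2 = of_real l * w$2"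
    using dirac_momentum_eigenvector[OF l] by blast
  define c where "c = norm w * sqrt (LINT x|lborel. (profile e 0 x)\<^sup>2)"
  have c: "0 < c"
    using w(1) integral_profile_square_pos[OF e(1)] by (simp add: c_def)
  \<comment> \<open>The threshold makes the correction term, of norm at most \<open>KB * KQ\<close>
    times that of A g, no larger than c/2; the summand 1 covers \<open>KB * KQ = 0\<close>.\<close>
  then have "0 < c / (2 * (KB * KQ + 1))"
    using KB KQ by (intro divide_pos_pos) (auto simp: add_nonneg_pos)
  with A.wave_packet_escapes(2)[OF e(1), of p w] obtain n where
    n: "norm (abs_spinor (\<lambda>x. mat_sqrt (mat_abs (V x)) *v wave_packet p w e (real n) x)) < c / (2 * (KB * KQ + 1))"
    by (metis (no_types, lifting) order_tendstoD(2) eventually_happens trivial_limit_sequentially)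
  define g where "g = wave_packet p w e (real n)"
  have g_si: "square_integrable g"
    unfolding g_def by (rule square_integrable_wave_packet[OF e(1)])
  have g_norm: "norm (abs_spinor g) = c"
    unfolding g_def c_def by (rule norm_abs_wave_packet[OF e(1)])
  obtain r where r: "(abs_spinor g, of_real l *\<^sub>C abs_spinor g + r) \<in> free_dirac m" "norm r \<le> e * c"
    using wave_packet_approximate_eigenvector[OF e(1) w(2,3), of "real n"] unfolding g_norm[symmetric] unfolding g_def by blast
  \<comment> \<open>This is (H_0 - z) g. Both the packet error \<open>r\<close> and the shift from
    \<open>l\<close> to \<open>z\<close> contribute at most e c to its norm.\<close>
  define f where "f = r + (of_real l - z) *\<^sub>C abs_spinor g"
  have diff: "of_real l - z = - (\<i> * of_real e)" "z - of_real l = \<i> * of_real e"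
    by (simp_all add: z_def complex_eq_iff)
  have f_norm: "norm f \<le> 2 * (e * c)"
    unfolding f_def using norm_triangle_ineq[of r "(of_real l - z) *\<^sub>C abs_spinor g"] r(2) e(1)
    by (simp add: norm_scaleC g_norm diff norm_mult)
  have "f + z *\<^sub>C abs_spinor g = of_real l *\<^sub>C abs_spinor g + r"
    by (simp add: f_def complex_vector.scale_left_diff_distrib)
  then have fg: "(f, abs_spinor g) \<in> R0"
    using r(1) by (simp add: mem_resolvent_iff)
  obtain u where u: "(f, u) \<in> resolvent H z"
    using total by blast
  then obtain g2 g3 a b h where uh: "u = g2 - h" "(f, g2) \<in> R0"
    "(f, g3) \<in> R0" "(g3, a) \<in> op_A V" "(a, b) \<in> resolvent (op_Q m V z) (- 1)"
    "(b, h) \<in> closure (R0 \<cdot>\<^sub>o op_B V)"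
    unfolding RH op_diff_def by blast
  have g23: "g2 = abs_spinor g" "g3 = abs_spinor g"
    using sv fg uh(2,3) by (auto simp: single_valued_def)
  have "a = abs_spinor (\<lambda>x. mat_sqrt (mat_abs (V x)) *v g x)"
    using uh(4) unfolding g23 op_A_def mult_op_iff[OF A.a g_si] by blast
  then have a: "norm a \<le> c / (2 * (KB * KQ + 1))"
    using n by (simp add: g_def)
  have "norm h \<le> KB * norm b"
    by (rule bounded_relD[OF KB(2) uh(6)])
  also have "\<dots> \<le> KB * (KQ * norm a)"
    by (intro mult_left_mono KB(1) bounded_relD[OF KQ(1) uh(5)])
  also have "\<dots> \<le> KB * (KQ * (c / (2 * (KB * KQ + 1))))"
    by (intro mult_left_mono KB(1) KQ(2) a)
  also have "\<dots> \<le> c / 2"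
  proof -
    have "0 \<le> KB * KQ" using KB(1) KQ(2) by simp
    then show ?thesis using c by (simp add: field_simps)
  qed
  finally have h: "norm h \<le> c / 2" .
  have u_lower: "c / 2 \<le> norm u"
    using norm_triangle_ineq2[of "abs_spinor g" h] h by (simp add: uh(1) g23 g_norm)
  have "(u, f + z *\<^sub>C u) \<in> H"
    using u by (simp add: mem_resolvent_iff)
  \<comment> \<open>Since (H - z) u = f, one has (H - l) u = f + (z - l) u. The resolvent at
    \<open>l\<close>, assumed bounded by \<open>C\<close>, must return \<open>u\<close> from this
    small argument.\<close>
  then have "(f + (z - of_real l) *\<^sub>C u, u) \<in> resolvent H (of_real l)"
    by (simp add: mem_resolvent_iff complex_vector.scale_left_diff_distrib)
  then have "norm u \<le> C * norm (f + (z - of_real l) *\<^sub>C u)"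
    by (rule bounded_relD[OF C(1)])
  also have "\<dots> \<le> C * (2 * (e * c) + e * norm u)"
    using norm_triangle_ineq[of f "(z - of_real l) *\<^sub>C u"] f_norm e(1)
    by (intro mult_left_mono C(2)) (simp add: norm_scaleC diff norm_mult)
  also have "\<dots> = (C * e) * (2 * c + norm u)"
    by (simp add: algebra_simps)
  also have "\<dots> \<le> 1 / 8 * (2 * c + norm u)"
    using c by (intro mult_right_mono Ce) simp
  finally show False
    using u_lower c by simp
qed

theorem theorem2p1:
  fixes m v x\<^sub>0 r\<^sub>0 :: real and V :: "real \<Rightarrow> complex^2^2" and H :: "spinor op"
  assumes "m \<ge> 0"
    and "\<And>i j. integrable lborel (\<lambda>x. V x $ i $ j)"
    and "v = potential_norm V"
    and "v < 1"
    and "is_dirac_operator m V H"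
    and "x\<^sub>0 = sqrt ((v ^ 4 - 2 * v ^ 2 + 2) / (4 * (1 - v ^ 2)) + 1 / 2)"
    and "r\<^sub>0 = sqrt ((v ^ 4 - 2 * v ^ 2 + 2) / (4 * (1 - v ^ 2)) - 1 / 2)"
  shows "closed_disk (m * r\<^sub>0) (complex_of_real (m * x\<^sub>0)) \<inter>
           closed_disk (m * r\<^sub>0) (complex_of_real (- m * x\<^sub>0)) = {}
       \<and> discrete_spectrum H \<subseteq>
           closed_disk (m * r\<^sub>0) (complex_of_real (m * x\<^sub>0)) \<union>
           closed_disk (m * r\<^sub>0) (complex_of_real (- m * x\<^sub>0))
       \<and> (m = 0 \<longrightarrow> spectrum H = \<real>)"
proof -
  have "0 \<le> onorm (\<lambda>w. V x *v w)" for x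
    by (rule onorm_pos_le[OF bounded_linear_mat2])
  then have "0 \<le> v"
    by (simp add: assms(3) potential_norm_def)
  then interpret disk_data m v x\<^sub>0 r\<^sub>0
    using assms by unfold_locales
  have off_axis: "z \<in> resolvent_set H" if z: "z \<notin> disks" "\<not> (Im z = 0 \<and> m\<^sup>2 \<le> (Re z)\<^sup>2)" for z
  proof -
    obtain k where kz: "dirac_resolvent m z k"
      using wave_number_exists[OF z(2)] by blast
    then interpret dirac_potential m z k V
      using assms(2) by (simp add: dirac_potential_def dirac_potential_axioms_def)
    have "- 1 \<in> resolvent_set (op_Q m V z)"
      using green_bound_outside_disks[OF kz z(1)] by (intro minus_one_in_resolvent_set_Q) (simp add: assms(3))
    then show ?thesis
      by (intro is_dirac_operatorD(1)[OF assms(5)] free_resolvent_set)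
  qed
  have on_axis: "of_real l \<in> spectrum H" if l: "complex_of_real l \<notin> disks" "m\<^sup>2 \<le> l\<^sup>2" for l
  proof -
    \<comment> \<open>Closedness of the disks provides a vertical segment above \<open>l\<close> on
      which the estimate of Q holds.\<close>
    have "open (- disks)" using closed_disks by (simp add: open_Compl)
    then obtain e0 where e0: "0 < e0" "ball (complex_of_real l) e0 \<subseteq> - disks"
      using l(1) by (meson ComplI openE)
    show ?thesis
    proof (rule real_in_spectrum[OF assms(5,2) l(2) e0(1)])
      fix e :: real assume e: "0 < e" "e < e0"
      have "complex_of_real l - Complex l e = - (\<i> * of_real e)"
        by (simp add: complex_eq_iff)
      then have "Complex l e \<in> ball (complex_of_real l) e0"
        using e by (simp add: dist_norm norm_mult)
      with e0(2) have out: "Complex l e \<notin> disks" by blast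
      obtain k where k: "dirac_resolvent m (Complex l e) k"
        using wave_number_exists[of "Complex l e" m] e(1) by auto
      with green_bound_outside_disks[OF k out] assms(3)
      show "\<exists>k. dirac_resolvent m (Complex l e) k \<and>
          green_bound (dirac_resolvent.\<zeta> m (Complex l e) k) * potential_norm V < 1"
        by blast
    qed
  qed
  have "discrete_spectrum H \<subseteq> disks"
  proof
    fix z assume z: "z \<in> discrete_spectrum H"
    show "z \<in> disks"
    proof (rule ccontr)
      assume out: "z \<notin> disks"
      from z obtain T where T: "open T" "T \<inter> spectrum H = {z}" and zs: "z \<in> spectrum H"
        by (auto simp: discrete_spectrum_def isolated_in_def)
      have ax: "Im z = 0" "m\<^sup>2 \<le> (Re z)\<^sup>2"
        using off_axis[OF out] zs by (auto simp: spectrum_def)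
      have "open (T \<inter> - disks)" "z \<in> T \<inter> - disks"
        using T closed_disks out by (auto simp: open_Int open_Compl)
      then obtain e where e: "0 < e" "ball z e \<subseteq> T \<inter> - disks"
        by (meson openE)
      \<comment> \<open>The neighbour is taken on the side away from the gap, so that |l| \<ge> |Re
        z| \<ge> m. At distance e/2 it stays in the ball and is a second point of the spectrum
        there.\<close>
      define l where "l = Re z + (if 0 \<le> Re z then e / 2 else - (e / 2))"
      have "\<bar>Re z\<bar> \<le> \<bar>l\<bar>"
        using e(1) by (auto simp: l_def)
      then have l: "m\<^sup>2 \<le> l\<^sup>2"
        using ax(2) by (meson abs_le_square_iff order.trans)
      have "z - of_real l = of_real (Re z - l)"
        using ax(1) by (simp add: complex_eq_iff)
      then have "dist z (of_real l) = e / 2"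
        using e(1) by (simp add: dist_norm l_def del: of_real_diff)
      with e have mem: "complex_of_real l \<in> T" "complex_of_real l \<notin> disks"
        by (auto simp: subset_iff)
      with on_axis[OF mem(2) l] T(2) have "of_real l = z" by blast
      with \<open>dist z (of_real l) = e / 2\<close> e(1) show False by simp
    qed
  qed
  moreover have "spectrum H = \<real>" if "m = 0"
  proof -
    \<comment> \<open>The radius is 0 and the convention makes the disks empty, so the two preceding
      facts decide every point of the plane.\<close>
    have "disks = {}" unfolding disks_def using that by (simp add: closed_disk_def)
    show ?thesis
    proof (intro set_eqI iffI)
      fix z assume "z \<in> spectrum H"
      then have "Im z = 0"
        using off_axis[of z] \<open>disks = {}\<close> by (auto simp: spectrum_def)
      then show "z \<in> \<real>"
        by (simp add: complex_is_Real_iff)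
    next
      fix z :: complex assume "z \<in> \<real>"
      then show "z \<in> spectrum H"
        using on_axis \<open>disks = {}\<close> that by (auto elim: Reals_cases)
    qed
  qed
  ultimately show ?thesis
    using disks_disjoint unfolding disks_def by blast
qed

end
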